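(* Let $G$ be a finite cut group of exponent dividing the positive integer $n$ and let $\zeta$ be a primitive complex $n$-th root of unity. Then the natural actions of $\operatorname{Gal}(\mathbb{Q}(\zeta)/\mathbb{Q})$ on the set of conjugacy classes of $G$ and on the set $\operatorname{Irr}(G)$ of irreducible complex characters of $G$ are permutation isomorphic. In particular, the number of rational irreducible characters of $G$ is equal to the number of rational conjugacy classes of $G$.
   Context: A finite group $G$ is called a cut group if all central units of its integral group ring are trivial, i.e. $\mathcal{Z}(\mathcal{U}(\mathbb{Z}G)) = \pm \mathcal{Z}(G)$, where $\mathcal{U}(R)$ denotes the unit group of a ring $R$ and $\mathcal{Z}(\cdot)$ denotes the center. Natural actions: each $\sigma \in \operatorname{Gal}(\mathbb{Q}(\zeta)/\mathbb{Q})$ is determined by $\sigma(\zeta) = \zeta^{m}$ for an integer $m = m(\sigma)$ coprime to $n$, unique modulo $n$. The group $\operatorname{Gal}(\mathbb{Q}(\zeta)/\mathbb{Q})$ acts on $\operatorname{Irr}(G)$ by $\chi^\sigma = \sigma^{-1} \circ \chi$, and on the set of conjugacy classes of $G$ by $(x^G)^\sigma = (x^{m(\sigma)})^G$, where $x^G$ is the conjugacy class of $x\in G$. Two actions of a group $\Gamma$ on sets $X$ and $Y$ are called permutation isomorphic if there is a bijection $\alpha \colon X \to Y$ with $\alpha(x^g) = \alpha(x)^g$ for all $x \in X$ and all $g \in \Gamma$. A character $\chi$ is called rational if all its values are rational, i.e. $\mathbb{Q}(\chi)=\mathbb{Q}$. An element $x \in G$ is called rational in $G$ if $x^j$ is conjugate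 to $x$ in $G$ for all integers $j$ coprime to the order of $x$; a conjugacy class is called rational if it consists of elements rational in $G$. *)

theory Defs
  imports
    "HOL-Algebra.Algebra"
    "Jordan_Normal_Form.VS_Connect"
begin

section \<open>Integral group rings and cut groups\<close>

definition center :: "('a, 'b) monoid_scheme \<Rightarrow> 'a set" where
  "center M = {z \<in> carrier M. \<forall>x\<in>carrier M. z \<otimes>\<^bsub>M\<^esub> x = x \<otimes>\<^bsub>M\<^esub> z}"

text \<open>
  The integral group ring of a \<^emph>\<open>finite\<close> group: a formal sum is its coefficient function,
  so that multiplication is convolution. No finite-support condition is imposed, and the
  coefficient functions are extensional so that equality is equality on \<open>carrier G\<close>.
\<close>
definition int_group_ring :: "('a, 'b) monoid_scheme \<Rightarrow> ('a \<Rightarrow> int) ring" where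
  "int_group_ring G =
     \<lparr> carrier = extensional (carrier G),
       monoid.mult = (\<lambda>f h. \<lambda>x\<in>carrier G. \<Sum>y\<in>carrier G. f y * h (inv\<^bsub>G\<^esub> y \<otimes>\<^bsub>G\<^esub> x)),
       one = (\<lambda>x\<in>carrier G. if x = \<one>\<^bsub>G\<^esub> then 1 else 0),
       ring.zero = (\<lambda>x\<in>carrier G. 0),
       add = (\<lambda>f h. \<lambda>x\<in>carrier G. f x + h x) \<rparr>"

definition group_ring_elem :: "('a, 'b) monoid_scheme \<Rightarrow> 'a \<Rightarrow> ('a \<Rightarrow> int)" where
  "group_ring_elem G g = (\<lambda>x\<in>carrier G. if x = g then 1 else 0)"

definition cut_group :: "('a, 'b) monoid_scheme \<Rightarrow> bool" where
  "cut_group G \<longleftrightarrow> group G \<and> finite (carrier G) \<and>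
     center (units_of (int_group_ring G)) =
       group_ring_elem G ` center G \<union>
       (\<lambda>z. \<ominus>\<^bsub>int_group_ring G\<^esub> group_ring_elem G z) ` center G"

definition group_exponent :: "('a, 'b) monoid_scheme \<Rightarrow> nat" where
  "group_exponent G = (LCM x\<in>carrier G. group.ord G x)"

section \<open>Conjugacy classes\<close>

abbreviation conjugation :: "('a, 'b) monoid_scheme \<Rightarrow> 'a \<Rightarrow> 'a \<Rightarrow> 'a" where
  "conjugation G \<equiv> (\<lambda>g. \<lambda>h\<in>carrier G. g \<otimes>\<^bsub>G\<^esub> h \<otimes>\<^bsub>G\<^esub> inv\<^bsub>G\<^esub> g)"

definition conj_class :: "('a, 'b) monoid_scheme \<Rightarrow> 'a \<Rightarrow> 'a set" where
  "conj_class G x = orbit G (conjugation G) x"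

definition conj_classes :: "('a, 'b) monoid_scheme \<Rightarrow> 'a set set" where
  "conj_classes G = orbits G (carrier G) (conjugation G)"

definition rational_elem :: "('a, 'b) monoid_scheme \<Rightarrow> 'a \<Rightarrow> bool" where
  "rational_elem G x \<longleftrightarrow>
     (\<forall>j::int. coprime j (int (group.ord G x)) \<longrightarrow> x [^]\<^bsub>G\<^esub> j \<in> conj_class G x)"

definition rational_class :: "('a, 'b) monoid_scheme \<Rightarrow> 'a set \<Rightarrow> bool" where
  "rational_class G C \<longleftrightarrow> (\<forall>x\<in>C. rational_elem G x)"

section \<open>Irreducible complex characters\<close>

definition general_linear :: "nat \<Rightarrow> complex mat monoid" where
  "general_linear d = units_of (ring_mat TYPE(complex) d ())"

definition mat_trace :: "complex mat \<Rightarrow> complex" where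
  "mat_trace A = (\<Sum>i<dim_row A. A $$ (i, i))"

definition irreducible_rep ::
    "('a, 'b) monoid_scheme \<Rightarrow> nat \<Rightarrow> ('a \<Rightarrow> complex mat) \<Rightarrow> bool" where
  "irreducible_rep G d \<rho> \<longleftrightarrow>
     \<rho> \<in> hom G (general_linear d) \<and> d > 0 \<and>
     (\<forall>W. VectorSpace.subspace class_ring W (module_vec TYPE(complex) d) \<longrightarrow>
          (\<forall>g\<in>carrier G. \<forall>w\<in>W. \<rho> g *\<^sub>v w \<in> W) \<longrightarrow>
          W = {0\<^sub>v d} \<or> W = carrier_vec d)"

definition Irr :: "('a, 'b) monoid_scheme \<Rightarrow> ('a \<Rightarrow> complex) set" where
  "Irr G = {\<lambda>g\<in>carrier G. mat_trace (\<rho> g) | d \<rho>. irreducible_rep G d \<rho>}"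

definition rational_character :: "('a, 'b) monoid_scheme \<Rightarrow> ('a \<Rightarrow> complex) \<Rightarrow> bool" where
  "rational_character G \<chi> \<longleftrightarrow> (\<forall>g\<in>carrier G. \<chi> g \<in> \<rat>)"

section \<open>Galois groups of cyclotomic fields and their natural actions\<close>

definition primitive_root_of_unity :: "nat \<Rightarrow> complex \<Rightarrow> bool" where
  "primitive_root_of_unity n \<zeta> \<longleftrightarrow> \<zeta> ^ n = 1 \<and> (\<forall>k. 0 < k \<and> k < n \<longrightarrow> \<zeta> ^ k \<noteq> 1)"

definition galois_group :: "complex set \<Rightarrow> complex set \<Rightarrow> (complex \<Rightarrow> complex) monoid" where
  "galois_group L K = BijGroup L
     \<lparr> carrier := {\<sigma> \<in> Bij L. \<sigma> \<in> ring_iso (class_ring\<lparr>carrier := L\<rparr>) (class_ring\<lparr>carrier := L\<rparr>) \<and>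
                              (\<forall>q\<in>K. \<sigma> q = q)} \<rparr>"

definition cyclotomic_field :: "complex \<Rightarrow> complex set" where
  "cyclotomic_field \<zeta> = generate_field class_ring (\<rat> \<union> {\<zeta>})"

abbreviation cyclotomic_galois :: "complex \<Rightarrow> (complex \<Rightarrow> complex) monoid" where
  "cyclotomic_galois \<zeta> \<equiv> galois_group (cyclotomic_field \<zeta>) \<rat>"

text \<open>The choice below is unique only modulo \<open>n\<close>.\<close>
definition galois_exp :: "nat \<Rightarrow> complex \<Rightarrow> (complex \<Rightarrow> complex) \<Rightarrow> int" where
  "galois_exp n \<zeta> \<sigma> = (SOME m. coprime m (int n) \<and> \<sigma> \<zeta> = \<zeta> powi m)"

definition character_action ::
    "('a, 'b) monoid_scheme \<Rightarrow> complex \<Rightarrow> ('a \<Rightarrow> complex) \<Rightarrow> (complex \<Rightarrow> complex) \<Rightarrow> ('a \<Rightarrow> complex)"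
  where
  "character_action G \<zeta> \<chi> \<sigma> = (\<lambda>g\<in>carrier G. (inv\<^bsub>cyclotomic_galois \<zeta>\<^esub> \<sigma>) (\<chi> g))"

text \<open>
  The class of \<open>x [^] m\<close> does not depend on the representative \<open>x\<close> of \<open>C\<close>, so the union
  below is over one and the same class.
\<close>
definition class_action ::
    "('a, 'b) monoid_scheme \<Rightarrow> nat \<Rightarrow> complex \<Rightarrow> 'a set \<Rightarrow> (complex \<Rightarrow> complex) \<Rightarrow> 'a set" where
  "class_action G n \<zeta> C \<sigma> = (\<Union>x\<in>C. conj_class G (x [^]\<^bsub>G\<^esub> galois_exp n \<zeta> \<sigma>))"

section \<open>Permutation isomorphic actions\<close>

text \<open>
  Actions are written exponentially on the right, \<open>act x g\<close> standing for $x^g$; they are thus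
  right actions, whereas \<^locale>\<open>group_action\<close> describes left actions.
\<close>
definition right_action :: "('g, 'b) monoid_scheme \<Rightarrow> 'x set \<Rightarrow> ('x \<Rightarrow> 'g \<Rightarrow> 'x) \<Rightarrow> bool" where
  "right_action \<Gamma> S act \<longleftrightarrow> group \<Gamma> \<and>
     (\<forall>x\<in>S. \<forall>g\<in>carrier \<Gamma>. act x g \<in> S) \<and>
     (\<forall>x\<in>S. act x (\<one>\<^bsub>\<Gamma>\<^esub>) = x) \<and>
     (\<forall>x\<in>S. \<forall>g\<in>carrier \<Gamma>. \<forall>h\<in>carrier \<Gamma>. act x (g \<otimes>\<^bsub>\<Gamma>\<^esub> h) = act (act x g) h)"

definition permutation_isomorphic ::
    "('g, 'b) monoid_scheme \<Rightarrow> 'x set \<Rightarrow> ('x \<Rightarrow> 'g \<Rightarrow> 'x) \<Rightarrow> 'y set \<Rightarrow> ('y \<Rightarrow> 'g \<Rightarrow> 'y) \<Rightarrow> bool"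
  where
  "permutation_isomorphic \<Gamma> S actS T actT \<longleftrightarrow>
     right_action \<Gamma> S actS \<and> right_action \<Gamma> T actT \<and>
     (\<exists>\<alpha>. bij_betw \<alpha> S T \<and> (\<forall>x\<in>S. \<forall>g\<in>carrier \<Gamma>. \<alpha> (actS x g) = actT (\<alpha> x) g))"

end

theory Submission
  imports Defs
    "HOL-Number_Theory.Number_Theory"
    "Jordan_Normal_Form.Char_Poly"
    "Jordan_Normal_Form.Schur_Decomposition"
    "Jordan_Normal_Form.Spectral_Radius"
begin

text \<open>
  Write \<open>\<Gamma>\<close> for the Galois group of the cyclotomic field. By Brauer's permutation lemma
  (\<open>fixed_points_equal\<close>) each \<open>\<sigma> \<in> \<Gamma>\<close> fixes as many conjugacy classes as irreducible characters:
  both numbers, multiplied by the order of \<open>G\<close>, count the pairs \<open>(t, g)\<close> with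
  \<open>t g\<^sup>k t\<^sup>-\<^sup>1 = g\<close>, where \<open>\<sigma> \<zeta> = \<zeta>\<^sup>k\<close>. As \<open>\<Gamma>\<close> need not be cyclic, equal fixed point counts alone
  do not make two actions isomorphic. What the cut property adds is that orbits are short: an
  irreducible character \<open>\<chi>\<close> has no Galois conjugates besides \<open>\<chi>\<close> and its complex conjugate, and the
  powers \<open>x\<^sup>k\<close> in question are conjugate to \<open>x\<close> or to \<open>x\<^sup>-\<^sup>1\<close>. So complex conjugation \<open>c \<in> \<Gamma>\<close> moves
  every point, of either set, that is moved by anything at all. Then the stabilizer of a point is
  \<open>\<Gamma>\<close> or a subgroup of index two not containing \<open>c\<close>, the numbers of points with given stabilizer can
  be recovered from the numbers of fixed points by Fourier inversion over the sign characters of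
  \<open>\<Gamma>\<close>, and a bijection that respects stabilizers and \<open>c\<close> is an isomorphism of actions
  (\<open>small_orbit_actions_isomorphic\<close>).

  The short orbits come from a unit. Suppose that \<open>\<theta> = \<chi>(g) + \<chi>(g\<^sup>-\<^sup>1)\<close> is moved by \<open>\<Gamma>\<close>. It is a
  cyclotomic integer all of whose conjugates are real, and there are at least two of them. As in
  Dirichlet's unit theorem, the pigeonhole principle gives infinitely many elements of
  \<open>\<int>[\<theta>]\<close> that are small at \<open>\<theta>\<close> and have bounded norm, and a quotient of two of them is a unit
  \<open>u = 1 + N w(\<theta>)\<close> with \<open>\<bar>u\<bar> < 1\<close>, where \<open>N\<close> is the order of \<open>G\<close> (\<open>real_orbit_unit\<close>). Let \<open>\<alpha>\<close> be the
  central element of the complex group algebra that acts on the representation of a conjugate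
  \<open>\<tau> \<circ> \<chi>\<close> by \<open>\<tau> u\<close> and on the other irreducible representations by \<open>1\<close>. Its coefficients are fixed by
  \<open>\<Gamma>\<close>, and the congruence \<open>u \<equiv> 1\<close> modulo \<open>N\<close> cancels the denominators, so \<open>\<alpha>\<close> is a
  central unit of the integral group ring. As \<open>G\<close> is cut, \<open>\<alpha> = \<plusminus> z\<close> with \<open>z\<close> central, and such an
  element acts by a root of unity, contradicting \<open>\<bar>u\<bar> < 1\<close> (\<open>cut_group_real_part_fixed\<close>). Hence
  \<open>\<chi>(g) + \<chi>(g\<^sup>-\<^sup>1)\<close> is always fixed by \<open>\<Gamma>\<close>, and the orthogonality relations turn this into the statements
  about orbits.

  The arguments rest on the irreducibility of the cyclotomic polynomial, in the form
  \<open>ipoly_root_conjugate\<close>, and on the orthogonality relations, which are derived from the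
  functional equation of characters (\<open>char_like\<close>). That equation also shows that the Galois
  conjugates of an irreducible character are irreducible, since it is preserved by field
  automorphisms. The count of rational characters and classes follows because these are the points
  fixed by all of \<open>\<Gamma>\<close>.
\<close>

section \<open>Divisibility modulo a prime\<close>

text \<open>
  Add to \<open>j\<close> the multiple \<open>r P\<close> of \<open>r\<close>, where \<open>P\<close> is the product of the prime factors of \<open>B\<close> that do
  not divide \<open>j\<close>: each prime factor of \<open>B\<close> divides exactly one of the two summands.
\<close>
lemma coprime_lift_modulus:
  fixes j r B :: nat
  assumes co: "coprime j r" and "B > 0"
  obtains m where "[m = j] (mod r)" "coprime m B" "m > 0"
proof -
  define P where "P = \<Prod>{p. Factorial_Ring.prime p \<and> p dvd B \<and> \<not> p dvd j}"
  have fin: "finite {p. Factorial_Ring.prime p \<and> p dvd B \<and> \<not> p dvd j}"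
    by (rule finite_subset[OF _ finite_divisors_nat[OF \<open>B > 0\<close>]]) auto
  define m where "m = j + r * P"
  have "coprime m B"
  proof (rule ccontr)
    assume "\<not> coprime m B"
    then obtain p where p: "Factorial_Ring.prime p" "p dvd m" "p dvd B"
      by (metis coprime_iff_gcd_eq_1 gcd_greatest_iff prime_factor_nat)
    have dvdP: "p dvd P \<longleftrightarrow> \<not> p dvd j"
    proof
      assume "p dvd P"
      then obtain q where "q \<in> {p. Factorial_Ring.prime p \<and> p dvd B \<and> \<not> p dvd j}" "p dvd q"
        unfolding P_def using prime_dvd_prod_iff[OF fin p(1)] by auto
      then show "\<not> p dvd j" using p(1) primes_dvd_imp_eq by blast
    next
      assume "\<not> p dvd j"
      then show "p dvd P" unfolding P_def using p fin
        by (metis (mono_tags, lifting) dvd_prod_eqI mem_Collect_eq)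
    qed
    show False
    proof (cases "p dvd j")
      case True
      then have "p dvd r * P" using p(2) unfolding m_def by (simp add: dvd_add_right_iff)
      then have "p dvd r" using dvdP True p(1) by (simp add: prime_dvd_mult_iff)
      then show False using True co p(1)
        by (meson coprime_common_divisor not_prime_unit)
    next
      case False
      then have "p dvd r * P" using dvdP by auto
      then show False using False p(2) unfolding m_def by (simp add: dvd_add_left_iff)
    qed
  qed
  moreover have "[m = j] (mod r)" unfolding m_def by (simp add: cong_def)
  moreover have "m > 0"
  proof -
    have "P > 0" unfolding P_def by (intro prod_pos) (auto simp: prime_gt_0_nat)
    then show ?thesis using co unfolding m_def by (cases "j = 0") auto
  qed
  ultimately show ?thesis using that by blast
qed

lemma prime_dvd_power_add:
  fixes a b :: "'a::comm_ring_1"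
  assumes "Factorial_Ring.prime (p::nat)"
  shows "of_nat p dvd (a + b) ^ p - a ^ p - b ^ p"
proof -
  have p: "p > 1" using assms prime_gt_1_nat by blast
  define t where "t = (\<lambda>k. of_nat (p choose k) * a ^ k * b ^ (p - k))"
  have "(a + b) ^ p = (\<Sum>k\<le>p. t k)" unfolding t_def by (rule binomial_ring)
  also have "{..p} = insert 0 (insert p {1..<p})" using p by auto
  also have "(\<Sum>k\<in>\<dots>. t k) = b ^ p + (a ^ p + (\<Sum>k\<in>{1..<p}. t k))"
    using p by (simp add: t_def)
  finally have "(a + b) ^ p - a ^ p - b ^ p = (\<Sum>k\<in>{1..<p}. t k)" by simp
  also have "of_nat p dvd \<dots>"
  proof (rule dvd_sum)
    fix k assume k: "k \<in> {1..<p}"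
    have "p dvd (p choose k)" using assms k by (intro dvd_choose_prime) auto
    then have "of_nat p dvd (of_nat (p choose k) :: 'a)" by (auto elim!: dvdE)
    then show "of_nat p dvd t k" unfolding t_def by (simp add: mult.assoc)
  qed
  finally show ?thesis .
qed

lemma prime_dvd_power_diff_int:
  fixes a :: int
  assumes "Factorial_Ring.prime (p::nat)"
  shows "int p dvd a ^ p - a"
proof -
  have p: "p > 0" using assms prime_gt_0_nat by blast
  have nat: "int p dvd int k ^ p - int k" for k
  proof (induction k)
    case 0 then show ?case using p by (simp add: zero_power)
  next
    case (Suc k)
    have "int p dvd ((int k + 1) ^ p - int k ^ p - 1 ^ p) + (int k ^ p - int k)"
      using prime_dvd_power_add[OF assms, of "int k" 1] Suc by (intro dvd_add) auto
    then show ?case by (simp add: algebra_simps)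
  qed
  define k where "k = nat (a mod int p)"
  have k: "int k = a mod int p" unfolding k_def using p by simp
  have "[a = int k] (mod int p)" by (simp add: k cong_def)
  then have "[a ^ p - a = int k ^ p - int k] (mod int p)"
    by (intro cong_diff cong_pow)
  then show ?thesis using nat[of k] by (simp add: cong_dvd_iff)
qed

text \<open>
  The Frobenius congruence \<open>f(X\<^sup>p) \<equiv> f(X)\<^sup>p\<close>. Being additive and multiplicative modulo \<open>p\<close>, it
  reduces to the constants, where it is Fermat's little theorem, and to the indeterminate.
\<close>
lemma prime_dvd_pcompose_monom:
  fixes f :: "int poly"
  assumes "Factorial_Ring.prime (p::nat)"
  shows "of_nat p dvd pcompose f (monom 1 p) - f ^ p"
proof (induction f)
  case 0
  then show ?case using assms prime_gt_0_nat[of p] by (simp add: zero_power)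
next
  case (pCons a f)
  let ?X = "monom (1::int) 1"
  have eq: "pCons a f = [:a:] + ?X * f" by (simp add: monom_altdef)
  have X: "?X ^ p = monom 1 p" by (simp add: monom_power)
  have "of_nat p dvd [:a:] - [:a:] ^ p"
  proof -
    obtain c where "a ^ p - a = int p * c" using prime_dvd_power_diff_int[OF assms, of a] by auto
    then have "a - a ^ p = int p * (- c)" by simp
    then have "[:a:] - [:a:] ^ p = of_nat p * [:- c:]"
      by (simp add: poly_const_pow of_nat_poly mult.commute)
    then show ?thesis by (metis dvd_triv_left)
  qed
  moreover have "of_nat p dvd ?X ^ p * (pcompose f (monom 1 p) - f ^ p)"
    using pCons.IH by simp
  moreover have "of_nat p dvd ([:a:] + ?X * f) ^ p - [:a:] ^ p - (?X * f) ^ p"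
    by (rule prime_dvd_power_add[OF assms])
  ultimately have "of_nat p dvd ([:a:] - [:a:] ^ p) + ?X ^ p * (pcompose f (monom 1 p) - f ^ p)
       - (([:a:] + ?X * f) ^ p - [:a:] ^ p - (?X * f) ^ p)"
    by (rule dvd_diff[OF dvd_add])
  also have "\<dots> = [:a:] + ?X ^ p * pcompose f (monom 1 p) - ([:a:] + ?X * f) ^ p"
    by (simp add: algebra_simps power_mult_distrib)
  also have "\<dots> = pcompose (pCons a f) (monom 1 p) - (pCons a f) ^ p"
    unfolding X eq[symmetric] by (simp add: pcompose_pCons)
  finally show ?case .
qed

section \<open>Integral elements of a cyclotomic field\<close>

abbreviation ipoly :: "int poly \<Rightarrow> complex \<Rightarrow> complex" where
  "ipoly p x \<equiv> poly (map_poly of_int p) x"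

text \<open>
  The ring \<open>\<int>[x]\<close>.
\<close>
definition int_adjoin :: "complex \<Rightarrow> complex set" where
  "int_adjoin x = range (\<lambda>p. ipoly p x)"

lemma ipoly_add: "ipoly (p + q) x = ipoly p x + ipoly q x" by (simp add: of_int_poly_hom.hom_add)
lemma ipoly_mult: "ipoly (p * q) x = ipoly p x * ipoly q x" by (simp add: of_int_poly_hom.hom_mult)
lemma ipoly_diff: "ipoly (p - q) x = ipoly p x - ipoly q x" by (simp add: of_int_poly_hom.hom_minus)
lemma ipoly_power: "ipoly (p ^ k) x = ipoly p x ^ k" by (simp add: of_int_poly_hom.hom_power)
lemma ipoly_pcompose: "ipoly (pcompose p q) x = ipoly p (ipoly q x)"
  by (simp add: of_int_hom.map_poly_pcompose poly_pcompose)
lemma ipoly_monom: "ipoly (monom c k) x = of_int c * x ^ k"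
  by (simp add: map_poly_monom poly_monom)
lemma ipoly_const: "ipoly [:c:] x = of_int c" by (simp add: of_int_hom.map_poly_pCons_hom)
lemma ipoly_smult: "ipoly (Polynomial.smult c p) x = of_int c * ipoly p x" by (simp add: of_int_hom.map_poly_hom_smult)
lemma ipoly_altdef: "ipoly p x = (\<Sum>k\<le>degree p. of_int (coeff p k) * x ^ k)"
  by (simp add: poly_altdef degree_map_poly coeff_map_poly)

lemma int_adjoinI: "ipoly p x \<in> int_adjoin x"
  unfolding int_adjoin_def by (rule rangeI)

lemma int_adjoinE: assumes "a \<in> int_adjoin x" obtains p where "a = ipoly p x"
  using assms unfolding int_adjoin_def by (elim rangeE)

lemma int_adjoin_add:
  assumes "a \<in> int_adjoin x" "b \<in> int_adjoin x" shows "a + b \<in> int_adjoin x"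
proof -
  obtain p q where "a = ipoly p x" "b = ipoly q x" using assms by (elim int_adjoinE)
  then have "a + b = ipoly (p + q) x" by (simp only: ipoly_add)
  then show ?thesis by (simp only: int_adjoinI)
qed

lemma int_adjoin_mult:
  assumes "a \<in> int_adjoin x" "b \<in> int_adjoin x" shows "a * b \<in> int_adjoin x"
proof -
  obtain p q where "a = ipoly p x" "b = ipoly q x" using assms by (elim int_adjoinE)
  then have "a * b = ipoly (p * q) x" by (simp only: ipoly_mult)
  then show ?thesis by (simp only: int_adjoinI)
qed

lemma int_adjoin_of_int: "of_int c \<in> int_adjoin x"
  using int_adjoinI[of "[:c:]" x] by (simp only: ipoly_const)

lemma int_adjoin_self: "x \<in> int_adjoin x"
  using int_adjoinI[of "monom 1 1" x, unfolded ipoly_monom] by simp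

lemma int_adjoin_uminus: "a \<in> int_adjoin x \<Longrightarrow> - a \<in> int_adjoin x"
  using int_adjoin_mult[OF int_adjoin_of_int[of "-1"]] by simp

lemma int_adjoin_sum: "(\<And>i. i \<in> I \<Longrightarrow> f i \<in> int_adjoin x) \<Longrightarrow> sum f I \<in> int_adjoin x"
  by (induction I rule: infinite_finite_induct)
     (auto intro: int_adjoin_add simp: int_adjoin_of_int[of 0, simplified])

lemma int_adjoin_prod: "(\<And>i. i \<in> I \<Longrightarrow> f i \<in> int_adjoin x) \<Longrightarrow> prod f I \<in> int_adjoin x"
  by (induction I rule: infinite_finite_induct)
     (auto intro: int_adjoin_mult simp: int_adjoin_of_int[of 1, simplified])

lemma int_adjoin_power: "a \<in> int_adjoin x \<Longrightarrow> a ^ k \<in> int_adjoin x"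
  by (induction k) (auto intro: int_adjoin_mult simp: int_adjoin_of_int[of 1, simplified])

lemma int_adjoin_ipoly: "a \<in> int_adjoin x \<Longrightarrow> ipoly p a \<in> int_adjoin x"
  unfolding ipoly_altdef by (intro int_adjoin_sum int_adjoin_mult int_adjoin_of_int int_adjoin_power)

text \<open>
  An eigenvalue of an integer matrix is a root of its characteristic polynomial, which is monic
  with integer coefficients.
\<close>
lemma algebraic_int_of_int_eigenvector:
  fixes y :: complex and v :: "nat \<Rightarrow> complex" and c :: "nat \<Rightarrow> nat \<Rightarrow> int"
  assumes eq: "\<And>i. i < n \<Longrightarrow> (\<Sum>j<n. of_int (c i j) * v j) = y * v i"
    and nz: "i0 < n" "v i0 \<noteq> 0"
  shows "algebraic_int y"
proof -
  define M where "M = mat n n (\<lambda>(i, j). c i j)"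
  have M: "M \<in> carrier_mat n n" unfolding M_def by simp
  let ?M = "map_mat of_int M :: complex mat"
  have M': "?M \<in> carrier_mat n n" using M by simp
  have "eigenvector ?M (vec n v) y"
    unfolding eigenvector_def
  proof (intro conjI)
    show "vec n v \<in> carrier_vec (dim_row ?M)" using M by auto
    show "vec n v \<noteq> 0\<^sub>v (dim_row ?M)"
      using nz M by (metis carrier_matD(1) index_map_mat(2) index_vec index_zero_vec(1))
    show "?M *\<^sub>v vec n v = y \<cdot>\<^sub>v vec n v"
      by (rule eq_vecI) (auto simp: M_def scalar_prod_def eq lessThan_atLeast0[symmetric])
  qed
  then have "eigenvalue ?M y" unfolding eigenvalue_def by blast
  then have "poly (char_poly ?M) y = 0" using eigenvalue_root_char_poly[OF M'] by simp
  then have "ipoly (char_poly M) y = 0" using of_int_hom.char_poly_hom[OF M, where 'a = complex] by simp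
  moreover have "monic (char_poly M)" using degree_monic_char_poly[OF M] by auto
  ultimately show ?thesis unfolding algebraic_int_altdef_ipoly by blast
qed

locale root_of_unity =
  fixes n :: nat and \<zeta> :: complex
  assumes n_pos: "n > 0" and prim: "primitive_root_of_unity n \<zeta>"
begin

lemma zeta_power_n: "\<zeta> ^ n = 1" using prim unfolding primitive_root_of_unity_def by simp

lemma zeta_nonzero: "\<zeta> \<noteq> 0" using zeta_power_n n_pos by (metis power_0_left less_not_refl zero_neq_one)

lemma zeta_power_mod: "\<zeta> ^ (k mod n) = \<zeta> ^ k"
proof -
  have "\<zeta> ^ k = \<zeta> ^ (n * (k div n) + k mod n)" by simp
  also have "\<dots> = \<zeta> ^ (k mod n)"
    by (simp only: power_add power_mult zeta_power_n power_one mult_1)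
  finally show ?thesis by simp
qed

lemma zeta_power_eq_1_iff: "\<zeta> ^ k = 1 \<longleftrightarrow> n dvd k"
proof
  assume "\<zeta> ^ k = 1"
  then have "\<zeta> ^ (k mod n) = 1" by (simp add: zeta_power_mod)
  then have "\<not> (0 < k mod n \<and> k mod n < n)"
    using prim unfolding primitive_root_of_unity_def by blast
  then show "n dvd k" using n_pos by (auto simp: mod_eq_0_iff_dvd)
next
  assume "n dvd k" then show "\<zeta> ^ k = 1"
    using zeta_power_n by (auto simp: power_mult elim!: dvdE)
qed

lemma zeta_power_eq_iff: "\<zeta> ^ k = \<zeta> ^ l \<longleftrightarrow> [k = l] (mod n)"
proof (induction k l rule: linorder_wlog)
  case (le a b)
  have "\<zeta> ^ b = \<zeta> ^ a * \<zeta> ^ (b - a)" using le by (simp add: power_add[symmetric])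
  then have "\<zeta> ^ a = \<zeta> ^ b \<longleftrightarrow> \<zeta> ^ (b - a) = 1" using zeta_nonzero by simp
  also have "\<dots> \<longleftrightarrow> n dvd b - a" by (rule zeta_power_eq_1_iff)
  also have "\<dots> \<longleftrightarrow> [a = b] (mod n)"
    using le by (metis cong_altdef_nat cong_sym_eq)
  finally show ?case .
next
  case (sym a b)
  then show ?case by (metis cong_sym_eq)
qed

lemma roots_of_unity_powers:
  assumes "w ^ n = 1" obtains k where "k < n" "w = \<zeta> ^ k"
proof -
  have inj: "inj_on (\<lambda>k. \<zeta> ^ k) {..<n}"
    by (auto simp: inj_on_def zeta_power_eq_iff cong_def)
  have sub: "(\<lambda>k. \<zeta> ^ k) ` {..<n} \<subseteq> {z. z ^ n = 1}"
    by (auto simp: power_mult[symmetric] zeta_power_eq_1_iff)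
  have "finite {z::complex. z ^ n = 1}" "card {z::complex. z ^ n = 1} = n"
    using card_roots_unity_eq[OF n_pos] finite_roots_unity[of n] n_pos by auto
  then have "(\<lambda>k. \<zeta> ^ k) ` {..<n} = {z. z ^ n = 1}"
    using card_subset_eq[OF _ sub] card_image[OF inj] by simp
  then show ?thesis using assms that by auto
qed

text \<open>
  Multiplication by \<open>y\<close> maps each power of \<open>\<zeta>\<close> to an integer combination of
  \<open>1, \<zeta>, \<dots>, \<zeta>\<^sup>n\<^sup>-\<^sup>1\<close>; so these powers form an eigenvector of an integer matrix with eigenvalue \<open>y\<close>.
\<close>
lemma algebraic_int_int_adjoin:
  assumes "y \<in> int_adjoin \<zeta>" shows "algebraic_int y"
proof -
  obtain q where y: "y = ipoly q \<zeta>" using assms unfolding int_adjoin_def by auto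
  define c where "c = (\<lambda>i j. \<Sum>k\<le>degree q. if (i + k) mod n = j then coeff q k else 0)"
  show ?thesis
  proof (rule algebraic_int_of_int_eigenvector[of n c "\<lambda>j. \<zeta> ^ j" y 0])
    fix i assume "i < n"
    have "(\<Sum>j<n. of_int (c i j) * \<zeta> ^ j)
        = (\<Sum>j<n. \<Sum>k\<le>degree q. if j = (i + k) mod n then of_int (coeff q k) * \<zeta> ^ j else 0)"
      unfolding c_def of_int_sum sum_distrib_right by (intro sum.cong) auto
    also have "\<dots> = (\<Sum>k\<le>degree q. \<Sum>j<n. if j = (i + k) mod n then of_int (coeff q k) * \<zeta> ^ j else 0)"
      by (rule sum.swap)
    also have "\<dots> = (\<Sum>k\<le>degree q. of_int (coeff q k) * \<zeta> ^ (i + k))"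
      using n_pos by (simp add: zeta_power_mod)
    also have "\<dots> = y * \<zeta> ^ i"
      unfolding y ipoly_altdef sum_distrib_right by (simp add: power_add mult_ac)
    finally show "(\<Sum>j<n. of_int (c i j) * \<zeta> ^ j) = y * \<zeta> ^ i" .
  qed (use n_pos in auto)
qed

lemma int_adjoin_rational: "y \<in> int_adjoin \<zeta> \<Longrightarrow> y \<in> \<rat> \<Longrightarrow> y \<in> \<int>"
  by (rule rational_algebraic_int_is_int[OF algebraic_int_int_adjoin])

text \<open>
  In a polynomial relation of \<open>v\<close> with nonzero constant term \<open>c\<close>, everything but \<open>c\<close> is divisible
  by \<open>v\<close>.
\<close>
lemma int_adjoin_dvd_int:
  assumes "v \<in> int_adjoin \<zeta>" "v \<noteq> 0"
  obtains w c where "w \<in> int_adjoin \<zeta>" "c \<noteq> 0" "v * w = of_int c"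
proof -
  have "algebraic v" using algebraic_int_int_adjoin[OF assms(1)] by blast
  then obtain p where p: "coeff p 0 \<noteq> 0" "ipoly p v = 0"
    using algebraicE'_nonzero[OF _ assms(2)] by metis
  obtain a q where pq: "p = pCons a q" by (cases p)
  have "of_int a + v * ipoly q v = 0" using p(2) pq by (simp add: of_int_hom.map_poly_pCons_hom)
  then have "v * (- ipoly q v) = of_int a" by (simp add: add_eq_0_iff)
  then show ?thesis
    using that[of "- ipoly q v" a] p(1) pq assms(1) by (simp add: int_adjoin_uminus int_adjoin_ipoly)
qed

text \<open>
  A prime dividing \<open>v\<close> in \<open>\<int>[\<zeta>]\<close> divides every integer multiple \<open>c\<close> of \<open>v\<close> there, hence in
  \<open>\<int>\<close>, as rational elements of \<open>\<int>[\<zeta>]\<close> are integers.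
\<close>
lemma int_adjoin_not_dvd_large_prime:
  assumes "v \<in> int_adjoin \<zeta>" "v \<noteq> 0"
  obtains B where "\<And>p w. Factorial_Ring.prime p \<Longrightarrow> p > B \<Longrightarrow> w \<in> int_adjoin \<zeta> \<Longrightarrow> v \<noteq> of_nat p * w"
proof -
  obtain w c where wc: "w \<in> int_adjoin \<zeta>" "c \<noteq> 0" "v * w = of_int c"
    using int_adjoin_dvd_int[OF assms] .
  have "v \<noteq> of_nat p * u" if p: "Factorial_Ring.prime p" "p > nat \<bar>c\<bar>" "u \<in> int_adjoin \<zeta>" for p u
  proof
    assume v: "v = of_nat p * u"
    have p0: "p > 0" using p by simp
    have uw: "u * w = of_int c / of_nat p" using v wc(3) p0 by (simp add: field_simps)
    have "u * w \<in> \<rat>" unfolding uw by (intro Rats_divide) auto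
    moreover have "u * w \<in> int_adjoin \<zeta>" using p wc by (intro int_adjoin_mult)
    ultimately have "u * w \<in> \<int>" by (intro int_adjoin_rational)
    then obtain k where "u * w = of_int k" by (auto elim: Ints_cases)
    then have "of_int c = (of_int (int p * k) :: complex)"
      using uw p0 by (simp add: field_simps)
    then have ck: "c = int p * k" by (simp only: of_int_eq_iff)
    then have "int p dvd c" by simp
    then have "int p \<le> \<bar>c\<bar>" using wc(2) dvd_imp_le_int[of c "int p"] by simp
    then show False using p(2) by linarith
  qed
  then show ?thesis using that by blast
qed

lemma finite_ipoly_values: "finite (range (\<lambda>k. ipoly f (\<zeta> ^ k)))"
proof -
  have "range (\<lambda>k. ipoly f (\<zeta> ^ k)) \<subseteq> (\<lambda>k. ipoly f (\<zeta> ^ k)) ` {..<n}"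
  proof safe
    fix k have "ipoly f (\<zeta> ^ k) = ipoly f (\<zeta> ^ (k mod n))" by (simp add: zeta_power_mod)
    then show "ipoly f (\<zeta> ^ k) \<in> (\<lambda>k. ipoly f (\<zeta> ^ k)) ` {..<n}" using n_pos by auto
  qed
  then show ?thesis using finite_surj by blast
qed

text \<open>
  Irreducibility of the cyclotomic polynomial: a polynomial vanishing at \<open>\<zeta>\<close> vanishes at all
  primitive \<open>n\<close>-th roots of unity. If \<open>f(\<zeta>\<^sup>k) = 0\<close>, then the Frobenius congruence makes
  \<open>f(\<zeta>\<^sup>k\<^sup>p)\<close> divisible by \<open>p\<close> in \<open>\<int>[\<zeta>]\<close>. The finitely many nonzero values of \<open>f\<close> at powers of
  \<open>\<zeta>\<close> are divisible by no prime above some bound \<open>b\<close>; so the exponent may be multiplied by primes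
  above \<open>b\<close>. Every exponent prime to \<open>n\<close> is congruent modulo \<open>n\<close> to a product of such primes.
\<close>
theorem ipoly_root_conjugate:
  assumes f: "ipoly f \<zeta> = 0" and m: "coprime m n"
  shows "ipoly f (\<zeta> ^ m) = 0"
proof -
  let ?V = "range (\<lambda>k. ipoly f (\<zeta> ^ k)) - {0}"
  have mem: "ipoly g (\<zeta> ^ k) \<in> int_adjoin \<zeta>" for g k
    by (intro int_adjoin_ipoly int_adjoin_power int_adjoin_self)
  have "\<forall>v\<in>?V. \<exists>B. \<forall>p w. Factorial_Ring.prime p \<longrightarrow> p > B \<longrightarrow> w \<in> int_adjoin \<zeta> \<longrightarrow> v \<noteq> of_nat p * w"
  proof
    fix v assume v: "v \<in> ?V"
    then have "v \<in> int_adjoin \<zeta>" "v \<noteq> 0" using mem by auto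
    then show "\<exists>B. \<forall>p w. Factorial_Ring.prime p \<longrightarrow> p > B \<longrightarrow> w \<in> int_adjoin \<zeta> \<longrightarrow> v \<noteq> of_nat p * w"
      using int_adjoin_not_dvd_large_prime[of v] by metis
  qed
  then obtain B where B: "\<And>v p w. v \<in> ?V \<Longrightarrow> Factorial_Ring.prime p \<Longrightarrow> p > B v \<Longrightarrow> w \<in> int_adjoin \<zeta> \<Longrightarrow> v \<noteq> of_nat p * w"
    by metis
  define b where "b = (\<Sum>v\<in>?V. B v)"
  have Bb: "B v \<le> b" if "v \<in> ?V" for v
    unfolding b_def using finite_ipoly_values that by (intro member_le_sum) auto
  have step: "ipoly f (\<zeta> ^ (k * p)) = 0"
    if k: "ipoly f (\<zeta> ^ k) = 0" and p: "Factorial_Ring.prime p" "p > b" for k p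
  proof (rule ccontr)
    assume nz: "ipoly f (\<zeta> ^ (k * p)) \<noteq> 0"
    obtain h where h: "pcompose f (monom 1 p) - f ^ p = of_nat p * h"
      using prime_dvd_pcompose_monom[OF p(1)] by (auto elim: dvdE)
    have "ipoly (pcompose f (monom 1 p)) (\<zeta> ^ k) = ipoly (f ^ p + [:int p:] * h) (\<zeta> ^ k)"
      using h by (simp add: algebra_simps of_nat_poly)
    then have "ipoly f (\<zeta> ^ (k * p)) = of_nat p * ipoly h (\<zeta> ^ k)"
      using k p(1) prime_gt_0_nat[OF p(1)]
      by (simp only: ipoly_pcompose ipoly_monom ipoly_add ipoly_mult ipoly_power ipoly_const)
         (simp add: power_mult zero_power)
    moreover have "ipoly f (\<zeta> ^ (k * p)) \<in> ?V" using nz by blast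
    ultimately show False using B[of "ipoly f (\<zeta> ^ (k * p))" p "ipoly h (\<zeta> ^ k)"] Bb[of "ipoly f (\<zeta> ^ (k * p))"] p mem
      by fastforce
  qed
  \<comment> \<open>All prime factors of \<open>r\<close> exceed \<open>b\<close>, since \<open>r\<close> is prime to \<open>b!\<close>.\<close>
  obtain r where r: "[r = m] (mod n)" "coprime r (fact b)" "r > 0"
    using coprime_lift_modulus[OF m fact_gt_zero] .
  have large: "p > b" if "Factorial_Ring.prime p" "p dvd r" for p
  proof (rule ccontr)
    assume "\<not> p > b"
    then have "p dvd fact b" using that prime_gt_0_nat[of p] by (intro dvd_fact) auto
    then show False using r(2) that by (meson coprime_common_divisor not_prime_unit)
  qed
  have all: "ipoly f (\<zeta> ^ (\<Prod>\<^sub># A)) = 0"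
    if "\<forall>p\<in>#A. Factorial_Ring.prime p \<and> p > b" for A :: "nat multiset"
    using that
  proof (induction A)
    case empty then show ?case using f by simp
  next
    case (add p A)
    then show ?case using step[of "\<Prod>\<^sub># A" p] by (simp add: mult.commute)
  qed
  have "ipoly f (\<zeta> ^ r) = 0"
    using all[of "prime_factorization r"] large r(3)
    by (auto simp: prod_mset_prime_factorization in_prime_factors_iff)
  then show ?thesis using r(1) by (metis zeta_power_eq_iff)
qed

end


lemma ipoly_cnj: "ipoly p (cnj x) = cnj (ipoly p x)"
  by (simp add: ipoly_altdef)

context root_of_unity
begin

abbreviation L :: "complex set" where "L \<equiv> cyclotomic_field \<zeta>"
abbreviation Gal :: "(complex \<Rightarrow> complex) monoid" where "Gal \<equiv> cyclotomic_galois \<zeta>"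

lemma int_adjoin_sub_cyclotomic: "x \<in> int_adjoin \<zeta> \<Longrightarrow> x \<in> L"
proof -
  assume "x \<in> int_adjoin \<zeta>"
  then obtain p where x: "x = ipoly p \<zeta>" by (elim int_adjoinE)
  have "ipoly p \<zeta> \<in> generate_field class_ring (\<rat> \<union> {\<zeta>})"
  proof (induction p)
    case 0
    then show ?case by (auto intro: generate_field.incl)
  next
    case (pCons a p)
    have 1: "of_int a \<in> generate_field class_ring (\<rat> \<union> {\<zeta>})"
      by (rule generate_field.incl) auto
    have z: "\<zeta> \<in> generate_field class_ring (\<rat> \<union> {\<zeta>})" by (rule generate_field.incl) auto
    show ?case
      using generate_field.eng_add[OF 1 generate_field.eng_mult[OF z pCons.IH]]
      by (simp add: of_int_hom.map_poly_pCons_hom)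
  qed
  then show ?thesis unfolding x cyclotomic_field_def .
qed

text \<open>
  Closure under inverses is the only part of this that is not formal: a nonzero \<open>x \<in> \<int>[\<zeta>]\<close>
  divides a nonzero integer, which serves as the denominator.
\<close>
lemma cyclotomic_field_altdef: "L = {x / of_int d | x d. x \<in> int_adjoin \<zeta> \<and> d \<noteq> 0}" (is "_ = ?R")
proof (intro equalityI subsetI)
  fix y assume "y \<in> L"
  then show "y \<in> ?R" unfolding cyclotomic_field_def
  proof (induction rule: generate_field.induct)
    case one
    show ?case using int_adjoin_of_int[of 1 \<zeta>] by (intro CollectI exI[of _ 1]) auto
  next
    case (incl h)
    show ?case
    proof (cases "h = \<zeta>")
      case True
      then show ?thesis using int_adjoin_self[of \<zeta>] by (intro CollectI exI[of _ \<zeta>] exI[of _ 1]) auto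
    next
      case False
      then have "h \<in> \<rat>" using incl by auto
      then obtain a b where "b > 0" "h = of_int a / of_int b" by (auto elim: Rats_cases')
      then show ?thesis using int_adjoin_of_int[of a \<zeta>]
        by (intro CollectI exI[of _ "of_int a"] exI[of _ b]) auto
    qed
  next
    case (a_inv h)
    then obtain x d where "h = x / of_int d" "x \<in> int_adjoin \<zeta>" "d \<noteq> 0" by blast
    then show ?case using int_adjoin_uminus
      by (intro CollectI exI[of _ "- x"] exI[of _ d]) (auto simp: class_ring_simps)
  next
    case (m_inv h)
    then obtain x d where h: "h = x / of_int d" "x \<in> int_adjoin \<zeta>" "d \<noteq> 0" by blast
    then have "x \<noteq> 0" using m_inv by auto
    then obtain w c where wc: "w \<in> int_adjoin \<zeta>" "c \<noteq> 0" "x * w = of_int c"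
      using int_adjoin_dvd_int[OF h(2)] by metis
    have "w \<noteq> 0" using wc by auto
    then have "inverse h = of_int d * w / of_int c"
      unfolding h(1) wc(3)[symmetric] using \<open>x \<noteq> 0\<close> by simp
    moreover have "h \<noteq> 0" using h \<open>x \<noteq> 0\<close> by simp
    moreover have "of_int d * w \<in> int_adjoin \<zeta>" using wc by (intro int_adjoin_mult int_adjoin_of_int)
    ultimately show ?case using wc
      by (intro CollectI exI[of _ "of_int d * w"] exI[of _ c]) (auto simp: class_ring_simps)
  next
    case (eng_add h1 h2)
    then obtain x d y e where h: "h1 = x / of_int d" "x \<in> int_adjoin \<zeta>" "d \<noteq> 0"
      "h2 = y / of_int e" "y \<in> int_adjoin \<zeta>" "e \<noteq> 0" by blast
    then have "x * of_int e + y * of_int d \<in> int_adjoin \<zeta>"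
      by (intro int_adjoin_add int_adjoin_mult int_adjoin_of_int)
    then show ?case using h
      by (intro CollectI exI[of _ "x * of_int e + y * of_int d"] exI[of _ "d * e"]) (auto simp: field_simps)
  next
    case (eng_mult h1 h2)
    then obtain x d y e where h: "h1 = x / of_int d" "x \<in> int_adjoin \<zeta>" "d \<noteq> 0"
      "h2 = y / of_int e" "y \<in> int_adjoin \<zeta>" "e \<noteq> 0" by blast
    then have "x * y \<in> int_adjoin \<zeta>" by (intro int_adjoin_mult)
    then show ?case using h
      by (intro CollectI exI[of _ "x * y"] exI[of _ "d * e"]) auto
  qed
next
  fix y assume "y \<in> ?R"
  then obtain x d where y: "y = x / of_int d" "x \<in> int_adjoin \<zeta>" "d \<noteq> 0" by blast
  have "of_int d \<in> generate_field class_ring (\<rat> \<union> {\<zeta>})"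
    by (rule generate_field.incl) auto
  then have "m_inv class_ring (of_int d) \<in> generate_field class_ring (\<rat> \<union> {\<zeta>})"
    by (rule generate_field.m_inv) (use y in auto)
  then have "inverse (of_int d) \<in> generate_field class_ring (\<rat> \<union> {\<zeta>})"
    using y by (simp add: class_ring_simps)
  from generate_field.eng_mult[OF int_adjoin_sub_cyclotomic[OF y(2), unfolded cyclotomic_field_def] this]
  show "y \<in> L" unfolding cyclotomic_field_def y by (simp add: divide_inverse)
qed

lemma cyclotomic_fieldE:
  assumes "y \<in> L" obtains p d where "y = ipoly p \<zeta> / of_int d" "d \<noteq> 0"
  using assms unfolding cyclotomic_field_altdef by (auto elim: int_adjoinE)

lemma cyclotomic_fieldI: "d \<noteq> 0 \<Longrightarrow> ipoly p \<zeta> / of_int d \<in> L"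
  unfolding cyclotomic_field_altdef using int_adjoinI by blast

lemma Rats_sub_cyclotomic: "q \<in> \<rat> \<Longrightarrow> q \<in> L"
  unfolding cyclotomic_field_def by (rule generate_field.incl) simp

lemma zeta_in_L: "\<zeta> \<in> L"
  unfolding cyclotomic_field_def by (rule generate_field.incl) simp

lemma L_add: "x \<in> L \<Longrightarrow> y \<in> L \<Longrightarrow> x + y \<in> L"
  unfolding cyclotomic_field_def using generate_field.eng_add[of x class_ring _ y] by simp

lemma L_mult: "x \<in> L \<Longrightarrow> y \<in> L \<Longrightarrow> x * y \<in> L"
  unfolding cyclotomic_field_def using generate_field.eng_mult[of x class_ring _ y] by simp

lemma L_sum: "(\<And>i. i \<in> I \<Longrightarrow> f i \<in> L) \<Longrightarrow> sum f I \<in> L"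
  by (induction I rule: infinite_finite_induct) (auto intro: L_add Rats_sub_cyclotomic)

lemma L_prod: "(\<And>i. i \<in> I \<Longrightarrow> f i \<in> L) \<Longrightarrow> prod f I \<in> L"
  by (induction I rule: infinite_finite_induct) (auto intro: L_mult Rats_sub_cyclotomic)

lemma L_power: "x \<in> L \<Longrightarrow> x ^ k \<in> L"
  by (induction k) (auto intro: L_mult Rats_sub_cyclotomic)

lemma carrier_Gal:
  "carrier Gal = {\<sigma> \<in> Bij L. (\<forall>x\<in>L. \<forall>y\<in>L. \<sigma> (x + y) = \<sigma> x + \<sigma> y) \<and>
     (\<forall>x\<in>L. \<forall>y\<in>L. \<sigma> (x * y) = \<sigma> x * \<sigma> y) \<and> (\<forall>q\<in>\<rat>. \<sigma> q = q)}"
  unfolding galois_group_def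
  by (auto simp: ring_iso_def Ring.ring_hom_def Bij_def bij_betw_def)

lemma Gal_group: "group Gal"
proof -
  interpret B: group "BijGroup L" by (rule group_BijGroup)
  have "subgroup (carrier Gal) (BijGroup L)"
  proof (rule B.subgroupI)
    show "carrier Gal \<subseteq> carrier (BijGroup L)"
      by (auto simp: carrier_Gal BijGroup_def)
    have "(\<lambda>x\<in>L. x) \<in> carrier Gal"
      by (auto simp: carrier_Gal id_Bij L_add L_mult Rats_sub_cyclotomic)
    then show "carrier Gal \<noteq> {}" by blast
  next
    fix a b assume a: "a \<in> carrier Gal" and b: "b \<in> carrier Gal"
    have mem: "a x \<in> L" "b x \<in> L" if "x \<in> L" for x
      using a b that by (auto simp: carrier_Gal Bij_def bij_betw_def)
    have "compose L a b \<in> carrier Gal"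
      using a b mem by (auto simp: carrier_Gal compose_Bij) (auto simp: compose_def L_add L_mult Rats_sub_cyclotomic)
    then show "a \<otimes>\<^bsub>BijGroup L\<^esub> b \<in> carrier Gal"
      using a b by (auto simp: BijGroup_def carrier_Gal)
  next
    fix a assume a: "a \<in> carrier Gal"
    then have aB: "a \<in> Bij L" by (simp add: carrier_Gal)
    let ?b = "\<lambda>x\<in>L. inv_into L a x"
    have bB: "?b \<in> Bij L" using restrict_inv_into_Bij[OF aB] .
    have ab: "a (?b x) = x" "?b x \<in> L" if "x \<in> L" for x
      using aB that by (auto simp: Bij_def bij_betw_def f_inv_into_f inv_into_into)
    have inj: "x = y" if "a x = a y" "x \<in> L" "y \<in> L" for x y
      using aB that by (auto simp: Bij_def bij_betw_def inj_on_def)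
    have a_add: "a (u + v) = a u + a v" and a_mult: "a (u * v) = a u * a v" if "u \<in> L" "v \<in> L" for u v
      using a that by (simp_all add: carrier_Gal)
    have add: "?b (x + y) = ?b x + ?b y" if "x \<in> L" "y \<in> L" for x y
    proof (rule inj)
      have "a (?b (x + y)) = x + y" by (intro ab L_add that)
      also have "\<dots> = a (?b x) + a (?b y)" using ab that by simp
      also have "\<dots> = a (?b x + ?b y)" using ab(2) that by (intro a_add[symmetric])
      finally show "a (?b (x + y)) = a (?b x + ?b y)" .
    qed (auto intro!: ab(2) L_add that simp del: restrict_apply restrict_apply')
    have mult: "?b (x * y) = ?b x * ?b y" if "x \<in> L" "y \<in> L" for x y
    proof (rule inj)
      have "a (?b (x * y)) = x * y" by (intro ab L_mult that)
      also have "\<dots> = a (?b x) * a (?b y)" using ab that by simp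
      also have "\<dots> = a (?b x * ?b y)" using ab(2) that by (intro a_mult[symmetric])
      finally show "a (?b (x * y)) = a (?b x * ?b y)" .
    qed (auto intro!: ab(2) L_mult that simp del: restrict_apply restrict_apply')
    have rat: "?b q = q" if "q \<in> \<rat>" for q
    proof (rule inj)
      have "a (?b q) = q" by (intro ab Rats_sub_cyclotomic that)
      also have "q = a q" using a that unfolding carrier_Gal by simp
      finally show "a (?b q) = a q" .
    qed (rule ab(2)[OF Rats_sub_cyclotomic[OF that]], rule Rats_sub_cyclotomic[OF that])
    have "?b \<in> carrier Gal" unfolding carrier_Gal using bB add mult rat by blast
    then show "inv\<^bsub>BijGroup L\<^esub> a \<in> carrier Gal" using inv_BijGroup[OF aB] by simp
  qed
  then have "group (BijGroup L\<lparr>carrier := carrier Gal\<rparr>)" by (rule B.subgroup_imp_group)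
  then show ?thesis by (simp add: galois_group_def)
qed

lemma Gal_one: "\<one>\<^bsub>Gal\<^esub> = (\<lambda>x\<in>L. x)"
  by (simp add: galois_group_def BijGroup_def)

lemma Gal_mult:
  assumes "\<sigma> \<in> carrier Gal" "\<tau> \<in> carrier Gal" "x \<in> L"
  shows "(\<sigma> \<otimes>\<^bsub>Gal\<^esub> \<tau>) x = \<sigma> (\<tau> x)"
  using assms by (auto simp: carrier_Gal) (simp add: galois_group_def BijGroup_def compose_def)

lemma Gal_closed: "\<sigma> \<in> carrier Gal \<Longrightarrow> x \<in> L \<Longrightarrow> \<sigma> x \<in> L"
  by (auto simp: carrier_Gal Bij_def bij_betw_def)

lemma Gal_inj: "\<sigma> \<in> carrier Gal \<Longrightarrow> x \<in> L \<Longrightarrow> y \<in> L \<Longrightarrow> \<sigma> x = \<sigma> y \<longleftrightarrow> x = y"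
  by (auto simp: carrier_Gal Bij_def bij_betw_def inj_on_def)

lemma Gal_add: "\<sigma> \<in> carrier Gal \<Longrightarrow> x \<in> L \<Longrightarrow> y \<in> L \<Longrightarrow> \<sigma> (x + y) = \<sigma> x + \<sigma> y"
  by (simp add: carrier_Gal)

lemma Gal_times: "\<sigma> \<in> carrier Gal \<Longrightarrow> x \<in> L \<Longrightarrow> y \<in> L \<Longrightarrow> \<sigma> (x * y) = \<sigma> x * \<sigma> y"
  by (simp add: carrier_Gal)

lemma Gal_Rats: "\<sigma> \<in> carrier Gal \<Longrightarrow> q \<in> \<rat> \<Longrightarrow> \<sigma> q = q"
  by (simp add: carrier_Gal)

lemma Gal_sum: "\<sigma> \<in> carrier Gal \<Longrightarrow> (\<And>i. i \<in> I \<Longrightarrow> f i \<in> L) \<Longrightarrow> \<sigma> (sum f I) = (\<Sum>i\<in>I. \<sigma> (f i))"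
  by (induction I rule: infinite_finite_induct) (auto simp: Gal_Rats Gal_add L_sum)

lemma Gal_prod: "\<sigma> \<in> carrier Gal \<Longrightarrow> (\<And>i. i \<in> I \<Longrightarrow> f i \<in> L) \<Longrightarrow> \<sigma> (prod f I) = (\<Prod>i\<in>I. \<sigma> (f i))"
  by (induction I rule: infinite_finite_induct) (auto simp: Gal_Rats Gal_times L_prod)

lemma Gal_power: "\<sigma> \<in> carrier Gal \<Longrightarrow> x \<in> L \<Longrightarrow> \<sigma> (x ^ k) = \<sigma> x ^ k"
  by (induction k) (auto simp: Gal_Rats Gal_times L_power)

lemma Gal_ipoly: "\<sigma> \<in> carrier Gal \<Longrightarrow> x \<in> L \<Longrightarrow> \<sigma> (ipoly p x) = ipoly p (\<sigma> x)"
  unfolding ipoly_altdef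
  by (subst Gal_sum)
     (auto simp: Gal_times Gal_power Gal_Rats Rats_sub_cyclotomic L_power intro!: L_mult)

lemma Gal_divide_int:
  assumes "\<sigma> \<in> carrier Gal" "x \<in> L"
  shows "\<sigma> (x / of_int d) = \<sigma> x / of_int d"
proof -
  have r: "inverse (of_int d) \<in> (\<rat> :: complex set)" by (intro Rats_inverse) simp
  show ?thesis
    using Gal_times[OF assms(1,2) Rats_sub_cyclotomic[OF r]] Gal_Rats[OF assms(1) r]
    by (simp add: divide_inverse)
qed

lemma Gal_inv:
  assumes "\<sigma> \<in> carrier Gal" "x \<in> L"
  shows "(inv\<^bsub>Gal\<^esub> \<sigma>) (\<sigma> x) = x" "\<sigma> ((inv\<^bsub>Gal\<^esub> \<sigma>) x) = x"
proof -
  interpret group Gal by (rule Gal_group)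
  have i: "inv\<^bsub>Gal\<^esub> \<sigma> \<in> carrier Gal" using assms by simp
  show "(inv\<^bsub>Gal\<^esub> \<sigma>) (\<sigma> x) = x" "\<sigma> ((inv\<^bsub>Gal\<^esub> \<sigma>) x) = x"
    using assms i by (simp_all add: Gal_mult[symmetric] Gal_one)
qed

lemma Gal_eqI:
  assumes "\<sigma> \<in> carrier Gal" "\<tau> \<in> carrier Gal" "\<sigma> \<zeta> = \<tau> \<zeta>" shows "\<sigma> = \<tau>"
proof (rule extensionalityI)
  show "\<sigma> \<in> extensional L" "\<tau> \<in> extensional L" using assms by (auto simp: carrier_Gal Bij_def)
  fix x assume "x \<in> L"
  then obtain p d where x: "x = ipoly p \<zeta> / of_int d" by (elim cyclotomic_fieldE)
  have "ipoly p \<zeta> \<in> L" using int_adjoin_sub_cyclotomic int_adjoinI by blast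
  then show "\<sigma> x = \<tau> x"
    unfolding x using assms by (simp add: Gal_divide_int Gal_ipoly zeta_in_L)
qed

text \<open>
  The image of \<open>\<zeta>\<close> is an \<open>n\<close>-th root of unity, hence a power \<open>\<zeta>\<^sup>k\<close>; if \<open>k\<close> had a common factor
  with \<open>n\<close>, then a power of \<open>\<zeta>\<close> other than \<open>1\<close> would be mapped to \<open>1\<close>.
\<close>
lemma Gal_zeta:
  assumes s: "\<sigma> \<in> carrier Gal"
  obtains k where "coprime k n" "\<sigma> \<zeta> = \<zeta> ^ k"
proof -
  have "\<sigma> \<zeta> ^ n = \<sigma> (\<zeta> ^ n)" by (simp add: Gal_power[OF s] zeta_in_L)
  also have "\<dots> = 1" unfolding zeta_power_n by (simp add: Gal_Rats[OF s])
  finally obtain k where k: "\<sigma> \<zeta> = \<zeta> ^ k" by (auto elim: roots_of_unity_powers)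
  let ?e = "n div gcd k n"
  have "\<sigma> (\<zeta> ^ ?e) = \<zeta> ^ (k * ?e)" by (simp add: Gal_power[OF s] zeta_in_L k power_mult)
  also have "n dvd k * ?e" by (metis div_mult_swap dvd_triv_left gcd_dvd1 gcd_dvd2 mult.commute)
  then have "\<zeta> ^ (k * ?e) = 1" by (simp add: zeta_power_eq_1_iff)
  also have "1 = \<sigma> 1" by (simp add: Gal_Rats[OF s])
  finally have "\<zeta> ^ ?e = 1" using Gal_inj[OF s] by (simp add: L_power zeta_in_L Rats_sub_cyclotomic)
  then have "n dvd ?e" by (simp add: zeta_power_eq_1_iff)
  have ge: "gcd k n * ?e = n" by simp
  then have "?e > 0" using n_pos by (metis mult_0_right not_gr_zero)
  with \<open>n dvd ?e\<close> have "n \<le> ?e" by (rule dvd_imp_le)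
  then have "gcd k n * ?e \<le> 1 * ?e" unfolding ge by simp
  then have "gcd k n \<le> 1" using \<open>?e > 0\<close> by (simp only: mult_le_cancel2)
  moreover have "gcd k n \<noteq> 0" using n_pos by simp
  ultimately have "gcd k n = 1" by linarith
  then have "coprime k n" unfolding coprime_iff_gcd_eq_1 .
  then show ?thesis using that k by blast
qed

text \<open>
  The rule \<open>p(\<zeta>) / d \<mapsto> p(\<zeta>\<^sup>m) / d\<close> is well defined by \<open>ipoly_root_conjugate\<close>, and the rule for an
  inverse of \<open>m\<close> modulo \<open>n\<close> inverts it.
\<close>
lemma Gal_exists:
  assumes m: "coprime m n"
  obtains \<sigma> where "\<sigma> \<in> carrier Gal" "\<sigma> \<zeta> = \<zeta> ^ m"
proof -
  \<comment> \<open>The value is chosen over all presentations \<open>y = p(\<zeta>) / d\<close>; they all give the same one.\<close>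
  define s where "s = (\<lambda>k. \<lambda>y\<in>L. SOME z. \<exists>p d. d \<noteq> 0 \<and> y = ipoly p \<zeta> / of_int d \<and> z = ipoly p (\<zeta> ^ k) / of_int d)"
  have s: "s k (ipoly p \<zeta> / of_int d) = ipoly p (\<zeta> ^ k) / of_int d"
    if k: "coprime k n" and d: "d \<noteq> 0" for k p d
  proof -
    let ?y = "ipoly p \<zeta> / of_int d"
    have "z = ipoly p (\<zeta> ^ k) / of_int d"
      if z: "\<exists>p d. d \<noteq> 0 \<and> ?y = ipoly p \<zeta> / of_int d \<and> z = ipoly p (\<zeta> ^ k) / of_int d" for z
    proof -
      obtain q e where q: "e \<noteq> 0" "?y = ipoly q \<zeta> / of_int e" "z = ipoly q (\<zeta> ^ k) / of_int e"
        using z by blast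
      have "ipoly (Polynomial.smult e p - Polynomial.smult d q) \<zeta> = 0"
        using q d by (simp only: ipoly_diff ipoly_smult) (simp add: field_simps)
      then have "ipoly (Polynomial.smult e p - Polynomial.smult d q) (\<zeta> ^ k) = 0"
        using ipoly_root_conjugate k by blast
      then have "of_int e * ipoly p (\<zeta> ^ k) = of_int d * ipoly q (\<zeta> ^ k)"
        by (simp only: ipoly_diff ipoly_smult) simp
      then show ?thesis unfolding q(3) using q(1) d by (simp add: frac_eq_eq mult.commute)
    qed
    then have "(SOME z. \<exists>p d. d \<noteq> 0 \<and> ?y = ipoly p \<zeta> / of_int d \<and> z = ipoly p (\<zeta> ^ k) / of_int d)
        = ipoly p (\<zeta> ^ k) / of_int d"
      by (intro some_equality) (use d in blast)+
    then show ?thesis unfolding s_def using cyclotomic_fieldI[OF d] by simp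
  qed
  have closed: "s k y \<in> L" if k: "coprime k n" and y: "y \<in> L" for k y
  proof -
    obtain p d where pd: "y = ipoly p \<zeta> / of_int d" "d \<noteq> 0" using y by (elim cyclotomic_fieldE)
    have "ipoly p (\<zeta> ^ k) \<in> int_adjoin \<zeta>"
      by (intro int_adjoin_ipoly int_adjoin_power int_adjoin_self)
    then show ?thesis unfolding pd(1) s[OF k pd(2)] using pd(2) cyclotomic_field_altdef by blast
  qed
  obtain m' where m': "[m * m' = 1] (mod n)" "coprime m' n"
  proof -
    obtain x where x: "[m * x = 1] (mod n)" using cong_solve_coprime_nat[OF m] by auto
    then have "coprime x n" by (meson cong_imp_coprime cong_sym coprime_1_left coprime_mult_left_iff)
    then show ?thesis using that x by blast
  qed
  have inverse: "s k (s l y) = y" if kl: "coprime k n" "coprime l n" "[k * l = 1] (mod n)" and y: "y \<in> L" for k l y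
  proof -
    obtain p d where pd: "y = ipoly p \<zeta> / of_int d" "d \<noteq> 0" using y by (elim cyclotomic_fieldE)
    have "s l y = ipoly (pcompose p (monom 1 l)) \<zeta> / of_int d"
      unfolding pd(1) s[OF kl(2) pd(2)] by (simp add: ipoly_pcompose poly_monom)
    then have "s k (s l y) = ipoly (pcompose p (monom 1 l)) (\<zeta> ^ k) / of_int d"
      using s[OF kl(1) pd(2)] by simp
    also have "\<dots> = ipoly p (\<zeta> ^ (k * l)) / of_int d"
      by (simp add: ipoly_pcompose poly_monom power_mult)
    also have "\<zeta> ^ (k * l) = \<zeta> ^ 1" using kl(3) zeta_power_eq_iff by blast
    finally show ?thesis using pd by simp
  qed
  have mm: "[m' * m = 1] (mod n)" using m' by (simp add: mult.commute)
  have "s m \<in> Bij L"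
    unfolding Bij_def
  proof (intro IntI CollectI)
    show "s m \<in> extensional L" unfolding s_def by simp
    show "bij_betw (s m) L L"
      by (rule bij_betw_byWitness[where f' = "s m'"])
         (use inverse[OF m m'(2,1)] inverse[OF m'(2) m mm] closed[OF m] closed[OF m'(2)] in auto)
  qed
  moreover have "s m (x + y) = s m x + s m y \<and> s m (x * y) = s m x * s m y" if xy: "x \<in> L" "y \<in> L" for x y
  proof -
    obtain p d where pd: "x = ipoly p \<zeta> / of_int d" "d \<noteq> 0" using xy by (elim cyclotomic_fieldE)
    obtain q e where qe: "y = ipoly q \<zeta> / of_int e" "e \<noteq> 0" using xy by (elim cyclotomic_fieldE)
    have de: "d * e \<noteq> 0" using pd qe by simp
    have "x + y = ipoly (Polynomial.smult e p + Polynomial.smult d q) \<zeta> / of_int (d * e)"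
      using pd qe by (simp only: ipoly_add ipoly_smult) (simp add: field_simps)
    then have "s m (x + y) = ipoly (Polynomial.smult e p + Polynomial.smult d q) (\<zeta> ^ m) / of_int (d * e)"
      using s[OF m de] by metis
    moreover have "x * y = ipoly (p * q) \<zeta> / of_int (d * e)"
      using pd qe by (simp only: ipoly_mult) simp
    then have "s m (x * y) = ipoly (p * q) (\<zeta> ^ m) / of_int (d * e)" using s[OF m de] by metis
    moreover have "s m x = ipoly p (\<zeta> ^ m) / of_int d" using s[OF m pd(2)] pd(1) by simp
    moreover have "s m y = ipoly q (\<zeta> ^ m) / of_int e" using s[OF m qe(2)] qe(1) by simp
    ultimately show ?thesis using pd qe
      by (simp only: ipoly_add ipoly_smult ipoly_mult) (simp add: field_simps)
  qed
  moreover have "s m q = q" if "q \<in> \<rat>" for q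
  proof -
    obtain a b where ab: "b > 0" "q = of_int a / of_int b" using \<open>q \<in> \<rat>\<close> by (auto elim: Rats_cases')
    then have "q = ipoly [:a:] \<zeta> / of_int b" by (simp only: ipoly_const)
    then have "s m q = ipoly [:a:] (\<zeta> ^ m) / of_int b" using s[OF m, of b] ab by simp
    then show ?thesis using ab by (simp only: ipoly_const)
  qed
  ultimately have "s m \<in> carrier Gal" unfolding carrier_Gal by blast
  moreover have "s m \<zeta> = \<zeta> ^ m" using s[OF m, of 1 "monom 1 1"] by (simp only: ipoly_monom) simp
  ultimately show ?thesis using that by blast
qed

lemma finite_Gal: "finite (carrier Gal)"
proof (rule finite_imageD)
  show "inj_on (\<lambda>\<sigma>. \<sigma> \<zeta>) (carrier Gal)" by (auto intro: inj_onI Gal_eqI)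
  have "(\<lambda>\<sigma>. \<sigma> \<zeta>) ` carrier Gal \<subseteq> (\<lambda>k. \<zeta> ^ k) ` {..<n}"
  proof safe
    fix \<sigma> assume "\<sigma> \<in> carrier Gal"
    then obtain k where "\<sigma> \<zeta> = \<zeta> ^ k" by (elim Gal_zeta)
    then have "\<sigma> \<zeta> = \<zeta> ^ (k mod n)" by (simp add: zeta_power_mod)
    then show "\<sigma> \<zeta> \<in> (\<lambda>k. \<zeta> ^ k) ` {..<n}" using n_pos by auto
  qed
  then show "finite ((\<lambda>\<sigma>. \<sigma> \<zeta>) ` carrier Gal)" using finite_surj by blast
qed

lemma cnj_Gal:
  obtains \<sigma> where "\<sigma> \<in> carrier Gal" "\<And>x. x \<in> L \<Longrightarrow> \<sigma> x = cnj x"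
proof -
  have "coprime (n - 1) n" using n_pos by (rule coprime_diff_one_left_nat)
  then obtain \<sigma> where s: "\<sigma> \<in> carrier Gal" "\<sigma> \<zeta> = \<zeta> ^ (n - 1)" by (elim Gal_exists)
  have "norm \<zeta> = 1" using power_eq_1_iff[OF zeta_power_n] n_pos by simp
  then have "\<zeta> * cnj \<zeta> = 1" by (simp add: complex_norm_square[symmetric])
  moreover have "\<zeta> * \<zeta> ^ (n - 1) = 1" using zeta_power_n n_pos by (metis power_minus_mult mult.commute)
  ultimately have z: "\<sigma> \<zeta> = cnj \<zeta>" using s(2) zeta_nonzero by (metis mult_left_cancel)
  have "\<sigma> x = cnj x" if "x \<in> L" for x
  proof -
    obtain p d where pd: "x = ipoly p \<zeta> / of_int d" using \<open>x \<in> L\<close> by (elim cyclotomic_fieldE)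
    have "ipoly p \<zeta> \<in> L" using int_adjoin_sub_cyclotomic int_adjoinI by blast
    then show ?thesis
      unfolding pd by (simp add: Gal_divide_int[OF s(1)] Gal_ipoly[OF s(1) zeta_in_L] z ipoly_cnj)
  qed
  then show ?thesis using that s(1) by blast
qed

end

text \<open>
  Sorting all residues by their greatest common divisor with \<open>n\<close> expresses the full power sum,
  which is \<open>0\<close> or \<open>n\<close>, through such sums for the divisors of \<open>n\<close>.
\<close>
lemma ramanujan_sum_int:
  fixes w :: complex
  assumes "n > 0" "w ^ n = 1"
  shows "(\<Sum>m\<in>totatives n. w ^ m) \<in> \<int>"
  using assms
proof (induction n arbitrary: w rule: less_induct)
  case (less n)
  have split: "{0<..n} = (\<Union>d\<in>{d. d dvd n}. {k\<in>{0<..n}. gcd k n = d})" by auto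
  have fin: "finite {d. d dvd n}" using less.prems by simp
  have "(\<Sum>m\<in>{0<..n}. w ^ m) = (\<Sum>d\<in>{d. d dvd n}. \<Sum>m\<in>{k\<in>{0<..n}. gcd k n = d}. w ^ m)"
    by (subst split, rule sum.UNION_disjoint[OF fin]) auto
  also have "\<dots> = (\<Sum>d\<in>{d. d dvd n}. \<Sum>m\<in>totatives (n div d). (w ^ d) ^ m)"
  proof (rule sum.cong[OF refl])
    fix d assume "d \<in> {d. d dvd n}"
    then have d: "d dvd n" by simp
    show "(\<Sum>m\<in>{k\<in>{0<..n}. gcd k n = d}. w ^ m) = (\<Sum>m\<in>totatives (n div d). (w ^ d) ^ m)"
      using sum.reindex_bij_betw[OF bij_betw_totatives_gcd_eq[OF d], of "\<lambda>m. w ^ m"] less.prems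
      by (simp add: power_mult[symmetric] mult.commute)
  qed
  also have "\<dots> = (\<Sum>m\<in>totatives n. w ^ m) + (\<Sum>d\<in>{d. d dvd n} - {1}. \<Sum>m\<in>totatives (n div d). (w ^ d) ^ m)"
    by (subst sum.remove[OF fin, of 1]) auto
  finally have eq: "(\<Sum>m\<in>totatives n. w ^ m) = (\<Sum>m\<in>{0<..n}. w ^ m)
      - (\<Sum>d\<in>{d. d dvd n} - {1}. \<Sum>m\<in>totatives (n div d). (w ^ d) ^ m)" by simp
  have "(\<Sum>d\<in>{d. d dvd n} - {1}. \<Sum>m\<in>totatives (n div d). (w ^ d) ^ m) \<in> \<int>"
  proof (rule Ints_sum)
    fix d assume "d \<in> {d. d dvd n} - {1}"
    then have d: "d dvd n" "d \<noteq> 1" by auto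
    then have "d > 0" "d > 1" using less.prems by (auto intro: Nat.gr0I)
    then show "(\<Sum>m\<in>totatives (n div d). (w ^ d) ^ m) \<in> \<int>"
      using d less.prems by (intro less.IH) (auto simp: power_mult[symmetric] div_greater_zero_iff dvd_imp_le)
  qed
  moreover have "(\<Sum>m\<in>{0<..n}. w ^ m) \<in> \<int>"
  proof (cases "w = 1")
    case True then show ?thesis by simp
  next
    case False
    have "{0<..n} = Suc ` {..<n}" by (auto simp: image_iff) (metis Suc_pred lessThan_iff Suc_le_lessD)
    then have "(\<Sum>m\<in>{0<..n}. w ^ m) = w * (\<Sum>m<n. w ^ m)"
      by (simp add: sum.reindex sum_distrib_left)
    also have "(\<Sum>m<n. w ^ m) = 0" using False less.prems by (simp add: geometric_sum)
    finally show ?thesis by simp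
  qed
  ultimately show ?case unfolding eq by (rule Ints_diff[rotated])
qed

context root_of_unity
begin

text \<open>
  The average of \<open>y\<close> over the Galois group is \<open>y\<close> itself. On the other hand it is a rational
  combination of sums of \<open>(\<zeta>\<^sup>k)\<^sup>m\<close> over the residues \<open>m\<close> prime to \<open>n\<close>, which are integers.
\<close>
lemma Gal_fixed_rational:
  assumes y: "y \<in> L" and fixed: "\<And>\<sigma>. \<sigma> \<in> carrier Gal \<Longrightarrow> \<sigma> y = y"
  shows "y \<in> \<rat>"
proof -
  obtain p d where pd: "y = ipoly p \<zeta> / of_int d" "d \<noteq> 0" using y by (elim cyclotomic_fieldE)
  have pL: "ipoly p \<zeta> \<in> L" using int_adjoin_sub_cyclotomic int_adjoinI by blast
  have conj: "ipoly p (\<zeta> ^ m) = ipoly p \<zeta>" if "m \<in> totatives n" for m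
  proof -
    have "coprime m n" using that by (simp add: in_totatives_iff)
    then obtain \<sigma> where s: "\<sigma> \<in> carrier Gal" "\<sigma> \<zeta> = \<zeta> ^ m" by (elim Gal_exists)
    then have "ipoly p (\<zeta> ^ m) / of_int d = ipoly p \<zeta> / of_int d"
      using fixed[OF s(1)] unfolding pd(1) by (simp add: Gal_divide_int pL Gal_ipoly zeta_in_L)
    then show ?thesis using pd by simp
  qed
  have "of_nat (totient n) * ipoly p \<zeta> = (\<Sum>m\<in>totatives n. ipoly p (\<zeta> ^ m))"
    by (simp add: conj totient_def)
  also have "\<dots> = (\<Sum>k\<le>degree p. of_int (coeff p k) * (\<Sum>m\<in>totatives n. (\<zeta> ^ k) ^ m))"
    unfolding ipoly_altdef sum_distrib_left
    by (subst sum.swap) (simp add: power_mult[symmetric] mult.commute)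
  also have "\<dots> \<in> \<int>"
    by (intro Ints_sum Ints_mult ramanujan_sum_int n_pos Ints_of_int)
       (simp add: power_mult[symmetric] zeta_power_eq_1_iff)
  finally have "of_nat (totient n) * ipoly p \<zeta> \<in> \<rat>" by (rule Ints_subset_Rats[THEN subsetD])
  then have "of_nat (totient n) * ipoly p \<zeta> / of_nat (totient n) / of_int d \<in> \<rat>"
    by (intro Rats_divide) auto
  moreover have "totient n \<noteq> 0" using n_pos by simp
  ultimately show ?thesis using pd by simp
qed

lemma Gal_fixed_integer:
  assumes "y \<in> int_adjoin \<zeta>" "\<And>\<sigma>. \<sigma> \<in> carrier Gal \<Longrightarrow> \<sigma> y = y"
  shows "y \<in> \<int>"
proof (rule int_adjoin_rational[OF assms(1)])
  show "y \<in> \<rat>" by (rule Gal_fixed_rational) (use assms int_adjoin_sub_cyclotomic in auto)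
qed

lemma galois_exp:
  assumes "\<sigma> \<in> carrier Gal"
  shows "coprime (galois_exp n \<zeta> \<sigma>) (int n)" "\<sigma> \<zeta> = \<zeta> powi galois_exp n \<zeta> \<sigma>"
proof -
  obtain k where k: "coprime k n" "\<sigma> \<zeta> = \<zeta> ^ k" using assms by (elim Gal_zeta)
  have "\<exists>m. coprime m (int n) \<and> \<sigma> \<zeta> = \<zeta> powi m"
    by (rule exI[of _ "int k"]) (use k in auto)
  from someI_ex[OF this]
  show "coprime (galois_exp n \<zeta> \<sigma>) (int n)" "\<sigma> \<zeta> = \<zeta> powi galois_exp n \<zeta> \<sigma>"
    unfolding galois_exp_def by auto
qed

text \<open>
  The exponent entering the action on classes is an arbitrary choice; this makes every exponent
  \<open>k\<close> with \<open>\<sigma> \<zeta> = \<zeta>\<^sup>k\<close> as good as the chosen one.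
\<close>
lemma galois_exp_cong:
  assumes s: "\<sigma> \<in> carrier Gal" and k: "\<sigma> \<zeta> = \<zeta> ^ k"
  shows "[galois_exp n \<zeta> \<sigma> = int k] (mod int n)"
proof -
  let ?m = "galois_exp n \<zeta> \<sigma>"
  define r where "r = nat (?m mod int n)"
  have r: "int r = ?m mod int n" unfolding r_def using n_pos by simp
  have "?m = int n * (?m div int n) + int r" unfolding r by simp
  then have "\<zeta> powi ?m = \<zeta> powi (int n * (?m div int n) + int r)" by simp
  also have "\<dots> = (\<zeta> ^ n) powi (?m div int n) * \<zeta> ^ r"
    using zeta_nonzero by (simp add: power_int_add power_int_mult)
  also have "\<dots> = \<zeta> ^ r" by (simp add: zeta_power_n)
  finally have "\<zeta> ^ r = \<zeta> ^ k" using galois_exp(2)[OF s] k by simp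
  then have "[int r = int k] (mod int n)" by (simp add: zeta_power_eq_iff cong_int_iff)
  then show ?thesis unfolding r by (simp add: cong_def)
qed

end


section \<open>Linear algebra over the complex numbers\<close>

lemma subspace_vec_iff:
  "VectorSpace.subspace class_ring W (module_vec TYPE(complex) d) \<longleftrightarrow>
     W \<subseteq> carrier_vec d \<and> 0\<^sub>v d \<in> W \<and> (\<forall>v\<in>W. \<forall>w\<in>W. v + w \<in> W) \<and> (\<forall>c. \<forall>v\<in>W. c \<cdot>\<^sub>v v \<in> W)"
  unfolding VectorSpace.subspace_def submodule_def
  using vec_vs[of d, where 'a = complex] vec_module[of d, where 'a = complex]
  by (auto simp: module_vec_simps)

text \<open>
  The columns of an injective matrix are a basis of its range. Subspaces are handled through such
  matrices, which avoids bases as sets and lets intertwining be expressed by matrix equations.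
\<close>
definition inj_mat :: "complex mat \<Rightarrow> bool" where
  "inj_mat B \<longleftrightarrow> (\<forall>x\<in>carrier_vec (dim_col B). B *\<^sub>v x = 0\<^sub>v (dim_row B) \<longrightarrow> x = 0\<^sub>v (dim_col B))"

lemma inj_matD:
  assumes "inj_mat B" "B \<in> carrier_mat N k" "x \<in> carrier_vec k" "B *\<^sub>v x = 0\<^sub>v N"
  shows "x = 0\<^sub>v k"
  using assms unfolding inj_mat_def by auto

lemma inj_mat_vec_cancel:
  assumes B: "inj_mat B" "B \<in> carrier_mat N k" and xy: "x \<in> carrier_vec k" "y \<in> carrier_vec k"
    and eq: "B *\<^sub>v x = B *\<^sub>v y"
  shows "x = y"
proof -
  have "B *\<^sub>v (x - y) = B *\<^sub>v x - B *\<^sub>v y" using B xy by (intro mult_minus_distrib_mat_vec)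
  also have "\<dots> = 0\<^sub>v N" unfolding eq using B xy by (intro minus_cancel_vec mult_mat_vec_carrier)
  finally have "x - y = 0\<^sub>v k" using inj_matD[OF B] xy by simp
  then show ?thesis
    using xy by (metis minus_add_minus_vec minus_zero_vec carrier_vecD eq_vecI index_minus_vec(1) index_zero_vec(1) right_minus_eq)
qed

lemma inj_mat_cancel:
  assumes B: "inj_mat B" "B \<in> carrier_mat N k" and UV: "U \<in> carrier_mat k m" "V \<in> carrier_mat k m"
    and eq: "B * U = B * V"
  shows "U = V"
proof (rule mat_col_eqI)
  show "dim_row U = dim_row V" "dim_col U = dim_col V" using UV by auto
  fix j assume "j < dim_col V"
  then have j: "j < m" using UV by simp
  have "B *\<^sub>v col U j = B *\<^sub>v col V j"
    using col_mult2[OF B(2) UV(1) j] col_mult2[OF B(2) UV(2) j] eq by simp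
  moreover have "col U j \<in> carrier_vec k" "col V j \<in> carrier_vec k" using UV by auto
  ultimately show "col U j = col V j" using inj_mat_vec_cancel[OF B] by blast
qed

lemma inj_mat_mult:
  assumes "inj_mat B" "B \<in> carrier_mat N k" "inj_mat C" "C \<in> carrier_mat k l"
  shows "inj_mat (B * C)"
  unfolding inj_mat_def
proof (intro ballI impI)
  fix x assume x: "x \<in> carrier_vec (dim_col (B * C))" "(B * C) *\<^sub>v x = 0\<^sub>v (dim_row (B * C))"
  then have x': "x \<in> carrier_vec l" using assms by auto
  have "B *\<^sub>v (C *\<^sub>v x) = 0\<^sub>v N" using x assms x' by (simp add: assoc_mult_mat_vec)
  then have "C *\<^sub>v x = 0\<^sub>v k" using inj_matD[OF assms(1,2)] assms(4) x' mult_mat_vec_carrier by blast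
  then show "x = 0\<^sub>v (dim_col (B * C))" using inj_matD[OF assms(3,4) x'] assms by simp
qed

text \<open>
  The vectors, padded by a zero coordinate, are the columns of a square matrix with a zero row, whose
  determinant vanishes.
\<close>
lemma wide_dependent:
  fixes b :: "nat \<Rightarrow> complex vec"
  shows "\<exists>c. (\<exists>j\<le>N. c j \<noteq> 0) \<and> (\<forall>i<N. (\<Sum>j\<le>N. c j * b j $ i) = 0)"
proof -
  define A where "A = mat (Suc N) (Suc N) (\<lambda>(i, j). if i < N then b j $ i else 0)"
  have A: "A \<in> carrier_mat (Suc N) (Suc N)" unfolding A_def by simp
  have "transpose_mat A *\<^sub>v unit_vec (Suc N) N = 0\<^sub>v (Suc N)"
    by (rule eq_vecI) (auto simp: A_def scalar_prod_def unit_vec_def if_distrib cong: if_cong)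
  moreover have "unit_vec (Suc N) N \<noteq> (0\<^sub>v (Suc N) :: complex vec)" by simp
  ultimately have "det (transpose_mat A) = 0"
    using det_0_iff_vec_prod_zero[of "transpose_mat A" "Suc N"] A by (metis transpose_carrier_mat unit_vec_carrier)
  then have "det A = 0" using det_transpose[OF A] by simp
  then obtain v where v: "v \<in> carrier_vec (Suc N)" "v \<noteq> 0\<^sub>v (Suc N)" "A *\<^sub>v v = 0\<^sub>v (Suc N)"
    using det_0_iff_vec_prod_zero[OF A] by blast
  have "\<exists>j\<le>N. v $ j \<noteq> 0"
  proof (rule ccontr)
    assume "\<not> (\<exists>j\<le>N. v $ j \<noteq> 0)"
    then have "v = 0\<^sub>v (Suc N)" using v(1) by (intro eq_vecI) auto
    then show False using v(2) by simp
  qed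
  moreover have "(\<Sum>j\<le>N. v $ j * b j $ i) = 0" if "i < N" for i
  proof -
    have "0 = (A *\<^sub>v v) $ i" using v(3) that by simp
    also have "\<dots> = (\<Sum>j<Suc N. b j $ i * v $ j)"
      using that v(1) by (auto simp: A_def scalar_prod_def lessThan_atLeast0 intro!: sum.cong)
    finally show ?thesis by (simp add: lessThan_Suc_atMost mult.commute)
  qed
  ultimately show ?thesis by blast
qed

text \<open>
  The columns of \<open>B\<close> are a linearly independent family in \<open>W\<close> of maximal length; a vector of
  \<open>W\<close> outside their span could be appended.
\<close>
lemma subspace_basis_mat:
  assumes W: "VectorSpace.subspace class_ring W (module_vec TYPE(complex) N)"
  obtains k B where "k \<le> N" "B \<in> carrier_mat N k" "inj_mat B"
    "W = (\<lambda>x. B *\<^sub>v x) ` carrier_vec k" "k = N \<Longrightarrow> W = carrier_vec N"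
proof -
  define indep where "indep = (\<lambda>k (b :: nat \<Rightarrow> complex vec).
     \<forall>c. (\<forall>i<N. (\<Sum>j<k. c j * b j $ i) = 0) \<longrightarrow> (\<forall>j<k. c j = 0))"
  have indepD: "c j = 0" if "indep k b" "\<And>i. i < N \<Longrightarrow> (\<Sum>j<k. c j * b j $ i) = 0" "j < k" for k b c j
  proof -
    have "(\<forall>i<N. (\<Sum>j<k. c j * b j $ i) = 0) \<longrightarrow> (\<forall>j<k. c j = 0)"
      using that(1) unfolding indep_def by (rule spec)
    then show ?thesis using that(2,3) by blast
  qed
  define P where "P = (\<lambda>k. \<exists>b. (\<forall>j<k. b j \<in> W) \<and> indep k b)"
  have Ws: "W \<subseteq> carrier_vec N" "0\<^sub>v N \<in> W" "\<And>v w. v \<in> W \<Longrightarrow> w \<in> W \<Longrightarrow> v + w \<in> W"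
    "\<And>c v. v \<in> W \<Longrightarrow> c \<cdot>\<^sub>v v \<in> W" using W unfolding subspace_vec_iff by auto
  have bound: "k \<le> N" if "indep k b" for k b
  proof (rule ccontr)
    assume "\<not> k \<le> N"
    then have k: "Suc N \<le> k" by simp
    obtain c where c: "\<exists>j\<le>N. c j \<noteq> 0" "\<forall>i<N. (\<Sum>j\<le>N. c j * b j $ i) = 0"
      using wide_dependent[of N b] by blast
    define c' where "c' = (\<lambda>j. if j \<le> N then c j else 0)"
    have "(\<Sum>j<k. c' j * b j $ i) = (\<Sum>j\<le>N. c j * b j $ i)" for i
      unfolding c'_def using k by (intro sum.mono_neutral_cong_right) auto
    then have "(\<Sum>j<k. c' j * b j $ i) = 0" if "i < N" for i using c(2) that by metis
    then have "c' j = 0" if "j < k" for j by (rule indepD[OF \<open>indep k b\<close> _ that])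
    moreover obtain j where "j \<le> N" "c j \<noteq> 0" using c(1) by blast
    ultimately have "c' j = 0" using k by simp
    then show False using \<open>j \<le> N\<close> \<open>c j \<noteq> 0\<close> unfolding c'_def by simp
  qed
  have extend: "(\<exists>c. w = vec N (\<lambda>i. \<Sum>j<k. c j * b j $ i)) \<or> indep (Suc k) (b(k := w))"
    if w: "w \<in> carrier_vec N" and b: "indep k b" for w k b
  proof (rule disjCI)
    assume no: "\<not> indep (Suc k) (b(k := w))"
    then obtain c where c: "\<forall>i<N. (\<Sum>j<Suc k. c j * (b(k := w)) j $ i) = 0" "\<exists>j<Suc k. c j \<noteq> 0"
      unfolding indep_def by blast
    have eq: "(\<Sum>j<k. c j * b j $ i) + c k * w $ i = 0" if "i < N" for i
      using c(1) that by simp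
    have "c k \<noteq> 0"
    proof
      assume c0: "c k = 0"
      then have "(\<Sum>j<k. c j * b j $ i) = 0" if "i < N" for i using eq[OF that] by simp
      then have "c j = 0" if "j < k" for j by (rule indepD[OF b _ that])
      then show False using c(2) c0 by (auto simp: less_Suc_eq)
    qed
    have "w = vec N (\<lambda>i. \<Sum>j<k. (- c j / c k) * b j $ i)"
    proof (rule eq_vecI)
      fix i assume "i < dim_vec (vec N (\<lambda>i. \<Sum>j<k. (- c j / c k) * b j $ i))"
      then have i: "i < N" by simp
      have "w $ i = - (\<Sum>j<k. c j * b j $ i) / c k"
        using eq[OF i] \<open>c k \<noteq> 0\<close> by (simp add: field_simps add_eq_0_iff)
      also have "\<dots> = (\<Sum>j<k. (- c j / c k) * b j $ i)"
        by (simp add: sum_divide_distrib sum_negf)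
      finally show "w $ i = vec N (\<lambda>i. \<Sum>j<k. (- c j / c k) * b j $ i) $ i" using i by simp
    qed (use w in simp)
    then show "\<exists>c. w = vec N (\<lambda>i. \<Sum>j<k. c j * b j $ i)" by (rule exI[of _ "\<lambda>j. - c j / c k"])
  qed
  have "P 0" unfolding P_def indep_def by simp
  moreover have P_bound: "\<forall>l. P l \<longrightarrow> l < Suc N"
    using bound unfolding P_def by (meson less_Suc_eq_le)
  ultimately have "\<exists>k. P k \<and> (\<forall>l. P l \<longrightarrow> l \<le> k)"
    using ex_has_greatest_nat[of P 0 id "Suc N"] P_bound by simp
  then obtain k where k: "P k" "\<And>l. P l \<Longrightarrow> l \<le> k" by blast
  then obtain b where b: "\<And>j. j < k \<Longrightarrow> b j \<in> W" "indep k b" unfolding P_def by blast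
  define B where "B = mat N k (\<lambda>(i, j). b j $ i)"
  have B: "B \<in> carrier_mat N k" unfolding B_def by simp
  have Bx: "B *\<^sub>v x = vec N (\<lambda>i. \<Sum>j<k. x $ j * b j $ i)" if "x \<in> carrier_vec k" for x
    using that by (intro eq_vecI) (auto simp: B_def scalar_prod_def lessThan_atLeast0 mult.commute intro!: sum.cong)
  have inW: "vec N (\<lambda>i. \<Sum>j<l. c j * b j $ i) \<in> W" if "l \<le> k" for l c
    using that
  proof (induction l)
    case 0
    have "vec N (\<lambda>i. \<Sum>j<0. c j * b j $ i) = 0\<^sub>v N" by (intro eq_vecI) auto
    then show ?case using Ws(2) by simp
  next
    case (Suc l)
    have "b l \<in> carrier_vec N" using b(1)[of l] Suc Ws(1) by auto
    then have "vec N (\<lambda>i. \<Sum>j<Suc l. c j * b j $ i) = vec N (\<lambda>i. \<Sum>j<l. c j * b j $ i) + c l \<cdot>\<^sub>v b l"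
      by (intro eq_vecI) auto
    then show ?case using Suc b(1)[of l] Ws(3,4) by simp
  qed
  have span: "\<exists>x\<in>carrier_vec k. w = B *\<^sub>v x"
    if w: "w \<in> carrier_vec N" and no: "\<not> indep (Suc k) (b(k := w))" for w
  proof -
    obtain c where "w = vec N (\<lambda>i. \<Sum>j<k. c j * b j $ i)" using extend[OF w b(2)] no by blast
    then have "w = B *\<^sub>v vec k c" by (subst Bx) auto
    then show ?thesis by (intro bexI[of _ "vec k c"]) auto
  qed
  show ?thesis
  proof (rule that)
    show "k \<le> N" using bound b(2) by blast
    show "B \<in> carrier_mat N k" by (rule B)
    show "inj_mat B"
      unfolding inj_mat_def
    proof (intro ballI impI)
      fix x assume x: "x \<in> carrier_vec (dim_col B)" "B *\<^sub>v x = 0\<^sub>v (dim_row B)"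
      then have x': "x \<in> carrier_vec k" "B *\<^sub>v x = 0\<^sub>v N" using B by auto
      have "(\<Sum>j<k. x $ j * b j $ i) = 0" if "i < N" for i
        using arg_cong[OF x'(2), of "\<lambda>v. v $ i"] Bx[OF x'(1)] that by simp
      then have "x $ j = 0" if "j < k" for j by (rule indepD[OF b(2) _ that])
      then show "x = 0\<^sub>v (dim_col B)" using x'(1) B by (intro eq_vecI) auto
    qed
    show "W = (\<lambda>x. B *\<^sub>v x) ` carrier_vec k"
    proof (intro equalityI subsetI)
      fix w assume w: "w \<in> W"
      have "\<not> indep (Suc k) (b(k := w))"
      proof
        assume "indep (Suc k) (b(k := w))"
        then have "P (Suc k)" unfolding P_def using b(1) w
          by (intro exI[of _ "b(k := w)"]) (auto simp: less_Suc_eq)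
        then show False using k(2)[of "Suc k"] by simp
      qed
      then show "w \<in> (\<lambda>x. B *\<^sub>v x) ` carrier_vec k" using span[of w] w Ws(1) by blast
    next
      fix w assume "w \<in> (\<lambda>x. B *\<^sub>v x) ` carrier_vec k"
      then show "w \<in> W" using Bx inW[of k] by auto
    qed
    then have *: "W = (\<lambda>x. B *\<^sub>v x) ` carrier_vec k" .
    show "W = carrier_vec N" if "k = N"
    proof (rule equalityI[OF Ws(1)], rule subsetI)
      fix w :: "complex vec" assume w: "w \<in> carrier_vec N"
      have "\<not> indep (Suc k) (b(k := w))" using bound[of "Suc k"] that by auto
      then show "w \<in> W" using span[OF w] * by blast
    qed
  qed
qed

lemma mat_trace_mult_comm:
  assumes "A \<in> carrier_mat n m" "B \<in> carrier_mat m n"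
  shows "mat_trace (A * B) = mat_trace (B * A)"
proof -
  have "mat_trace (A * B) = (\<Sum>i<n. \<Sum>j<m. A $$ (i, j) * B $$ (j, i))"
    using assms unfolding mat_trace_def
    by (auto simp: scalar_prod_def lessThan_atLeast0 intro!: sum.cong)
  also have "\<dots> = (\<Sum>j<m. \<Sum>i<n. B $$ (j, i) * A $$ (i, j))"
    by (subst sum.swap) (simp add: mult.commute)
  also have "\<dots> = mat_trace (B * A)"
    using assms unfolding mat_trace_def
    by (auto simp: scalar_prod_def lessThan_atLeast0 intro!: sum.cong)
  finally show ?thesis .
qed

lemma mat_trace_smult_one: "mat_trace (c \<cdot>\<^sub>m 1\<^sub>m d) = of_nat d * c"
  by (simp add: mat_trace_def)

lemma upper_triangular_mult_diag:
  fixes A B :: "complex mat"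
  assumes A: "A \<in> carrier_mat n n" "upper_triangular A" and B: "B \<in> carrier_mat n n" "upper_triangular B"
  shows "upper_triangular (A * B)" and "i < n \<Longrightarrow> (A * B) $$ (i, i) = A $$ (i, i) * B $$ (i, i)"
proof -
  have ent: "(A * B) $$ (i, j) = (\<Sum>k<n. A $$ (i, k) * B $$ (k, j))" if "i < n" "j < n" for i j
    using A B that by (auto simp: scalar_prod_def lessThan_atLeast0 intro!: sum.cong)
  have Az: "A $$ (i, k) = 0" if "k < i" "i < n" for i k using A that by auto
  have Bz: "B $$ (i, k) = 0" if "k < i" "i < n" for i k using B that by auto
  show "upper_triangular (A * B)"
  proof (rule upper_triangularI)
    fix i j assume ij: "j < i" "i < dim_row (A * B)"
    then have "i < n" "j < n" using A by auto
    then show "(A * B) $$ (i, j) = 0"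
      unfolding ent[OF \<open>i < n\<close> \<open>j < n\<close>] using ij Az Bz
      by (intro sum.neutral) (metis lessThan_iff linorder_neqE_nat mult_eq_0_iff less_trans)
  qed
  show "(A * B) $$ (i, i) = A $$ (i, i) * B $$ (i, i)" if i: "i < n"
  proof -
    have "(A * B) $$ (i, i) = (\<Sum>k\<in>{i}. A $$ (i, k) * B $$ (k, i))"
      unfolding ent[OF i i] using i Az Bz
      by (intro sum.mono_neutral_right) (auto, metis linorder_neqE_nat)
    then show ?thesis by simp
  qed
qed

lemma upper_triangular_pow_diag:
  fixes A :: "complex mat"
  assumes A: "A \<in> carrier_mat n n" "upper_triangular A"
  shows "upper_triangular (A ^\<^sub>m k) \<and> (\<forall>i<n. (A ^\<^sub>m k) $$ (i, i) = (A $$ (i, i)) ^ k)"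
proof (induction k)
  case 0 then show ?case using A by auto
next
  case (Suc k)
  have Ak: "A ^\<^sub>m k \<in> carrier_mat n n" using A by simp
  show ?case
    using upper_triangular_mult_diag[OF Ak _ A] Suc by (auto simp: mult.commute)
qed

text \<open>
  Let \<open>e\<close> be the diagonal of a Schur triangular form of \<open>A\<close>. Triangular matrices multiply entrywise
  on the diagonal, and the trace is invariant under similarity.
\<close>
lemma mat_trace_powers:
  fixes A :: "complex mat"
  assumes A: "A \<in> carrier_mat d d" and An: "A ^\<^sub>m n = 1\<^sub>m d"
  obtains e where "\<And>i. i < d \<Longrightarrow> e i ^ n = 1" "\<And>k. mat_trace (A ^\<^sub>m k) = (\<Sum>i<d. e i ^ k)"
proof -
  obtain es where "char_poly A = (\<Prod>a\<leftarrow>es. [:- a, 1:])" using char_poly_factorized[OF A] by blast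
  then obtain B where B: "B \<in> carrier_mat d d" "upper_triangular B" "similar_mat A B"
    using schur_decomposition_exists[OF A] by blast
  then obtain P Q where wit: "similar_mat_wit A B P Q" unfolding similar_mat_def by blast
  define e where "e = (\<lambda>i. B $$ (i, i))"
  have pow: "similar_mat_wit (A ^\<^sub>m k) (B ^\<^sub>m k) P Q" for k by (rule similar_mat_wit_pow[OF wit])
  have trace: "mat_trace (A ^\<^sub>m k) = (\<Sum>i<d. e i ^ k)" for k
  proof -
    have Ak: "A ^\<^sub>m k \<in> carrier_mat d d" using A by simp
    note w = similar_mat_witD2[OF Ak pow]
    have "mat_trace (A ^\<^sub>m k) = mat_trace (P * (B ^\<^sub>m k * Q))"
      using w by (simp add: assoc_mult_mat[of _ d d _ d _ d])
    also have "\<dots> = mat_trace ((B ^\<^sub>m k * Q) * P)" using w by (intro mat_trace_mult_comm[of _ d d]) auto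
    also have "\<dots> = mat_trace (B ^\<^sub>m k)"
      using w by (simp add: assoc_mult_mat[of _ d d _ d _ d] right_mult_one_mat[of _ d d])
    also have "\<dots> = (\<Sum>i<d. e i ^ k)"
      unfolding mat_trace_def e_def using upper_triangular_pow_diag[OF B(1,2)] B(1) by auto
    finally show ?thesis .
  qed
  have "B ^\<^sub>m n = 1\<^sub>m d"
  proof -
    have An': "A ^\<^sub>m n \<in> carrier_mat d d" using A by simp
    have Bn: "B ^\<^sub>m n \<in> carrier_mat d d" using B by simp
    have w: "similar_mat_wit (B ^\<^sub>m n) (A ^\<^sub>m n) Q P" by (rule similar_mat_wit_sym[OF pow])
    note w = similar_mat_witD2[OF Bn w]
    show ?thesis using w An by simp
  qed
  then have "e i ^ n = 1" if "i < d" for i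
    using upper_triangular_pow_diag[OF B(1,2), of n] that unfolding e_def by auto
  then show ?thesis using that trace by blast
qed

text \<open>
  With \<open>v = M u\<close> and the adjoint \<open>M'\<close>, the norm of \<open>M' v\<close> vanishes because
  \<open>\<langle>M' v, M' v\<rangle> = \<langle>M M' v, v\<rangle> = \<langle>M' M v, v\<rangle> = 0\<close>, and then \<open>\<langle>v, v\<rangle> = \<langle>u, M' v\<rangle> = 0\<close>.
\<close>
lemma normal_mat_square_zero:
  fixes M :: "complex mat"
  assumes M: "M \<in> carrier_mat n n" "M' \<in> carrier_mat n n"
    and adj: "\<And>i j. i < n \<Longrightarrow> j < n \<Longrightarrow> M' $$ (i, j) = cnj (M $$ (j, i))"
    and comm: "M * M' = M' * M"
    and u: "u \<in> carrier_vec n" and zero: "M *\<^sub>v (M *\<^sub>v u) = 0\<^sub>v n"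
  shows "M *\<^sub>v u = 0\<^sub>v n"
proof -
  have flip: "(M *\<^sub>v v) \<bullet>c w = v \<bullet>c (M' *\<^sub>v w)" if "v \<in> carrier_vec n" "w \<in> carrier_vec n" for v w
  proof -
    have "(M *\<^sub>v v) \<bullet>c w = (\<Sum>i<n. \<Sum>j<n. M $$ (i, j) * v $ j * cnj (w $ i))"
      using M that by (auto simp: scalar_prod_def sum_distrib_right lessThan_atLeast0 intro!: sum.cong)
    also have "\<dots> = (\<Sum>j<n. \<Sum>i<n. M $$ (i, j) * v $ j * cnj (w $ i))" by (rule sum.swap)
    also have "\<dots> = v \<bullet>c (M' *\<^sub>v w)"
      using M that by (auto simp: scalar_prod_def sum_distrib_left lessThan_atLeast0 adj mult_ac intro!: sum.cong)
    finally show ?thesis .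
  qed
  have null: "v = 0\<^sub>v n" if "v \<in> carrier_vec n" "v \<bullet>c v = 0" for v :: "complex vec"
    using conjugate_square_eq_0_vec[OF that(1)] that(2) by simp
  let ?v = "M *\<^sub>v u"
  have v: "?v \<in> carrier_vec n" using M u by simp
  have M'v: "M' *\<^sub>v ?v \<in> carrier_vec n" using M u by simp
  have "(M' *\<^sub>v ?v) \<bullet>c (M' *\<^sub>v ?v) = (M *\<^sub>v (M' *\<^sub>v ?v)) \<bullet>c ?v" by (rule flip[OF M'v v, symmetric])
  also have "M *\<^sub>v (M' *\<^sub>v ?v) = M' *\<^sub>v (M *\<^sub>v ?v)"
    using M v comm by (metis assoc_mult_mat_vec)
  also have "\<dots> = 0\<^sub>v n" unfolding zero using M by (intro eq_vecI) auto
  also have "0\<^sub>v n \<bullet>c ?v = 0" using v M by simp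
  finally have M'0: "M' *\<^sub>v ?v = 0\<^sub>v n" by (rule null[OF M'v])
  have "?v \<bullet>c ?v = u \<bullet>c (M' *\<^sub>v ?v)" by (rule flip[OF u v])
  also have "\<dots> = 0" unfolding M'0 using u by (simp add: scalar_prod_def)
  finally show ?thesis by (rule null[OF v])
qed


section \<open>Complex representations of a finite group\<close>

text \<open>
  The dimension is an argument so that the empty sum is a matrix of the right size.
\<close>
definition mat_sum :: "nat \<Rightarrow> ('i \<Rightarrow> complex mat) \<Rightarrow> 'i set \<Rightarrow> complex mat" where
  "mat_sum d f S = mat d d (\<lambda>ij. \<Sum>t\<in>S. f t $$ ij)"

lemma mat_sum_carrier [simp]: "mat_sum d f S \<in> carrier_mat d d"
  by (simp add: mat_sum_def)

lemma square_mult: "A \<in> carrier_mat d d \<Longrightarrow> B \<in> carrier_mat d d \<Longrightarrow> A * B \<in> carrier_mat d d"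
  by (rule mult_carrier_mat)

lemma mat_mult_entry:
  fixes A B :: "complex mat"
  assumes "A \<in> carrier_mat d d" "B \<in> carrier_mat d d" "i < d" "j < d"
  shows "(A * B) $$ (i, j) = (\<Sum>k<d. A $$ (i, k) * B $$ (k, j))"
  using assms by (auto simp: scalar_prod_def lessThan_atLeast0 intro!: sum.cong)

lemma mat_sum_cong: "(\<And>t. t \<in> S \<Longrightarrow> f t = g t) \<Longrightarrow> mat_sum d f S = mat_sum d g S"
  unfolding mat_sum_def by (intro cong_mat refl) (auto intro!: sum.cong)

lemma mat_sum_reindex:
  assumes "bij_betw \<pi> S S"
  shows "mat_sum d (\<lambda>t. f (\<pi> t)) S = mat_sum d f S"
  unfolding mat_sum_def
  by (intro cong_mat refl) (auto intro!: sum.reindex_bij_betw[OF assms])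

lemma mat_sum_mult_left:
  assumes A: "A \<in> carrier_mat d d" and f: "\<And>t. t \<in> S \<Longrightarrow> f t \<in> carrier_mat d d"
  shows "A * mat_sum d f S = mat_sum d (\<lambda>t. A * f t) S"
proof (rule eq_matI)
  fix i j assume "i < dim_row (mat_sum d (\<lambda>t. A * f t) S)" "j < dim_col (mat_sum d (\<lambda>t. A * f t) S)"
  then have ij: "i < d" "j < d" by (simp_all add: mat_sum_def)
  have "(A * mat_sum d f S) $$ (i, j) = (\<Sum>k<d. \<Sum>t\<in>S. A $$ (i, k) * f t $$ (k, j))"
    using A ij by (auto simp: scalar_prod_def mat_sum_def sum_distrib_left lessThan_atLeast0 intro!: sum.cong)
  also have "\<dots> = (\<Sum>t\<in>S. \<Sum>k<d. A $$ (i, k) * f t $$ (k, j))" by (rule sum.swap)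
  also have "\<dots> = (\<Sum>t\<in>S. (A * f t) $$ (i, j))"
  proof (rule sum.cong[OF refl])
    fix t assume "t \<in> S"
    with f have "f t \<in> carrier_mat d d" by blast
    then show "(\<Sum>k<d. A $$ (i, k) * f t $$ (k, j)) = (A * f t) $$ (i, j)"
      using A ij by (auto simp: scalar_prod_def lessThan_atLeast0 intro!: sum.cong)
  qed
  finally show "(A * mat_sum d f S) $$ (i, j) = mat_sum d (\<lambda>t. A * f t) S $$ (i, j)"
    using ij by (simp add: mat_sum_def)
qed (use A in \<open>auto simp: mat_sum_def\<close>)

lemma mat_sum_mult_right:
  assumes A: "A \<in> carrier_mat d d" and f: "\<And>t. t \<in> S \<Longrightarrow> f t \<in> carrier_mat d d"
  shows "mat_sum d f S * A = mat_sum d (\<lambda>t. f t * A) S"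
proof (rule eq_matI)
  fix i j assume "i < dim_row (mat_sum d (\<lambda>t. f t * A) S)" "j < dim_col (mat_sum d (\<lambda>t. f t * A) S)"
  then have ij: "i < d" "j < d" by (simp_all add: mat_sum_def)
  have "(mat_sum d f S * A) $$ (i, j) = (\<Sum>k<d. \<Sum>t\<in>S. f t $$ (i, k) * A $$ (k, j))"
    using A ij by (auto simp: scalar_prod_def mat_sum_def sum_distrib_right lessThan_atLeast0 intro!: sum.cong)
  also have "\<dots> = (\<Sum>t\<in>S. \<Sum>k<d. f t $$ (i, k) * A $$ (k, j))" by (rule sum.swap)
  also have "\<dots> = (\<Sum>t\<in>S. (f t * A) $$ (i, j))"
  proof (rule sum.cong[OF refl])
    fix t assume "t \<in> S"
    with f have "f t \<in> carrier_mat d d" by blast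
    then show "(\<Sum>k<d. f t $$ (i, k) * A $$ (k, j)) = (f t * A) $$ (i, j)"
      using A ij by (auto simp: scalar_prod_def lessThan_atLeast0 intro!: sum.cong)
  qed
  finally show "(mat_sum d f S * A) $$ (i, j) = mat_sum d (\<lambda>t. f t * A) S $$ (i, j)"
    using ij by (simp add: mat_sum_def)
qed (use A in \<open>auto simp: mat_sum_def\<close>)

lemma mat_trace_mat_sum:
  assumes "\<And>t. t \<in> S \<Longrightarrow> f t \<in> carrier_mat d d"
  shows "mat_trace (mat_sum d f S) = (\<Sum>t\<in>S. mat_trace (f t))"
proof -
  have "mat_trace (mat_sum d f S) = (\<Sum>i<d. \<Sum>t\<in>S. f t $$ (i, i))"
    by (simp add: mat_trace_def mat_sum_def)
  also have "\<dots> = (\<Sum>t\<in>S. \<Sum>i<d. f t $$ (i, i))" by (rule sum.swap)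
  also have "\<dots> = (\<Sum>t\<in>S. mat_trace (f t))"
    using assms by (intro sum.cong refl) (auto simp: mat_trace_def dest: carrier_matD)
  finally show ?thesis .
qed

lemma group_general_linear: "group (general_linear d)"
proof -
  have "ring (ring_mat TYPE(complex) d ())" by (rule ring_mat)
  then show ?thesis unfolding general_linear_def
    by (intro monoid.units_group ring.is_monoid)
qed

text \<open>
  For a group, invertibility of the matrices is automatic, so this is the same as a homomorphism into
  the general linear group (\<open>hom_general_linear_iff\<close>).
\<close>
definition is_rep :: "('a, 'b) monoid_scheme \<Rightarrow> nat \<Rightarrow> ('a \<Rightarrow> complex mat) \<Rightarrow> bool" where
  "is_rep G d \<rho> \<longleftrightarrow> (\<forall>g\<in>carrier G. \<rho> g \<in> carrier_mat d d) \<and>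
     (\<forall>g\<in>carrier G. \<forall>h\<in>carrier G. \<rho> (g \<otimes>\<^bsub>G\<^esub> h) = \<rho> g * \<rho> h) \<and> \<rho> \<one>\<^bsub>G\<^esub> = 1\<^sub>m d"

lemma hom_general_linear_iff:
  assumes G: "group G"
  shows "\<rho> \<in> hom G (general_linear d) \<longleftrightarrow> is_rep G d \<rho>"
proof
  interpret group G by (rule G)
  assume h: "\<rho> \<in> hom G (general_linear d)"
  have "\<rho> \<one>\<^bsub>G\<^esub> = \<one>\<^bsub>general_linear d\<^esub>"
    by (rule hom_one[OF h G group_general_linear])
  then have "\<rho> \<one>\<^bsub>G\<^esub> = 1\<^sub>m d" by (simp add: general_linear_def units_of_def ring_mat_def)
  moreover have "\<rho> g \<in> carrier_mat d d" if "g \<in> carrier G" for g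
    using h that unfolding hom_def general_linear_def by (auto simp: units_of_def Units_def ring_mat_def)
  moreover have "\<rho> (g \<otimes>\<^bsub>G\<^esub> k) = \<rho> g * \<rho> k" if "g \<in> carrier G" "k \<in> carrier G" for g k
    using h that unfolding hom_def general_linear_def by (auto simp: units_of_def ring_mat_def)
  ultimately show "is_rep G d \<rho>" unfolding is_rep_def by blast
next
  interpret group G by (rule G)
  assume r: "is_rep G d \<rho>"
  have "\<rho> g \<in> carrier (general_linear d)" if g: "g \<in> carrier G" for g
  proof -
    have "\<rho> (inv\<^bsub>G\<^esub> g) * \<rho> g = 1\<^sub>m d" "\<rho> g * \<rho> (inv\<^bsub>G\<^esub> g) = 1\<^sub>m d"
      using r g unfolding is_rep_def by (metis inv_closed l_inv, metis inv_closed r_inv)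
    then show ?thesis using r g unfolding is_rep_def general_linear_def
      by (auto simp: units_of_def Units_def ring_mat_def intro!: bexI[of _ "\<rho> (inv\<^bsub>G\<^esub> g)"])
  qed
  then show "\<rho> \<in> hom G (general_linear d)"
    using r unfolding hom_def is_rep_def by (auto simp: general_linear_def units_of_def ring_mat_def)
qed

text \<open>
  Schur's lemma: \<open>M\<close> has an eigenvalue, and its eigenspace is an invariant subspace.
\<close>
lemma irreducible_rep_scalar:
  assumes irr: "irreducible_rep G d \<rho>" and G: "group G"
    and M: "M \<in> carrier_mat d d" and comm: "\<And>g. g \<in> carrier G \<Longrightarrow> M * \<rho> g = \<rho> g * M"
  obtains c where "M = c \<cdot>\<^sub>m 1\<^sub>m d"
proof -
  have r: "is_rep G d \<rho>" and d: "d > 0"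
    using irr G unfolding irreducible_rep_def by (auto simp: hom_general_linear_iff)
  obtain c where "c \<in> spectrum M" using spectrum_non_empty[OF M d] by blast
  then obtain v where v: "v \<in> carrier_vec d" "v \<noteq> 0\<^sub>v d" "M *\<^sub>v v = c \<cdot>\<^sub>v v"
    using M unfolding spectrum_def eigenvalue_def eigenvector_def by auto
  define W where "W = {w \<in> carrier_vec d. M *\<^sub>v w = c \<cdot>\<^sub>v w}"
  have "VectorSpace.subspace class_ring W (module_vec TYPE(complex) d)"
    unfolding subspace_vec_iff
  proof (intro conjI ballI allI)
    show "W \<subseteq> carrier_vec d" unfolding W_def by blast
    show "0\<^sub>v d \<in> W" unfolding W_def using M by (auto intro!: eq_vecI)
    fix v w assume "v \<in> W" "w \<in> W"
    then show "v + w \<in> W" unfolding W_def using M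
      by (auto simp: mult_add_distrib_mat_vec[of _ d d] smult_add_distrib_vec[of _ d])
  next
    fix a v assume "v \<in> W"
    then show "a \<cdot>\<^sub>v v \<in> W" unfolding W_def using M
      by (auto simp: mult_mat_vec[of _ d d] smult_smult_assoc mult.commute)
  qed
  moreover have "\<forall>g\<in>carrier G. \<forall>w\<in>W. \<rho> g *\<^sub>v w \<in> W"
  proof (intro ballI)
    fix g w assume g: "g \<in> carrier G" and w: "w \<in> W"
    have \<rho>: "\<rho> g \<in> carrier_mat d d" using r g unfolding is_rep_def by blast
    have w': "w \<in> carrier_vec d" "M *\<^sub>v w = c \<cdot>\<^sub>v w" using w unfolding W_def by auto
    have "M *\<^sub>v (\<rho> g *\<^sub>v w) = (M * \<rho> g) *\<^sub>v w" using M \<rho> w' by (simp add: assoc_mult_mat_vec[of _ d d _ d])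
    also have "\<dots> = \<rho> g *\<^sub>v (M *\<^sub>v w)"
      unfolding comm[OF g] using M \<rho> w' by (simp add: assoc_mult_mat_vec[of _ d d _ d])
    also have "\<dots> = c \<cdot>\<^sub>v (\<rho> g *\<^sub>v w)" unfolding w'(2) using \<rho> w' by (simp add: mult_mat_vec[of _ d d])
    finally show "\<rho> g *\<^sub>v w \<in> W" unfolding W_def using \<rho> w' by simp
  qed
  ultimately have "W = {0\<^sub>v d} \<or> W = carrier_vec d"
    using irr unfolding irreducible_rep_def by blast
  moreover have "v \<in> W" unfolding W_def using v by simp
  ultimately have W: "W = carrier_vec d" using v(2) by blast
  have "M = c \<cdot>\<^sub>m 1\<^sub>m d"
  proof (rule eq_matI)
    fix i j assume "i < dim_row (c \<cdot>\<^sub>m 1\<^sub>m d)" "j < dim_col (c \<cdot>\<^sub>m 1\<^sub>m d)"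
    then have ij: "i < d" "j < d" by auto
    have "unit_vec d j \<in> W" unfolding W by simp
    then have "M *\<^sub>v unit_vec d j = c \<cdot>\<^sub>v unit_vec d j" unfolding W_def by blast
    then have "(M *\<^sub>v unit_vec d j) $ i = (c \<cdot>\<^sub>v unit_vec d j) $ i" by simp
    moreover have "(M *\<^sub>v unit_vec d j) $ i = M $$ (i, j)"
      using M ij by (simp add: scalar_prod_right_unit)
    ultimately show "M $$ (i, j) = (c \<cdot>\<^sub>m 1\<^sub>m d) $$ (i, j)"
      using ij by simp
  qed (use M in auto)
  then show ?thesis by (rule that)
qed

locale fin_group = group G for G (structure) +
  assumes finite_carrier [simp]: "finite (carrier G)"
begin

abbreviation cardG :: nat where "cardG \<equiv> card (carrier G)"

lemma cardG_pos: "cardG > 0"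
  using finite_carrier one_closed by (metis card_gt_0_iff empty_iff)

lemma bij_left: "g \<in> carrier G \<Longrightarrow> bij_betw (\<lambda>t. g \<otimes> t) (carrier G) (carrier G)"
  by (rule bij_betw_byWitness[where f' = "\<lambda>t. inv g \<otimes> t"]) (auto simp: m_assoc[symmetric])

lemma bij_right: "g \<in> carrier G \<Longrightarrow> bij_betw (\<lambda>t. t \<otimes> g) (carrier G) (carrier G)"
  by (rule bij_betw_byWitness[where f' = "\<lambda>t. t \<otimes> inv g"]) (auto simp: m_assoc)

lemma bij_inv: "bij_betw (\<lambda>t. inv t) (carrier G) (carrier G)"
  by (rule bij_betw_byWitness[where f' = "\<lambda>t. inv t"]) auto

lemma bij_conj: "g \<in> carrier G \<Longrightarrow> bij_betw (\<lambda>t. g \<otimes> t \<otimes> inv g) (carrier G) (carrier G)"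
  using bij_betw_trans[OF bij_left bij_right, of g "inv g"] by (simp add: comp_def)

lemmas sum_left = sum.reindex_bij_betw[OF bij_left]
lemmas sum_right = sum.reindex_bij_betw[OF bij_right]
lemmas sum_inv = sum.reindex_bij_betw[OF bij_inv]
lemmas sum_conj = sum.reindex_bij_betw[OF bij_conj]

context
  fixes d \<rho> assumes irr: "irreducible_rep G d \<rho>"
begin

lemma irr_is_rep: "is_rep G d \<rho>" and irr_dim: "d > 0"
  using irr is_group unfolding irreducible_rep_def by (auto simp: hom_general_linear_iff)

lemma irr_carrier: "g \<in> carrier G \<Longrightarrow> \<rho> g \<in> carrier_mat d d"
  using irr_is_rep unfolding is_rep_def by blast

lemma irr_mult: "g \<in> carrier G \<Longrightarrow> h \<in> carrier G \<Longrightarrow> \<rho> (g \<otimes> h) = \<rho> g * \<rho> h"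
  using irr_is_rep unfolding is_rep_def by blast

lemma irr_one: "\<rho> \<one> = 1\<^sub>m d"
  using irr_is_rep unfolding is_rep_def by blast

lemma irr_inv: "g \<in> carrier G \<Longrightarrow> \<rho> (inv g) * \<rho> g = 1\<^sub>m d" "g \<in> carrier G \<Longrightarrow> \<rho> g * \<rho> (inv g) = 1\<^sub>m d"
  by (metis irr_mult inv_closed l_inv irr_one) (metis irr_mult inv_closed r_inv irr_one)

text \<open>
  The average commutes with the representation, so it is scalar, and its trace determines the scalar.
\<close>
lemma irr_average:
  assumes E: "E \<in> carrier_mat d d"
  shows "mat_sum d (\<lambda>t. \<rho> t * E * \<rho> (inv t)) (carrier G)
       = (of_nat cardG * mat_trace E / of_nat d) \<cdot>\<^sub>m 1\<^sub>m d"
proof -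
  let ?M = "mat_sum d (\<lambda>t. \<rho> t * E * \<rho> (inv t)) (carrier G)"
  note [simp] = irr_carrier E square_mult
  have comm: "?M * \<rho> g = \<rho> g * ?M" if g: "g \<in> carrier G" for g
  proof -
    have "\<rho> g * ?M = mat_sum d (\<lambda>t. \<rho> g * (\<rho> t * E * \<rho> (inv t))) (carrier G)"
      by (rule mat_sum_mult_left) (use g in \<open>auto intro!: square_mult\<close>)
    also have "\<dots> = mat_sum d (\<lambda>t. (\<lambda>s. \<rho> s * E * \<rho> (inv s) * \<rho> g) (g \<otimes> t)) (carrier G)"
    proof (rule mat_sum_cong)
      fix t assume t: "t \<in> carrier G"
      have "\<rho> (inv (g \<otimes> t)) * \<rho> g = \<rho> (inv t)"
        using g t by (simp add: irr_mult[symmetric] inv_mult_group m_assoc)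
      moreover have "\<rho> (g \<otimes> t) * E * \<rho> (inv (g \<otimes> t)) * \<rho> g = \<rho> (g \<otimes> t) * E * (\<rho> (inv (g \<otimes> t)) * \<rho> g)"
        using g t by (intro assoc_mult_mat[of _ d d _ d _ d]) (auto intro!: square_mult)
      ultimately show "\<rho> g * (\<rho> t * E * \<rho> (inv t)) = (\<lambda>s. \<rho> s * E * \<rho> (inv s) * \<rho> g) (g \<otimes> t)"
        using g t by (simp add: irr_mult assoc_mult_mat[of _ d d _ d _ d])
    qed
    also have "\<dots> = mat_sum d (\<lambda>s. \<rho> s * E * \<rho> (inv s) * \<rho> g) (carrier G)"
      by (rule mat_sum_reindex[OF bij_left[OF g]])
    also have "\<dots> = ?M * \<rho> g"
      by (rule mat_sum_mult_right[symmetric]) (use g in \<open>auto intro!: square_mult\<close>)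
    finally show ?thesis by (rule sym)
  qed
  obtain c where c: "?M = c \<cdot>\<^sub>m 1\<^sub>m d"
    using irreducible_rep_scalar[OF irr is_group mat_sum_carrier comm] .
  have "of_nat d * c = mat_trace ?M" unfolding c by (rule mat_trace_smult_one[symmetric])
  also have "\<dots> = (\<Sum>t\<in>carrier G. mat_trace (\<rho> t * E * \<rho> (inv t)))"
    by (rule mat_trace_mat_sum) (auto intro!: square_mult)
  also have "\<dots> = (\<Sum>t\<in>carrier G. mat_trace E)"
  proof (rule sum.cong[OF refl])
    fix t assume t: "t \<in> carrier G"
    have "mat_trace (\<rho> t * E * \<rho> (inv t)) = mat_trace (\<rho> (inv t) * (\<rho> t * E))"
      using t by (intro mat_trace_mult_comm[of _ d d]) (auto intro!: square_mult)
    also have "\<rho> (inv t) * (\<rho> t * E) = E"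
      using t irr_inv(1)[OF t] by (simp add: assoc_mult_mat[of _ d d _ d _ d, symmetric] left_mult_one_mat[of _ d d])
    finally show "mat_trace (\<rho> t * E * \<rho> (inv t)) = mat_trace E" .
  qed
  also have "\<dots> = of_nat cardG * mat_trace E" by simp
  finally have "c = of_nat cardG * mat_trace E / of_nat d" using irr_dim by (simp add: field_simps)
  then show ?thesis using c by simp
qed

text \<open>
  The functional equation of irreducible characters. The average of \<open>\<rho>(t) \<rho>(b) \<rho>(t)\<^sup>-\<^sup>1\<close> is a
  scalar; multiply it by \<open>\<rho>(a)\<close> and take traces.
\<close>
lemma irr_trace_equation:
  assumes a: "a \<in> carrier G" and b: "b \<in> carrier G"
  shows "of_nat d * (\<Sum>t\<in>carrier G. mat_trace (\<rho> (a \<otimes> t \<otimes> b \<otimes> inv t)))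
       = of_nat cardG * mat_trace (\<rho> a) * mat_trace (\<rho> b)"
proof -
  note [simp] = irr_carrier square_mult
  let ?M = "mat_sum d (\<lambda>t. \<rho> t * \<rho> b * \<rho> (inv t)) (carrier G)"
  have "(\<Sum>t\<in>carrier G. mat_trace (\<rho> (a \<otimes> t \<otimes> b \<otimes> inv t)))
      = (\<Sum>t\<in>carrier G. mat_trace (\<rho> a * (\<rho> t * \<rho> b * \<rho> (inv t))))"
    using a b by (intro sum.cong refl) (simp add: irr_mult assoc_mult_mat[of _ d d _ d _ d])
  also have "\<dots> = mat_trace (mat_sum d (\<lambda>t. \<rho> a * (\<rho> t * \<rho> b * \<rho> (inv t))) (carrier G))"
    by (rule mat_trace_mat_sum[symmetric]) (use a b in \<open>auto intro!: square_mult\<close>)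
  also have "\<dots> = mat_trace (\<rho> a * ?M)"
    by (subst mat_sum_mult_left) (use a b in \<open>auto intro!: square_mult\<close>)
  also have "?M = (of_nat cardG * mat_trace (\<rho> b) / of_nat d) \<cdot>\<^sub>m 1\<^sub>m d"
    by (rule irr_average) (use b in simp)
  also have "\<rho> a * \<dots> = (of_nat cardG * mat_trace (\<rho> b) / of_nat d) \<cdot>\<^sub>m \<rho> a"
    using a by (simp add: mult_smult_distrib[of _ d d _ d] right_mult_one_mat[of _ d d])
  also have "mat_trace \<dots> = (of_nat cardG * mat_trace (\<rho> b) / of_nat d) * mat_trace (\<rho> a)"
    using irr_carrier[OF a] by (auto simp: mat_trace_def sum_distrib_left)
  finally show ?thesis using irr_dim by simp
qed

text \<open>
  The matrix units \<open>E\<close> in the averaging formula give the orthogonality of the matrix coefficients;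
  summing over the diagonal coefficients gives the norm of the character.
\<close>
lemma irr_trace_norm:
  "(\<Sum>t\<in>carrier G. mat_trace (\<rho> t) * mat_trace (\<rho> (inv t))) = of_nat cardG"
proof -
  have ent: "(\<Sum>t\<in>carrier G. \<rho> t $$ (i, i) * \<rho> (inv t) $$ (k, k)) = (if i = k then of_nat cardG / of_nat d else 0)"
    if ik: "i < d" "k < d" for i k
  proof -
    define E where "E = mat d d (\<lambda>(a, b). if a = i \<and> b = k then 1 else 0 :: complex)"
    have E: "E \<in> carrier_mat d d" unfolding E_def by simp
    have e: "(\<rho> t * E * \<rho> (inv t)) $$ (i, k) = \<rho> t $$ (i, i) * \<rho> (inv t) $$ (k, k)" if t: "t \<in> carrier G" for t
    proof -
      have c: "\<rho> t \<in> carrier_mat d d" "\<rho> (inv t) \<in> carrier_mat d d" using irr_carrier t by auto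
      have 1: "(\<rho> t * E) $$ (i, b) = (if b = k then \<rho> t $$ (i, i) else 0)" if "b < d" for b
        using c E ik that unfolding E_def
        by (auto simp: scalar_prod_def if_distrib cong: if_cong)
      have "(\<rho> t * E * \<rho> (inv t)) $$ (i, k) = (\<Sum>b<d. (\<rho> t * E) $$ (i, b) * \<rho> (inv t) $$ (b, k))"
        by (rule mat_mult_entry[OF square_mult[OF c(1) E] c(2) ik])
      also have "\<dots> = (\<Sum>b<d. if b = k then \<rho> t $$ (i, i) * \<rho> (inv t) $$ (k, k) else 0)"
        by (intro sum.cong refl) (auto simp: 1)
      finally show ?thesis using ik by simp
    qed
    have tr: "mat_trace E = (if i = k then 1 else 0)"
    proof -
      have "mat_trace E = (\<Sum>a<d. if a = i then (if i = k then 1 else 0) else 0)"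
        unfolding mat_trace_def using E by (auto simp: E_def intro!: sum.cong)
      then show ?thesis using ik by simp
    qed
    have "(\<Sum>t\<in>carrier G. \<rho> t $$ (i, i) * \<rho> (inv t) $$ (k, k))
        = mat_sum d (\<lambda>t. \<rho> t * E * \<rho> (inv t)) (carrier G) $$ (i, k)"
      using ik by (simp add: mat_sum_def e)
    also have "\<dots> = ((of_nat cardG * mat_trace E / of_nat d) \<cdot>\<^sub>m 1\<^sub>m d) $$ (i, k)"
      by (simp add: irr_average[OF E])
    also have "\<dots> = (if i = k then of_nat cardG / of_nat d else 0)" using ik by (simp add: tr)
    finally show ?thesis .
  qed
  have "(\<Sum>t\<in>carrier G. mat_trace (\<rho> t) * mat_trace (\<rho> (inv t)))
      = (\<Sum>t\<in>carrier G. \<Sum>i<d. \<Sum>k<d. \<rho> t $$ (i, i) * \<rho> (inv t) $$ (k, k))"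
  proof (rule sum.cong[OF refl])
    fix t assume t: "t \<in> carrier G"
    have "dim_row (\<rho> t) = d" "dim_row (\<rho> (inv t)) = d" using irr_carrier t by auto
    then show "mat_trace (\<rho> t) * mat_trace (\<rho> (inv t)) = (\<Sum>i<d. \<Sum>k<d. \<rho> t $$ (i, i) * \<rho> (inv t) $$ (k, k))"
      unfolding mat_trace_def by (simp add: sum_product)
  qed
  also have "\<dots> = (\<Sum>i<d. \<Sum>k<d. \<Sum>t\<in>carrier G. \<rho> t $$ (i, i) * \<rho> (inv t) $$ (k, k))"
    by (subst sum.swap) (intro sum.cong refl sum.swap)
  also have "\<dots> = (\<Sum>i<d. \<Sum>k<d. if i = k then of_nat cardG / of_nat d else 0)"
    by (intro sum.cong refl ent) auto
  also have "\<dots> = of_nat cardG" using irr_dim by simp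
  finally show ?thesis .
qed

lemma irr_pow: "g \<in> carrier G \<Longrightarrow> \<rho> (g [^] (k::nat)) = \<rho> g ^\<^sub>m k"
proof (induction k)
  case 0
  then have "dim_row (\<rho> g) = d" using irr_carrier by auto
  then show ?case by (simp add: irr_one)
next
  case (Suc k)
  then show ?case by (simp add: irr_mult)
qed

text \<open>
  A class function makes \<open>\<Sum> z(g) \<rho>(g)\<close> commute with the representation, so it is scalar; here its
  trace is zero.
\<close>
lemma irr_class_sum_scalar:
  assumes z: "\<And>g x. g \<in> carrier G \<Longrightarrow> x \<in> carrier G \<Longrightarrow> z (g \<otimes> x \<otimes> inv g) = z x"
    and trace: "(\<Sum>g\<in>carrier G. z g * mat_trace (\<rho> g)) = 0"
  shows "mat_sum d (\<lambda>g. z g \<cdot>\<^sub>m \<rho> g) (carrier G) = 0\<^sub>m d d"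
proof -
  note [simp] = irr_carrier square_mult
  let ?M = "mat_sum d (\<lambda>g. z g \<cdot>\<^sub>m \<rho> g) (carrier G)"
  have comm: "?M * \<rho> h = \<rho> h * ?M" if h: "h \<in> carrier G" for h
  proof -
    have "\<rho> h * ?M = mat_sum d (\<lambda>g. \<rho> h * (z g \<cdot>\<^sub>m \<rho> g)) (carrier G)"
      by (rule mat_sum_mult_left) (use h in auto)
    also have "\<dots> = mat_sum d (\<lambda>g. (\<lambda>s. z s \<cdot>\<^sub>m \<rho> s * \<rho> h) (h \<otimes> g \<otimes> inv h)) (carrier G)"
    proof (rule mat_sum_cong)
      fix g assume g: "g \<in> carrier G"
      let ?s = "h \<otimes> g \<otimes> inv h"
      have "z ?s \<cdot>\<^sub>m \<rho> ?s * \<rho> h = z ?s \<cdot>\<^sub>m (\<rho> ?s * \<rho> h)"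
        using g h by (intro mult_smult_assoc_mat[of _ d d _ d]) auto
      also have "\<rho> ?s * \<rho> h = \<rho> (h \<otimes> g)"
        using g h by (simp add: irr_mult[symmetric] m_assoc)
      also have "\<dots> = \<rho> h * \<rho> g" using g h by (rule irr_mult[rotated])
      also have "z ?s \<cdot>\<^sub>m (\<rho> h * \<rho> g) = \<rho> h * (z g \<cdot>\<^sub>m \<rho> g)"
        using g h z by (simp add: mult_smult_distrib[of _ d d _ d])
      finally show "\<rho> h * (z g \<cdot>\<^sub>m \<rho> g) = (\<lambda>s. z s \<cdot>\<^sub>m \<rho> s * \<rho> h) ?s" by simp
    qed
    also have "\<dots> = mat_sum d (\<lambda>s. z s \<cdot>\<^sub>m \<rho> s * \<rho> h) (carrier G)"
      by (rule mat_sum_reindex[OF bij_conj[OF h]])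
    also have "\<dots> = ?M * \<rho> h"
      by (rule mat_sum_mult_right[symmetric]) (use h in auto)
    finally show ?thesis by simp
  qed
  obtain c where c: "?M = c \<cdot>\<^sub>m 1\<^sub>m d"
    using irreducible_rep_scalar[OF irr is_group mat_sum_carrier comm] .
  have "of_nat d * c = mat_trace ?M" unfolding c by (rule mat_trace_smult_one[symmetric])
  also have "\<dots> = (\<Sum>g\<in>carrier G. mat_trace (z g \<cdot>\<^sub>m \<rho> g))"
    by (rule mat_trace_mat_sum) auto
  also have "\<dots> = (\<Sum>g\<in>carrier G. z g * mat_trace (\<rho> g))"
  proof (intro sum.cong refl)
    fix g assume "g \<in> carrier G"
    then have "\<rho> g \<in> carrier_mat d d" by simp
    then show "mat_trace (z g \<cdot>\<^sub>m \<rho> g) = z g * mat_trace (\<rho> g)"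
      by (auto simp: mat_trace_def sum_distrib_left)
  qed
  finally have "c = 0" using trace irr_dim by simp
  then show ?thesis unfolding c by (auto intro!: eq_matI)
qed

end

end


context fin_group
begin

text \<open>
  An invariant subspace of \<open>W\<close> of least positive dimension \<open>d\<close>, presented by an injective matrix
  \<open>B\<close> whose range it is; the subrepresentation in the coordinates given by \<open>B\<close> is \<open>\<rho>'\<close>.
\<close>
lemma rep_irreducible_subrep:
  assumes r: "is_rep G N \<rho>" and W: "VectorSpace.subspace class_ring W (module_vec TYPE(complex) N)"
    and inv: "\<And>g w. g \<in> carrier G \<Longrightarrow> w \<in> W \<Longrightarrow> \<rho> g *\<^sub>v w \<in> W" and nz: "W \<noteq> {0\<^sub>v N}"
  obtains d \<rho>' B where "irreducible_rep G d \<rho>'" "B \<in> carrier_mat N d" "inj_mat B"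
    "\<And>x. x \<in> carrier_vec d \<Longrightarrow> B *\<^sub>v x \<in> W" "\<And>g. g \<in> carrier G \<Longrightarrow> \<rho> g * B = B * \<rho>' g"
proof -
  have \<rho>: "\<rho> g \<in> carrier_mat N N" if "g \<in> carrier G" for g using r that unfolding is_rep_def by blast
  \<comment> \<open>\<open>P k\<close>: there is an invariant subspace of \<open>W\<close> of dimension \<open>k > 0\<close>.\<close>
  define P where "P = (\<lambda>k. \<exists>B. B \<in> carrier_mat N k \<and> inj_mat B \<and> k > 0 \<and> (\<forall>x\<in>carrier_vec k. B *\<^sub>v x \<in> W) \<and>
     (\<forall>g\<in>carrier G. \<forall>x\<in>carrier_vec k. \<exists>y\<in>carrier_vec k. \<rho> g *\<^sub>v (B *\<^sub>v x) = B *\<^sub>v y))"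
  have "\<exists>k. P k"
  proof -
    obtain k B where kB: "k \<le> N" "B \<in> carrier_mat N k" "inj_mat B" "W = (\<lambda>x. B *\<^sub>v x) ` carrier_vec k"
      using subspace_basis_mat[OF W] by metis
    have "k > 0"
    proof (rule ccontr)
      assume "\<not> k > 0"
      then have k0: "k = 0" by simp
      have "B *\<^sub>v x = 0\<^sub>v N" if "x \<in> carrier_vec k" for x
        using kB(2) that unfolding k0 by (intro eq_vecI) (auto simp: scalar_prod_def)
      moreover have "0\<^sub>v N \<in> W" using W unfolding subspace_vec_iff by blast
      ultimately have "W = {0\<^sub>v N}" using kB(4) by auto
      then show False using nz by simp
    qed
    moreover have "\<forall>x\<in>carrier_vec k. B *\<^sub>v x \<in> W" using kB(4) by blast
    moreover have "\<forall>g\<in>carrier G. \<forall>x\<in>carrier_vec k. \<exists>y\<in>carrier_vec k. \<rho> g *\<^sub>v (B *\<^sub>v x) = B *\<^sub>v y"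
    proof (intro ballI)
      fix g and x :: "complex vec" assume gx: "g \<in> carrier G" "x \<in> carrier_vec k"
      then have "\<rho> g *\<^sub>v (B *\<^sub>v x) \<in> W" using inv kB(4) by blast
      then show "\<exists>y\<in>carrier_vec k. \<rho> g *\<^sub>v (B *\<^sub>v x) = B *\<^sub>v y" using kB(4) by blast
    qed
    ultimately have "P k" unfolding P_def using kB(2,3) by blast
    then show ?thesis by blast
  qed
  define d where "d = (LEAST k. P k)"
  have Pd: "P d" unfolding d_def using \<open>\<exists>k. P k\<close> by (rule LeastI_ex)
  have least: "d \<le> k" if "P k" for k unfolding d_def using that by (rule Least_le)
  obtain B where B: "B \<in> carrier_mat N d" "inj_mat B" "d > 0" "\<And>x. x \<in> carrier_vec d \<Longrightarrow> B *\<^sub>v x \<in> W"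
    and Binv: "\<And>g x. g \<in> carrier G \<Longrightarrow> x \<in> carrier_vec d \<Longrightarrow> \<exists>y\<in>carrier_vec d. \<rho> g *\<^sub>v (B *\<^sub>v x) = B *\<^sub>v y"
    using Pd unfolding P_def by blast
  have "\<exists>R. R \<in> carrier_mat d d \<and> \<rho> g * B = B * R" if g: "g \<in> carrier G" for g
  proof -
    have "\<forall>j. \<exists>y\<in>carrier_vec d. \<rho> g *\<^sub>v (B *\<^sub>v unit_vec d j) = B *\<^sub>v y"
      using Binv[OF g] by simp
    then obtain y where y: "\<And>j. y j \<in> carrier_vec d" "\<And>j. \<rho> g *\<^sub>v (B *\<^sub>v unit_vec d j) = B *\<^sub>v y j"
      by metis
    define R where "R = mat d d (\<lambda>(i, j). y j $ i)"
    have R: "R \<in> carrier_mat d d" unfolding R_def by simp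
    have "\<rho> g * B = B * R"
    proof (rule mat_col_eqI)
      show "dim_row (\<rho> g * B) = dim_row (B * R)" "dim_col (\<rho> g * B) = dim_col (B * R)"
        using \<rho>[OF g] B(1) R by auto
      fix j assume "j < dim_col (B * R)"
      then have j: "j < d" using R by simp
      have "col (\<rho> g * B) j = \<rho> g *\<^sub>v col B j" by (rule col_mult2[OF \<rho>[OF g] B(1) j])
      also have "col B j = B *\<^sub>v unit_vec d j"
        using B(1) j by (intro eq_vecI) (auto simp: scalar_prod_right_unit)
      also have "\<rho> g *\<^sub>v (B *\<^sub>v unit_vec d j) = B *\<^sub>v y j" by (rule y)
      also have "y j = col R j" using y(1)[of j] j by (intro eq_vecI) (auto simp: R_def)
      also have "B *\<^sub>v col R j = col (B * R) j" by (rule col_mult2[OF B(1) R j, symmetric])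
      finally show "col (\<rho> g * B) j = col (B * R) j" .
    qed
    then show ?thesis using R by blast
  qed
  then obtain \<rho>' where \<rho>': "\<And>g. g \<in> carrier G \<Longrightarrow> \<rho>' g \<in> carrier_mat d d"
    "\<And>g. g \<in> carrier G \<Longrightarrow> \<rho> g * B = B * \<rho>' g" by metis
  have rep: "is_rep G d \<rho>'"
    unfolding is_rep_def
  proof (intro conjI ballI)
    fix g h assume gh: "g \<in> carrier G" "h \<in> carrier G"
    have "B * \<rho>' (g \<otimes> h) = \<rho> (g \<otimes> h) * B" using \<rho>'(2) gh by simp
    also have "\<rho> (g \<otimes> h) = \<rho> g * \<rho> h" using r gh unfolding is_rep_def by blast
    also have "\<rho> g * \<rho> h * B = \<rho> g * (\<rho> h * B)" by (rule assoc_mult_mat[OF \<rho>[OF gh(1)] \<rho>[OF gh(2)] B(1)])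
    also have "\<rho> h * B = B * \<rho>' h" using \<rho>'(2) gh by simp
    also have "\<rho> g * (B * \<rho>' h) = \<rho> g * B * \<rho>' h"
      by (rule assoc_mult_mat[OF \<rho>[OF gh(1)] B(1) \<rho>'(1)[OF gh(2)], symmetric])
    also have "\<rho> g * B = B * \<rho>' g" using \<rho>'(2) gh by simp
    also have "B * \<rho>' g * \<rho>' h = B * (\<rho>' g * \<rho>' h)"
      by (rule assoc_mult_mat[OF B(1) \<rho>'(1)[OF gh(1)] \<rho>'(1)[OF gh(2)]])
    finally show "\<rho>' (g \<otimes> h) = \<rho>' g * \<rho>' h"
      by (rule inj_mat_cancel[OF B(2,1) \<rho>'(1) square_mult, rotated -1]) (use gh \<rho>' in auto)
  next
    have "B * \<rho>' \<one> = \<rho> \<one> * B" using \<rho>'(2) by simp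
    also have "\<rho> \<one> = 1\<^sub>m N" using r unfolding is_rep_def by blast
    also have "1\<^sub>m N * B = B * 1\<^sub>m d" using B(1) by simp
    finally show "\<rho>' \<one> = 1\<^sub>m d"
      by (rule inj_mat_cancel[OF B(2,1) \<rho>'(1) one_carrier_mat, rotated -1]) simp
  qed (use \<rho>' in auto)
  have "irreducible_rep G d \<rho>'"
    unfolding irreducible_rep_def
  proof (intro conjI allI impI)
    show "\<rho>' \<in> hom G (general_linear d)" using rep is_group by (simp add: hom_general_linear_iff)
    show "d > 0" by (rule B(3))
    fix U assume U: "VectorSpace.subspace class_ring U (module_vec TYPE(complex) d)"
      and Uinv: "\<forall>g\<in>carrier G. \<forall>w\<in>U. \<rho>' g *\<^sub>v w \<in> U"
    obtain k C where kC: "k \<le> d" "C \<in> carrier_mat d k" "inj_mat C" "U = (\<lambda>x. C *\<^sub>v x) ` carrier_vec k"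
      "k = d \<Longrightarrow> U = carrier_vec d"
      using subspace_basis_mat[OF U] by metis
    show "U = {0\<^sub>v d} \<or> U = carrier_vec d"
    proof (cases "k = 0")
      case True
      have "C *\<^sub>v x = 0\<^sub>v d" if "x \<in> carrier_vec k" for x
        using kC(2) that unfolding True by (intro eq_vecI) (auto simp: scalar_prod_def)
      moreover have "0\<^sub>v d \<in> U" using U unfolding subspace_vec_iff by blast
      ultimately have "U = {0\<^sub>v d}" using kC(4) by auto
      then show ?thesis ..
    next
      case False
      have BC: "B * C \<in> carrier_mat N k" using B(1) kC(2) by simp
      have assoc: "(B * C) *\<^sub>v x = B *\<^sub>v (C *\<^sub>v x)" if "x \<in> carrier_vec k" for x
        by (rule assoc_mult_mat_vec[OF B(1) kC(2) that])
      have Cx: "C *\<^sub>v x \<in> carrier_vec d" if "x \<in> carrier_vec k" for x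
        using kC(2) that by simp
      have "P k"
        unfolding P_def
      proof (intro exI[of _ "B * C"] conjI ballI)
        show "inj_mat (B * C)" by (rule inj_mat_mult[OF B(2,1) kC(3,2)])
        fix x :: "complex vec" assume x: "x \<in> carrier_vec k"
        show "(B * C) *\<^sub>v x \<in> W" unfolding assoc[OF x] using B(4) Cx[OF x] .
        fix g assume g: "g \<in> carrier G"
        have "C *\<^sub>v x \<in> U" using x kC(4) by blast
        then have "\<rho>' g *\<^sub>v (C *\<^sub>v x) \<in> U" using Uinv g by blast
        then obtain y where y: "y \<in> carrier_vec k" "\<rho>' g *\<^sub>v (C *\<^sub>v x) = C *\<^sub>v y" using kC(4) by blast
        have "\<rho> g *\<^sub>v ((B * C) *\<^sub>v x) = (\<rho> g * B) *\<^sub>v (C *\<^sub>v x)"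
          unfolding assoc[OF x] by (rule assoc_mult_mat_vec[OF \<rho>[OF g] B(1) Cx[OF x], symmetric])
        also have "\<dots> = B *\<^sub>v (\<rho>' g *\<^sub>v (C *\<^sub>v x))"
          unfolding \<rho>'(2)[OF g] by (rule assoc_mult_mat_vec[OF B(1) \<rho>'(1)[OF g] Cx[OF x]])
        also have "\<dots> = (B * C) *\<^sub>v y" unfolding y(2) by (rule assoc[OF y(1), symmetric])
        finally show "\<exists>y\<in>carrier_vec k. \<rho> g *\<^sub>v ((B * C) *\<^sub>v x) = (B * C) *\<^sub>v y" using y(1) by blast
      qed (use False BC in auto)
      then have "k = d" using least kC(1) by (simp add: le_antisym)
      then show ?thesis using kC(5) by simp
    qed
  qed
  then show ?thesis using that B(1,2,4) \<rho>'(2) by blast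
qed

text \<open>
  Completeness of the irreducible characters. In the regular representation \<open>R\<close>, the class function
  \<open>z\<close> acts by a matrix \<open>M\<close> that commutes with the group and is normal. If \<open>M\<close> were nonzero, its
  range would contain an irreducible subrepresentation, on which \<open>M\<close> vanishes by the hypothesis on
  traces. That gives a nonzero vector \<open>M u\<close> with \<open>M (M u) = 0\<close>, which normality forbids. So
  \<open>M = 0\<close>, and \<open>z\<close> can be read off from the column of \<open>M\<close> at the neutral element.
\<close>
theorem irreducible_traces_complete:
  assumes z: "\<And>g x. g \<in> carrier G \<Longrightarrow> x \<in> carrier G \<Longrightarrow> z (g \<otimes> x \<otimes> inv g) = z x"
    and trace: "\<And>d \<rho>. irreducible_rep G d \<rho> \<Longrightarrow> (\<Sum>g\<in>carrier G. z g * mat_trace (\<rho> g)) = 0"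
    and x: "x \<in> carrier G"
  shows "z x = 0"
proof -
  let ?N = cardG
  \<comment> \<open>An enumeration \<open>e\<close> of the group indexes the rows and columns of the regular representation.\<close>
  obtain e where e: "bij_betw e {..<?N} (carrier G)"
    using ex_bij_betw_nat_finite[OF finite_carrier] by (auto simp: lessThan_atLeast0)
  have eC: "e i \<in> carrier G" if "i < ?N" for i using e that by (auto simp: bij_betw_def)
  note sum_e = sum.reindex_bij_betw[OF e]
  define R where "R = (\<lambda>g. mat ?N ?N (\<lambda>(i, j). if e i = g \<otimes> e j then 1 else 0 :: complex))"
  have Rc: "R g \<in> carrier_mat ?N ?N" for g unfolding R_def by simp
  have R_ent: "R g $$ (i, j) = (if e i = g \<otimes> e j then 1 else 0)" if "i < ?N" "j < ?N" for g i j
    using that unfolding R_def by simp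
  have R: "is_rep G ?N R"
    unfolding is_rep_def
  proof (intro conjI ballI)
    fix g h assume gh: "g \<in> carrier G" "h \<in> carrier G"
    show "R (g \<otimes> h) = R g * R h"
    proof (rule eq_matI)
      fix i j assume "i < dim_row (R g * R h)" "j < dim_col (R g * R h)"
      then have ij: "i < ?N" "j < ?N" by (simp_all add: R_def)
      have "(R g * R h) $$ (i, j) = (\<Sum>k<?N. (\<lambda>y. if y = h \<otimes> e j then (if e i = g \<otimes> y then 1 else 0) else 0) (e k))"
        unfolding mat_mult_entry[OF Rc Rc ij] using ij by (intro sum.cong) (auto simp: R_ent)
      also have "\<dots> = (\<Sum>y\<in>carrier G. if y = h \<otimes> e j then (if e i = g \<otimes> y then 1 else 0) else 0)"
        by (rule sum_e)
      also have "\<dots> = (if e i = g \<otimes> (h \<otimes> e j) then 1 else 0)"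
        using gh eC[OF ij(2)] by simp
      also have "\<dots> = R (g \<otimes> h) $$ (i, j)" using gh eC ij by (simp add: R_ent m_assoc)
      finally show "R (g \<otimes> h) $$ (i, j) = (R g * R h) $$ (i, j)" by simp
    qed (simp_all add: R_def)
  next
    show "R \<one> = 1\<^sub>m ?N"
      using e eC by (intro eq_matI) (auto simp: R_def bij_betw_def inj_on_def)
  qed (rule Rc)
  define M where "M = mat ?N ?N (\<lambda>(i, j). z (e i \<otimes> inv (e j)))"
  define M' where "M' = mat ?N ?N (\<lambda>(i, j). cnj (z (e j \<otimes> inv (e i))))"
  have M: "M \<in> carrier_mat ?N ?N" and M': "M' \<in> carrier_mat ?N ?N" unfolding M_def M'_def by simp_all
  have M_ent: "M $$ (i, j) = z (e i \<otimes> inv (e j))" if "i < ?N" "j < ?N" for i j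
    using that unfolding M_def by simp
  have M'_ent: "M' $$ (i, j) = cnj (z (e j \<otimes> inv (e i)))" if "i < ?N" "j < ?N" for i j
    using that unfolding M'_def by simp
  have shift: "z (a \<otimes> b) = z (b \<otimes> a)" if "a \<in> carrier G" "b \<in> carrier G" for a b
    using z[of b "a \<otimes> b"] that by (simp add: m_assoc)
  have comm: "R g * M = M * R g" if g: "g \<in> carrier G" for g
  proof (rule eq_matI)
    fix i j assume "i < dim_row (M * R g)" "j < dim_col (M * R g)"
    then have ij: "i < ?N" "j < ?N" by (simp_all add: R_def M_def)
    have "(R g * M) $$ (i, j) = (\<Sum>k<?N. (\<lambda>y. if y = inv g \<otimes> e i then z (y \<otimes> inv (e j)) else 0) (e k))"
      unfolding mat_mult_entry[OF Rc M ij] using ij g eC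
      by (intro sum.cong) (auto simp: R_ent M_ent inv_solve_left)
    also have "\<dots> = (\<Sum>y\<in>carrier G. if y = inv g \<otimes> e i then z (y \<otimes> inv (e j)) else 0)"
      by (rule sum_e)
    also have "\<dots> = z ((inv g \<otimes> e i) \<otimes> inv (e j))" using g eC ij by simp
    also have "\<dots> = z (inv g \<otimes> (e i \<otimes> inv (e j)))" using g eC ij by (simp add: m_assoc)
    also have "\<dots> = z ((e i \<otimes> inv (e j)) \<otimes> inv g)" using g eC ij by (intro shift) auto
    also have "\<dots> = z (e i \<otimes> inv (g \<otimes> e j))" using g eC ij by (simp add: m_assoc inv_mult_group)
    also have "\<dots> = (\<Sum>y\<in>carrier G. if y = g \<otimes> e j then z (e i \<otimes> inv y) else 0)"
      using g eC ij by simp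
    also have "\<dots> = (\<Sum>k<?N. (\<lambda>y. if y = g \<otimes> e j then z (e i \<otimes> inv y) else 0) (e k))"
      by (rule sum_e[symmetric])
    also have "\<dots> = (M * R g) $$ (i, j)"
      unfolding mat_mult_entry[OF M Rc ij] using ij g eC
      by (intro sum.cong) (auto simp: R_ent M_ent)
    finally show "(R g * M) $$ (i, j) = (M * R g) $$ (i, j)" .
  qed (simp_all add: R_def M_def)
  have normal: "M * M' = M' * M"
  proof (rule eq_matI)
    fix i j assume "i < dim_row (M' * M)" "j < dim_col (M' * M)"
    then have ij: "i < ?N" "j < ?N" using M' M by auto
    note ei = eC[OF ij(1)] and ej = eC[OF ij(2)]
    have "(M * M') $$ (i, j) = (\<Sum>k<?N. (\<lambda>y. z (e i \<otimes> inv y) * cnj (z (e j \<otimes> inv y))) (e k))"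
      unfolding mat_mult_entry[OF M M' ij] using ij by (intro sum.cong) (auto simp: M_ent M'_ent)
    also have "\<dots> = (\<Sum>y\<in>carrier G. z (e i \<otimes> inv y) * cnj (z (e j \<otimes> inv y)))" by (rule sum_e)
    also have "\<dots> = (\<Sum>y\<in>carrier G. z (e i \<otimes> y) * cnj (z (e j \<otimes> y)))"
      by (rule sum_inv[of "\<lambda>y. z (e i \<otimes> y) * cnj (z (e j \<otimes> y))"])
    also have "\<dots> = (\<Sum>y\<in>carrier G. z (e i \<otimes> (inv (e i) \<otimes> (y \<otimes> inv (e j)))) * cnj (z (e j \<otimes> (inv (e i) \<otimes> (y \<otimes> inv (e j))))))"
      using ei ej
      by (subst sum_left[of "inv (e i)", symmetric], simp, subst sum_right[of "inv (e j)", symmetric]) auto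
    also have "\<dots> = (\<Sum>y\<in>carrier G. cnj (z (y \<otimes> inv (e i))) * z (y \<otimes> inv (e j)))"
    proof (intro sum.cong refl)
      fix y assume y: "y \<in> carrier G"
      have "z (e j \<otimes> (inv (e i) \<otimes> (y \<otimes> inv (e j)))) = z ((inv (e i) \<otimes> (y \<otimes> inv (e j))) \<otimes> e j)"
        using ei ej y by (intro shift) auto
      also have "\<dots> = z (inv (e i) \<otimes> y)" using ei ej y by (simp add: m_assoc)
      also have "\<dots> = z (y \<otimes> inv (e i))" using ei y by (intro shift) auto
      finally show "z (e i \<otimes> (inv (e i) \<otimes> (y \<otimes> inv (e j)))) * cnj (z (e j \<otimes> (inv (e i) \<otimes> (y \<otimes> inv (e j)))))
          = cnj (z (y \<otimes> inv (e i))) * z (y \<otimes> inv (e j))"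
        using ei ej y by (simp add: m_assoc[symmetric])
    qed
    also have "\<dots> = (\<Sum>k<?N. (\<lambda>y. cnj (z (y \<otimes> inv (e i))) * z (y \<otimes> inv (e j))) (e k))" by (rule sum_e[symmetric])
    also have "\<dots> = (M' * M) $$ (i, j)"
      unfolding mat_mult_entry[OF M' M ij] using ij by (intro sum.cong) (auto simp: M_ent M'_ent)
    finally show "(M * M') $$ (i, j) = (M' * M) $$ (i, j)" .
  qed (use M M' in auto)
  define W where "W = (\<lambda>v. M *\<^sub>v v) ` carrier_vec ?N"
  have "W = {0\<^sub>v ?N}"
  proof (rule ccontr)
    assume nz: "W \<noteq> {0\<^sub>v ?N}"
    have sub: "VectorSpace.subspace class_ring W (module_vec TYPE(complex) ?N)"
      unfolding subspace_vec_iff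
    proof (intro conjI ballI allI)
      show "W \<subseteq> carrier_vec ?N" unfolding W_def using M by auto
      have "M *\<^sub>v 0\<^sub>v ?N = 0\<^sub>v ?N" using M by (intro eq_vecI) auto
      then show "0\<^sub>v ?N \<in> W" unfolding W_def by (metis imageI zero_carrier_vec)
      fix v w assume "v \<in> W" "w \<in> W"
      then obtain a b where "a \<in> carrier_vec ?N" "b \<in> carrier_vec ?N" "v = M *\<^sub>v a" "w = M *\<^sub>v b"
        unfolding W_def by blast
      then show "v + w \<in> W" unfolding W_def
        by (intro image_eqI[of _ _ "a + b"]) (auto simp: mult_add_distrib_mat_vec[OF M])
    next
      fix c v assume "v \<in> W"
      then obtain a where "a \<in> carrier_vec ?N" "v = M *\<^sub>v a" unfolding W_def by blast
      then show "c \<cdot>\<^sub>v v \<in> W" unfolding W_def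
        by (intro image_eqI[of _ _ "c \<cdot>\<^sub>v a"]) (auto simp: mult_mat_vec[OF M])
    qed
    have inv: "R g *\<^sub>v w \<in> W" if g: "g \<in> carrier G" and w: "w \<in> W" for g w
    proof -
      obtain a where a: "a \<in> carrier_vec ?N" "w = M *\<^sub>v a" using w unfolding W_def by blast
      have "R g *\<^sub>v w = (R g * M) *\<^sub>v a" unfolding a(2) by (rule assoc_mult_mat_vec[OF Rc M a(1), symmetric])
      also have "\<dots> = M *\<^sub>v (R g *\<^sub>v a)" unfolding comm[OF g] by (rule assoc_mult_mat_vec[OF M Rc a(1)])
      finally show ?thesis unfolding W_def using mult_mat_vec_carrier[OF Rc a(1)] by blast
    qed
    obtain d \<rho>' B where irr: "irreducible_rep G d \<rho>'" and B: "B \<in> carrier_mat ?N d" "inj_mat B"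
      "\<And>x. x \<in> carrier_vec d \<Longrightarrow> B *\<^sub>v x \<in> W" and intertw: "\<And>g. g \<in> carrier G \<Longrightarrow> R g * B = B * \<rho>' g"
      using rep_irreducible_subrep[OF R sub inv nz] by blast
    note \<rho>' = irr_carrier[OF irr]
    have zero: "mat_sum d (\<lambda>g. z g \<cdot>\<^sub>m \<rho>' g) (carrier G) = 0\<^sub>m d d"
      by (rule irr_class_sum_scalar[OF irr z trace[OF irr]])
    have MB: "M * B = 0\<^sub>m ?N d"
    proof (rule eq_matI)
      fix i j assume "i < dim_row (0\<^sub>m ?N d :: complex mat)" "j < dim_col (0\<^sub>m ?N d :: complex mat)"
      then have ij: "i < ?N" "j < d" by auto
      have "(M * B) $$ (i, j) = (\<Sum>k<?N. M $$ (i, k) * B $$ (k, j))"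
        using M B(1) ij by (auto simp: scalar_prod_def lessThan_atLeast0 intro!: sum.cong)
      also have "\<dots> = (\<Sum>k<?N. \<Sum>g\<in>carrier G. z g * R g $$ (i, k) * B $$ (k, j))"
      proof (rule sum.cong[OF refl])
        fix k assume "k \<in> {..<?N}"
        then have k: "k < ?N" by simp
        have "(\<Sum>g\<in>carrier G. z g * R g $$ (i, k) * B $$ (k, j))
            = (\<Sum>g\<in>carrier G. if g = e i \<otimes> inv (e k) then z g * B $$ (k, j) else 0)"
          using eC[OF ij(1)] eC[OF k] ij(1) k by (intro sum.cong) (auto simp: R_ent inv_solve_right m_assoc)
        then show "M $$ (i, k) * B $$ (k, j) = (\<Sum>g\<in>carrier G. z g * R g $$ (i, k) * B $$ (k, j))"
          using eC[OF ij(1)] eC[OF k] ij k by (simp add: M_ent)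
      qed
      also have "\<dots> = (\<Sum>g\<in>carrier G. z g * (\<Sum>k<?N. R g $$ (i, k) * B $$ (k, j)))"
        by (subst sum.swap) (simp add: sum_distrib_left mult.assoc)
      also have "\<dots> = (\<Sum>g\<in>carrier G. z g * (\<Sum>k<d. B $$ (i, k) * \<rho>' g $$ (k, j)))"
      proof (rule sum.cong[OF refl], rule arg_cong2[where f = "(*)", OF refl])
        fix g assume g: "g \<in> carrier G"
        have "(\<Sum>k<?N. R g $$ (i, k) * B $$ (k, j)) = (R g * B) $$ (i, j)"
          using Rc[of g] B(1) ij by (auto simp: scalar_prod_def lessThan_atLeast0 intro!: sum.cong)
        also have "\<dots> = (B * \<rho>' g) $$ (i, j)" using intertw[OF g] by simp
        also have "\<dots> = (\<Sum>k<d. B $$ (i, k) * \<rho>' g $$ (k, j))"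
          using \<rho>'[OF g] B(1) ij by (auto simp: scalar_prod_def lessThan_atLeast0 intro!: sum.cong)
        finally show "(\<Sum>k<?N. R g $$ (i, k) * B $$ (k, j)) = (\<Sum>k<d. B $$ (i, k) * \<rho>' g $$ (k, j))" .
      qed
      also have "\<dots> = (\<Sum>k<d. B $$ (i, k) * (\<Sum>g\<in>carrier G. z g * \<rho>' g $$ (k, j)))"
        unfolding sum_distrib_left by (subst sum.swap) (simp add: mult_ac)
      also have "\<dots> = 0"
      proof (intro sum.neutral ballI)
        fix k assume "k \<in> {..<d}"
        then have k: "k < d" by simp
        have "(\<Sum>g\<in>carrier G. z g * \<rho>' g $$ (k, j)) = mat_sum d (\<lambda>g. z g \<cdot>\<^sub>m \<rho>' g) (carrier G) $$ (k, j)"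
          using k ij carrier_matD[OF \<rho>'] by (auto simp: mat_sum_def intro!: sum.cong)
        also have "\<dots> = 0" unfolding zero using k ij by simp
        finally show "B $$ (i, k) * (\<Sum>g\<in>carrier G. z g * \<rho>' g $$ (k, j)) = 0" by simp
      qed
      finally show "(M * B) $$ (i, j) = 0\<^sub>m ?N d $$ (i, j)" using ij by simp
    qed (use M B(1) in auto)
    have d: "d > 0" by (rule irr_dim[OF irr])
    let ?v = "B *\<^sub>v unit_vec d 0"
    have "?v \<in> W" by (rule B(3)) simp
    then obtain u where u: "u \<in> carrier_vec ?N" "?v = M *\<^sub>v u" unfolding W_def by blast
    have "M *\<^sub>v (M *\<^sub>v u) = (M * B) *\<^sub>v unit_vec d 0"
      unfolding u(2)[symmetric] by (rule assoc_mult_mat_vec[OF M B(1), symmetric]) simp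
    also have "\<dots> = 0\<^sub>v ?N" unfolding MB by (intro eq_vecI) (auto simp: scalar_prod_def)
    finally have "M *\<^sub>v u = 0\<^sub>v ?N"
      by (rule normal_mat_square_zero[OF M M' _ normal u(1), rotated]) (auto simp: M_ent M'_ent)
    then have "unit_vec d 0 = (0\<^sub>v d :: complex vec)"
      using u(2) by (intro inj_matD[OF B(2,1)]) auto
    then show False using d by simp
  qed
  obtain i where i: "i < ?N" "e i = x" using e x by (metis bij_betw_iff_bijections lessThan_iff)
  obtain j where j: "j < ?N" "e j = \<one>" using e one_closed by (metis bij_betw_iff_bijections lessThan_iff)
  have "M *\<^sub>v unit_vec ?N j \<in> W" unfolding W_def by simp
  then have "M *\<^sub>v unit_vec ?N j = 0\<^sub>v ?N" using \<open>W = {0\<^sub>v ?N}\<close> by simp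
  then have "(M *\<^sub>v unit_vec ?N j) $ i = 0" using i by simp
  moreover have "(M *\<^sub>v unit_vec ?N j) $ i = M $$ (i, j)" using M i j by (simp add: scalar_prod_right_unit)
  ultimately show ?thesis using i j x by (simp add: M_ent)
qed

end


section \<open>Irreducible characters\<close>

context fin_group
begin

lemma carrier_nonempty [simp]: "carrier G \<noteq> {}"
  using one_closed by blast

definition class_fun :: "('a \<Rightarrow> complex) \<Rightarrow> bool" where
  "class_fun f \<longleftrightarrow> (\<forall>g\<in>carrier G. \<forall>x\<in>carrier G. f (g \<otimes> x \<otimes> inv g) = f x)"

lemma class_funD: "class_fun f \<Longrightarrow> g \<in> carrier G \<Longrightarrow> x \<in> carrier G \<Longrightarrow> f (g \<otimes> x \<otimes> inv g) = f x"
  unfolding class_fun_def by blast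

lemma class_fun_shift:
  assumes "class_fun f" "a \<in> carrier G" "b \<in> carrier G"
  shows "f (a \<otimes> b) = f (b \<otimes> a)"
  using class_funD[OF assms(1), of b "a \<otimes> b"] assms by (simp add: m_assoc)

lemma class_fun_conj_inv:
  assumes "class_fun f" "t \<in> carrier G" "x \<in> carrier G"
  shows "f (inv (t \<otimes> x \<otimes> inv t)) = f (inv x)"
  using class_funD[OF assms(1), of t "inv x"] assms by (simp add: inv_mult_group m_assoc)

text \<open>
  The functional equation of irreducible characters: it says that \<open>\<phi> / \<phi>(1)\<close>, extended linearly, is
  multiplicative on the centre of the group algebra.
\<close>
definition char_equation :: "('a \<Rightarrow> complex) \<Rightarrow> bool" where
  "char_equation \<phi> \<longleftrightarrow> (\<forall>a\<in>carrier G. \<forall>b\<in>carrier G.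
     \<phi> \<one> * (\<Sum>t\<in>carrier G. \<phi> (a \<otimes> t \<otimes> b \<otimes> inv t)) = of_nat cardG * \<phi> a * \<phi> b)"

text \<open>
  Four properties of the values that determine the irreducible characters among all functions on
  the group (\<open>Irr_char_like\<close>, \<open>char_like_Irr\<close>). The degree is rational and the rest are equations between
  values with rational coefficients, so they are preserved by field automorphisms, and no
  representation that affords the conjugate character has to be constructed.
\<close>
definition char_like :: "('a \<Rightarrow> complex) \<Rightarrow> bool" where
  "char_like \<phi> \<longleftrightarrow> class_fun \<phi> \<and> (\<exists>d::nat. d > 0 \<and> \<phi> \<one> = of_nat d) \<and> char_equation \<phi> \<and>
     (\<Sum>g\<in>carrier G. \<phi> g * \<phi> (inv g)) = of_nat cardG"

lemma IrrE:
  assumes "\<chi> \<in> Irr G"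
  obtains d \<rho> where "irreducible_rep G d \<rho>" "\<And>g. g \<in> carrier G \<Longrightarrow> \<chi> g = mat_trace (\<rho> g)"
    "\<chi> = (\<lambda>g\<in>carrier G. mat_trace (\<rho> g))"
  using assms unfolding Irr_def by auto

lemma Irr_extensional: "\<chi> \<in> Irr G \<Longrightarrow> \<chi> \<in> extensional (carrier G)"
  unfolding Irr_def by auto

lemma Irr_char_like:
  assumes "\<chi> \<in> Irr G" shows "char_like \<chi>"
proof -
  obtain d \<rho> where irr: "irreducible_rep G d \<rho>" and \<chi>: "\<And>g. g \<in> carrier G \<Longrightarrow> \<chi> g = mat_trace (\<rho> g)"
    using assms by (rule IrrE) blast
  note c = irr_carrier[OF irr]
  have one: "\<chi> \<one> = of_nat d" by (simp add: \<chi> irr_one[OF irr] mat_trace_def)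
  have "class_fun \<chi>"
    unfolding class_fun_def
  proof (intro ballI)
    fix g x assume gx: "g \<in> carrier G" "x \<in> carrier G"
    have "\<chi> (g \<otimes> x \<otimes> inv g) = mat_trace (\<rho> (g \<otimes> x) * \<rho> (inv g))"
      using gx by (simp add: \<chi> irr_mult[OF irr])
    also have "\<dots> = mat_trace (\<rho> (inv g) * \<rho> (g \<otimes> x))"
      using gx by (intro mat_trace_mult_comm[of _ d d] c) auto
    also have "\<dots> = mat_trace (\<rho> (inv g \<otimes> (g \<otimes> x)))" using gx by (subst irr_mult[OF irr]) auto
    also have "inv g \<otimes> (g \<otimes> x) = x" using gx by (simp add: m_assoc[symmetric])
    finally show "\<chi> (g \<otimes> x \<otimes> inv g) = \<chi> x" using gx by (simp add: \<chi>)
  qed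
  moreover have "char_equation \<chi>"
    unfolding char_equation_def
  proof (intro ballI)
    fix a b assume ab: "a \<in> carrier G" "b \<in> carrier G"
    have "(\<Sum>t\<in>carrier G. \<chi> (a \<otimes> t \<otimes> b \<otimes> inv t)) = (\<Sum>t\<in>carrier G. mat_trace (\<rho> (a \<otimes> t \<otimes> b \<otimes> inv t)))"
      using ab by (intro sum.cong refl \<chi>) auto
    then show "\<chi> \<one> * (\<Sum>t\<in>carrier G. \<chi> (a \<otimes> t \<otimes> b \<otimes> inv t)) = of_nat cardG * \<chi> a * \<chi> b"
      unfolding one using irr_trace_equation[OF irr ab] ab by (simp add: \<chi>)
  qed
  moreover have "(\<Sum>g\<in>carrier G. \<chi> g * \<chi> (inv g)) = of_nat cardG"
    using irr_trace_norm[OF irr] by (simp add: \<chi>)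
  ultimately show ?thesis unfolding char_like_def using one irr_dim[OF irr] by blast
qed

text \<open>
  The functional equation says that averaging \<open>\<phi>(h t g t\<^sup>-\<^sup>1)\<close> over \<open>t\<close> gives
  \<open>\<phi>(h) \<phi>(g) / \<phi>(1)\<close>; a class function \<open>\<psi>\<close> does not notice the averaging.
\<close>
lemma char_convolution:
  assumes \<phi>: "char_equation \<phi>" and \<psi>: "class_fun \<psi>" and h: "h \<in> carrier G"
  shows "\<phi> \<one> * (\<Sum>g\<in>carrier G. \<phi> (h \<otimes> g) * \<psi> (inv g)) = \<phi> h * (\<Sum>g\<in>carrier G. \<phi> g * \<psi> (inv g))"
proof -
  let ?F = "\<Sum>g\<in>carrier G. \<phi> (h \<otimes> g) * \<psi> (inv g)"
  have "of_nat cardG * (\<phi> \<one> * ?F) = (\<Sum>t\<in>carrier G. \<phi> \<one> * ?F)" by simp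
  also have "\<dots> = (\<Sum>t\<in>carrier G. \<Sum>g\<in>carrier G. \<phi> \<one> * (\<phi> (h \<otimes> t \<otimes> g \<otimes> inv t) * \<psi> (inv g)))"
  proof (rule sum.cong[OF refl])
    fix t assume t: "t \<in> carrier G"
    have "?F = (\<Sum>g\<in>carrier G. \<phi> (h \<otimes> (t \<otimes> g \<otimes> inv t)) * \<psi> (inv (t \<otimes> g \<otimes> inv t)))"
      by (rule sum_conj[OF t, symmetric])
    also have "\<dots> = (\<Sum>g\<in>carrier G. \<phi> (h \<otimes> t \<otimes> g \<otimes> inv t) * \<psi> (inv g))"
    proof (rule sum.cong[OF refl])
      fix g assume g: "g \<in> carrier G"
      have "h \<otimes> (t \<otimes> g \<otimes> inv t) = h \<otimes> t \<otimes> g \<otimes> inv t" using t h g by (simp add: m_assoc)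
      then show "\<phi> (h \<otimes> (t \<otimes> g \<otimes> inv t)) * \<psi> (inv (t \<otimes> g \<otimes> inv t)) = \<phi> (h \<otimes> t \<otimes> g \<otimes> inv t) * \<psi> (inv g)"
        by (simp only: class_fun_conj_inv[OF \<psi> t g])
    qed
    finally show "\<phi> \<one> * ?F = (\<Sum>g\<in>carrier G. \<phi> \<one> * (\<phi> (h \<otimes> t \<otimes> g \<otimes> inv t) * \<psi> (inv g)))"
      by (simp add: sum_distrib_left)
  qed
  also have "\<dots> = (\<Sum>g\<in>carrier G. (\<phi> \<one> * (\<Sum>t\<in>carrier G. \<phi> (h \<otimes> t \<otimes> g \<otimes> inv t))) * \<psi> (inv g))"
    by (subst sum.swap) (simp add: sum_distrib_left sum_distrib_right mult.assoc)
  also have "\<dots> = (\<Sum>g\<in>carrier G. (of_nat cardG * \<phi> h * \<phi> g) * \<psi> (inv g))"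
    using \<phi> h unfolding char_equation_def by (intro sum.cong refl) auto
  also have "\<dots> = of_nat cardG * (\<phi> h * (\<Sum>g\<in>carrier G. \<phi> g * \<psi> (inv g)))"
    by (simp add: sum_distrib_left mult.assoc)
  finally show ?thesis using cardG_pos by simp
qed

lemma inner_commute:
  "(\<Sum>g\<in>carrier G. \<phi> g * \<psi> (inv g)) = (\<Sum>g\<in>carrier G. \<psi> g * (\<phi> (inv g) :: complex))"
  using sum_inv[of "\<lambda>g. \<psi> g * \<phi> (inv g)"] by (simp add: mult.commute)

text \<open>
  The inner products of \<open>\<phi>\<close> with the translates of \<open>\<psi>\<close> are proportional to \<open>\<phi>\<close> and, by symmetry,
  also to \<open>\<psi>\<close>. If they are not all zero, \<open>\<phi>\<close> and \<open>\<psi>\<close> are proportional, and since both have norm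
  \<open>1\<close> and positive degree they are equal.
\<close>
lemma char_like_orthogonal:
  assumes \<phi>: "char_like \<phi>" and \<psi>: "char_like \<psi>"
    and S: "(\<Sum>g\<in>carrier G. \<phi> g * \<psi> (inv g)) \<noteq> 0" and h: "h \<in> carrier G"
  shows "\<phi> h = \<psi> h"
proof -
  let ?S = "\<Sum>g\<in>carrier G. \<phi> g * \<psi> (inv g)"
  obtain d e :: nat where d: "d > 0" "\<phi> \<one> = of_nat d" and e: "e > 0" "\<psi> \<one> = of_nat e"
    using \<phi> \<psi> unfolding char_like_def by blast
  have cl: "class_fun \<phi>" "class_fun \<psi>" "char_equation \<phi>" "char_equation \<psi>"
    using \<phi> \<psi> unfolding char_like_def by auto
  have proportional: "of_nat e * \<phi> h = of_nat d * \<psi> h" if h: "h \<in> carrier G" for h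
  proof -
    let ?F = "\<Sum>g\<in>carrier G. \<phi> (h \<otimes> g) * \<psi> (inv g)"
    have "?F = (\<Sum>g\<in>carrier G. \<phi> (h \<otimes> (inv h \<otimes> g)) * \<psi> (inv (inv h \<otimes> g)))"
      using h by (subst sum_left[of "inv h", symmetric]) auto
    also have "\<dots> = (\<Sum>g\<in>carrier G. \<phi> g * \<psi> (inv g \<otimes> h))"
      using h by (intro sum.cong refl) (simp add: m_assoc[symmetric] inv_mult_group)
    also have "\<dots> = (\<Sum>g\<in>carrier G. \<phi> (inv g) * \<psi> (inv (inv g) \<otimes> h))" by (rule sum_inv[symmetric])
    also have "\<dots> = (\<Sum>g\<in>carrier G. \<psi> (h \<otimes> g) * \<phi> (inv g))"
      using h by (intro sum.cong refl) (simp add: class_fun_shift[OF cl(2), of h])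
    finally have F: "?F = (\<Sum>g\<in>carrier G. \<psi> (h \<otimes> g) * \<phi> (inv g))" .
    have 1: "of_nat d * ?F = \<phi> h * ?S" using char_convolution[OF cl(3,2) h] d by simp
    have 2: "of_nat e * ?F = \<psi> h * ?S"
      using char_convolution[OF cl(4,1) h] e F inner_commute[of \<phi> \<psi>] by simp
    have "of_nat e * \<phi> h * ?S = of_nat e * (of_nat d * ?F)" using 1 by simp
    also have "\<dots> = of_nat d * \<psi> h * ?S" using 2 by (simp add: mult_ac)
    finally show ?thesis using S by simp
  qed
  have "of_nat e * of_nat e * of_nat cardG = (\<Sum>g\<in>carrier G. (of_nat e * \<phi> g) * (of_nat e * \<phi> (inv g)))"
    using \<phi> unfolding char_like_def by (simp add: sum_distrib_left[symmetric] mult_ac)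
  also have "\<dots> = (\<Sum>g\<in>carrier G. (of_nat d * \<psi> g) * (of_nat d * \<psi> (inv g)))"
    by (intro sum.cong refl) (simp add: proportional)
  also have "\<dots> = of_nat d * of_nat d * of_nat cardG"
    using \<psi> unfolding char_like_def by (simp add: sum_distrib_left[symmetric] mult_ac)
  finally have "of_nat (e * e) = (of_nat (d * d) :: complex)" using cardG_pos by simp
  then have "e * e = d * d" by (simp only: of_nat_eq_iff)
  then have "e = d" by (simp add: power2_eq_square[symmetric])
  then show ?thesis using proportional[OF h] d by simp
qed

lemma Irr_eqI:
  assumes "\<chi> \<in> Irr G" "\<psi> \<in> Irr G" "\<And>g. g \<in> carrier G \<Longrightarrow> \<chi> g = \<psi> g"
  shows "\<chi> = \<psi>"
  using Irr_extensional[OF assms(1)] Irr_extensional[OF assms(2)] assms(3) by (rule extensionalityI)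

lemma Irr_orthogonal:
  assumes "\<chi> \<in> Irr G" "\<psi> \<in> Irr G"
  shows "(\<Sum>g\<in>carrier G. \<chi> g * \<psi> (inv g)) = (if \<chi> = \<psi> then of_nat cardG else 0)"
proof (cases "\<chi> = \<psi>")
  case True then show ?thesis using Irr_char_like[OF assms(1)] unfolding char_like_def by simp
next
  case False
  have "(\<Sum>g\<in>carrier G. \<chi> g * \<psi> (inv g)) = 0"
  proof (rule ccontr)
    assume "(\<Sum>g\<in>carrier G. \<chi> g * \<psi> (inv g)) \<noteq> 0"
    from char_like_orthogonal[OF Irr_char_like[OF assms(1)] Irr_char_like[OF assms(2)] this]
    have "\<chi> = \<psi>" by (rule Irr_eqI[OF assms])
    with False show False ..
  qed
  then show ?thesis using False by simp
qed

text \<open>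
  This is \<open>irreducible_traces_complete\<close> for the function \<open>g \<mapsto> f(g\<^sup>-\<^sup>1)\<close>.
\<close>
lemma Irr_complete:
  assumes f: "class_fun f" and orth: "\<And>\<chi>. \<chi> \<in> Irr G \<Longrightarrow> (\<Sum>g\<in>carrier G. f g * \<chi> (inv g)) = 0"
    and x: "x \<in> carrier G"
  shows "f x = 0"
proof -
  have "f (inv (inv x)) = 0"
  proof (rule irreducible_traces_complete[of "\<lambda>g. f (inv g)"])
    show "f (inv (g \<otimes> y \<otimes> inv g)) = f (inv y)" if "g \<in> carrier G" "y \<in> carrier G" for g y
      by (rule class_fun_conj_inv[OF f that])
    fix d \<rho> assume irr: "irreducible_rep G d \<rho>"
    define \<chi> where "\<chi> = (\<lambda>g\<in>carrier G. mat_trace (\<rho> g))"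
    have "\<chi> \<in> Irr G" unfolding Irr_def \<chi>_def using irr by blast
    then have "(\<Sum>g\<in>carrier G. f g * \<chi> (inv g)) = 0" by (rule orth)
    then have "(\<Sum>g\<in>carrier G. \<chi> g * f (inv g)) = 0" using inner_commute[of f \<chi>] by simp
    then show "(\<Sum>g\<in>carrier G. f (inv g) * mat_trace (\<rho> g)) = 0"
      by (simp add: \<chi>_def mult.commute)
  qed (use x in simp)
  then show ?thesis using x by simp
qed

text \<open>
  By completeness \<open>\<phi>\<close> is not orthogonal to all irreducible characters, so it equals one of them.
\<close>
lemma char_like_Irr:
  assumes \<phi>: "char_like \<phi>" and ext: "\<phi> \<in> extensional (carrier G)"
  shows "\<phi> \<in> Irr G"
proof -
  have "\<exists>\<chi>\<in>Irr G. (\<Sum>g\<in>carrier G. \<phi> g * \<chi> (inv g)) \<noteq> 0"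
  proof (rule ccontr)
    assume "\<not> ?thesis"
    then have orth: "(\<Sum>g\<in>carrier G. \<phi> g * \<chi> (inv g)) = 0" if "\<chi> \<in> Irr G" for \<chi>
      using that by blast
    have "class_fun \<phi>" using \<phi> unfolding char_like_def by blast
    then have "\<phi> \<one> = 0" using orth one_closed by (rule Irr_complete)
    then show False using \<phi> unfolding char_like_def by auto
  qed
  then obtain \<chi> where \<chi>: "\<chi> \<in> Irr G" "(\<Sum>g\<in>carrier G. \<phi> g * \<chi> (inv g)) \<noteq> 0" by blast
  have "\<phi> = \<chi>"
    using char_like_orthogonal[OF \<phi> Irr_char_like[OF \<chi>(1)] \<chi>(2)] ext Irr_extensional[OF \<chi>(1)]
    by (intro extensionalityI)
  then show ?thesis using \<chi>(1) by simp
qed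

lemma Irr_eigenvalues:
  assumes "\<chi> \<in> Irr G" and g: "g \<in> carrier G" "g [^] (n::nat) = \<one>"
  shows "\<exists>(d::nat) e. (\<forall>i<d. e i ^ n = 1) \<and> (\<forall>k::nat. \<chi> (g [^] k) = (\<Sum>i<d. e i ^ k))"
proof -
  obtain d \<rho> where irr: "irreducible_rep G d \<rho>" and \<chi>: "\<And>g. g \<in> carrier G \<Longrightarrow> \<chi> g = mat_trace (\<rho> g)"
    using assms(1) by (rule IrrE) blast
  have one: "\<rho> g ^\<^sub>m n = 1\<^sub>m d" using irr_pow[OF irr g(1), of n] g(2) irr_one[OF irr] by simp
  obtain e where e: "\<And>i. i < d \<Longrightarrow> e i ^ n = 1" "\<And>k. mat_trace (\<rho> g ^\<^sub>m k) = (\<Sum>i<d. e i ^ k)"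
    using mat_trace_powers[OF irr_carrier[OF irr g(1)] one] by blast
  have traces: "\<chi> (g [^] k) = (\<Sum>i<d. e i ^ k)" for k :: nat
    using e(2)[of k] g(1) by (simp add: \<chi> irr_pow[OF irr])
  with e(1) show ?thesis by blast
qed

lemma inv_eq_power: "g \<in> carrier G \<Longrightarrow> inv g = g [^] (cardG - 1)"
proof -
  assume g: "g \<in> carrier G"
  have "g [^] (cardG - 1) \<otimes> g = g [^] cardG"
    using cardG_pos nat_pow_Suc[of g "cardG - 1"] by simp
  also have "\<dots> = \<one>" using pow_order_eq_1[OF g] by (simp add: Coset.order_def)
  finally show ?thesis using g by (intro inv_equality) auto
qed

text \<open>
  The eigenvalues are roots of unity, whose inverses are their conjugates. Inverses are written as
  powers, because the traces are controlled for powers of one element.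
\<close>
lemma Irr_cnj:
  assumes "\<chi> \<in> Irr G" "g \<in> carrier G"
  shows "\<chi> (inv g) = cnj (\<chi> g)"
proof -
  have "g [^] cardG = \<one>" using pow_order_eq_1[OF assms(2)] by (simp add: Coset.order_def)
  from Irr_eigenvalues[OF assms this] obtain d :: nat and e
    where e: "\<And>i. i < d \<Longrightarrow> e i ^ cardG = 1" "\<And>k::nat. \<chi> (g [^] k) = (\<Sum>i<d. e i ^ k)"
    by blast
  have "e i ^ (cardG - 1) = cnj (e i)" if "i < d" for i
  proof -
    have "norm (e i) = 1" using power_eq_1_iff[OF e(1)[OF that]] cardG_pos by simp
    then have "e i * cnj (e i) = 1" by (simp add: complex_norm_square[symmetric])
    moreover have "e i * e i ^ (cardG - 1) = 1"
      using e(1)[OF that] power_minus_mult[OF cardG_pos, of "e i"] by (simp add: mult.commute)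
    moreover have "e i \<noteq> 0" using \<open>norm (e i) = 1\<close> by auto
    ultimately have "e i * e i ^ (cardG - 1) = e i * cnj (e i)" by simp
    then show ?thesis using \<open>e i \<noteq> 0\<close> by simp
  qed
  then have "\<chi> (inv g) = cnj (\<chi> (g [^] (1::nat)))"
    unfolding inv_eq_power[OF assms(2)] e(2) by simp
  then show ?thesis using assms(2) by simp
qed

lemma Irr_degree: assumes "\<chi> \<in> Irr G" obtains d :: nat where "d > 0" "\<chi> \<one> = of_nat d"
  using Irr_char_like[OF assms] unfolding char_like_def by blast

text \<open>
  Bessel's inequality for the indicator function of the neutral element: its squared norm \<open>1\<close>
  bounds the sum of its squared coefficients, which are at least \<open>1 / \<bar>G\<bar>\<close> each. The function \<open>D\<close>
  is its defect from the projection to the span of \<open>F\<close>.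
\<close>
lemma card_Irr_subset:
  assumes F: "finite F" "F \<subseteq> Irr G"
  shows "card F \<le> cardG"
proof -
  define N where "N = (of_nat cardG :: complex)"
  have N: "N \<noteq> 0" unfolding N_def using cardG_pos by simp
  define a where "a = (\<lambda>\<chi>. \<chi> \<one> / N)"
  define D where "D = (\<lambda>g. (if g = \<one> then 1 else 0) - (\<Sum>\<chi>\<in>F. a \<chi> * \<chi> g))"
  have a_cnj: "cnj (a \<chi>) = a \<chi>" if "\<chi> \<in> F" for \<chi>
  proof -
    have "\<chi> \<in> Irr G" using F that by blast
    then obtain d :: nat where "\<chi> \<one> = of_nat d" by (rule Irr_degree)
    then show ?thesis unfolding a_def N_def by simp
  qed
  have D_cnj: "cnj (D g) = (if g = \<one> then 1 else 0) - (\<Sum>\<psi>\<in>F. a \<psi> * \<psi> (inv g))" if "g \<in> carrier G" for g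
  proof -
    have "cnj (\<Sum>\<chi>\<in>F. a \<chi> * \<chi> g) = (\<Sum>\<psi>\<in>F. a \<psi> * \<psi> (inv g))"
      unfolding cnj_sum using F that by (intro sum.cong refl) (auto simp: Irr_cnj a_cnj)
    then show ?thesis unfolding D_def by simp
  qed
  have cross: "(\<Sum>g\<in>carrier G. (\<Sum>\<chi>\<in>F. a \<chi> * \<chi> g) * (\<Sum>\<psi>\<in>F. a \<psi> * \<psi> (inv g))) = (\<Sum>\<chi>\<in>F. a \<chi> * a \<chi> * N)"
  proof -
    have "(\<Sum>g\<in>carrier G. (\<Sum>\<chi>\<in>F. a \<chi> * \<chi> g) * (\<Sum>\<psi>\<in>F. a \<psi> * \<psi> (inv g)))
        = (\<Sum>g\<in>carrier G. \<Sum>\<chi>\<in>F. \<Sum>\<psi>\<in>F. a \<chi> * a \<psi> * (\<chi> g * \<psi> (inv g)))"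
      unfolding sum_product by (intro sum.cong refl) (simp add: mult_ac)
    also have "\<dots> = (\<Sum>\<chi>\<in>F. \<Sum>g\<in>carrier G. \<Sum>\<psi>\<in>F. a \<chi> * a \<psi> * (\<chi> g * \<psi> (inv g)))" by (rule sum.swap)
    also have "\<dots> = (\<Sum>\<chi>\<in>F. \<Sum>\<psi>\<in>F. \<Sum>g\<in>carrier G. a \<chi> * a \<psi> * (\<chi> g * \<psi> (inv g)))"
      by (intro sum.cong refl sum.swap)
    also have "\<dots> = (\<Sum>\<chi>\<in>F. \<Sum>\<psi>\<in>F. a \<chi> * a \<psi> * (if \<chi> = \<psi> then N else 0))"
    proof (intro sum.cong refl)
      fix \<chi> \<psi> assume "\<chi> \<in> F" "\<psi> \<in> F"
      then have "\<chi> \<in> Irr G" "\<psi> \<in> Irr G" using F by auto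
      then show "(\<Sum>g\<in>carrier G. a \<chi> * a \<psi> * (\<chi> g * \<psi> (inv g))) = a \<chi> * a \<psi> * (if \<chi> = \<psi> then N else 0)"
        unfolding sum_distrib_left[symmetric] N_def by (simp add: Irr_orthogonal)
    qed
    also have "\<dots> = (\<Sum>\<chi>\<in>F. a \<chi> * a \<chi> * N)"
      using F(1) by (intro sum.cong refl) (simp add: if_distrib cong: if_cong)
    finally show ?thesis .
  qed
  have sq: "a \<chi> * a \<chi> * N = a \<chi> * \<chi> \<one>" for \<chi> unfolding a_def using N by simp
  have "(\<Sum>g\<in>carrier G. D g * cnj (D g)) = (\<Sum>g\<in>carrier G. (if g = \<one> then 1 - (\<Sum>\<chi>\<in>F. a \<chi> * \<chi> \<one>) - (\<Sum>\<psi>\<in>F. a \<psi> * \<psi> \<one>) else 0)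
      + (\<Sum>\<chi>\<in>F. a \<chi> * \<chi> g) * (\<Sum>\<psi>\<in>F. a \<psi> * \<psi> (inv g)))"
    by (intro sum.cong refl) (auto simp: D_cnj, auto simp: D_def algebra_simps)
  also have "\<dots> = 1 - (\<Sum>\<chi>\<in>F. a \<chi> * \<chi> \<one>)"
    unfolding sum.distrib cross sq by simp
  finally have eq: "(\<Sum>g\<in>carrier G. D g * cnj (D g)) = 1 - (\<Sum>\<chi>\<in>F. a \<chi> * \<chi> \<one>)" .
  have "(\<Sum>g\<in>carrier G. D g * cnj (D g)) = of_real (\<Sum>g\<in>carrier G. (norm (D g))\<^sup>2)"
    by (simp add: complex_norm_square[symmetric])
  then have "Re (\<Sum>g\<in>carrier G. D g * cnj (D g)) \<ge> 0" by (simp add: sum_nonneg)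
  then have le: "Re (\<Sum>\<chi>\<in>F. a \<chi> * \<chi> \<one>) \<le> 1" unfolding eq by simp
  have "real (card F) / real cardG = (\<Sum>\<chi>\<in>F. 1 / real cardG)" by simp
  also have "\<dots> \<le> (\<Sum>\<chi>\<in>F. Re (a \<chi> * \<chi> \<one>))"
  proof (rule sum_mono)
    fix \<chi> assume "\<chi> \<in> F"
    then have "\<chi> \<in> Irr G" using F by blast
    then obtain d :: nat where d: "d > 0" "\<chi> \<one> = of_nat d" by (rule Irr_degree)
    have "a \<chi> * \<chi> \<one> = of_real (real (d * d) / real cardG)" unfolding a_def N_def d by simp
    then have re: "Re (a \<chi> * \<chi> \<one>) = real (d * d) / real cardG" by simp
    have "1 \<le> d * d" using d(1) by simp
    then have "1 \<le> real (d * d)" by linarith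
    then show "1 / real cardG \<le> Re (a \<chi> * \<chi> \<one>)"
      unfolding re by (rule divide_right_mono) simp
  qed
  also have "\<dots> \<le> 1" using le by (simp only: Re_sum)
  finally show ?thesis using cardG_pos by (simp add: field_simps)
qed

lemma finite_Irr: "finite (Irr G)"
proof (rule ccontr)
  assume "infinite (Irr G)"
  from infinite_arbitrarily_large[OF this, of "Suc cardG"]
  obtain F where "F \<subseteq> Irr G" "finite F" "card F = Suc cardG" by blast
  then show False using card_Irr_subset[of F] by simp
qed

text \<open>
  The difference of the two sides is a class function orthogonal to all irreducible characters.
\<close>
lemma class_fun_expansion:
  assumes f: "class_fun f" and x: "x \<in> carrier G"
  shows "of_nat cardG * f x = (\<Sum>\<chi>\<in>Irr G. (\<Sum>g\<in>carrier G. f g * \<chi> (inv g)) * \<chi> x)"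
proof -
  define N where "N = (of_nat cardG :: complex)"
  define c where "c = (\<lambda>\<chi>. \<Sum>g\<in>carrier G. f g * \<chi> (inv g))"
  define D where "D = (\<lambda>x. N * f x - (\<Sum>\<chi>\<in>Irr G. c \<chi> * \<chi> x))"
  have "D x = 0"
  proof (rule Irr_complete[OF _ _ x])
    show "class_fun D" unfolding class_fun_def D_def
    proof (intro ballI)
      fix g y assume gy: "g \<in> carrier G" "y \<in> carrier G"
      have invariant: "\<chi> (g \<otimes> y \<otimes> inv g) = \<chi> y" if "\<chi> \<in> Irr G" for \<chi>
        using Irr_char_like[OF that] class_funD[OF _ gy] unfolding char_like_def by blast
      have "(\<Sum>\<chi>\<in>Irr G. c \<chi> * \<chi> (g \<otimes> y \<otimes> inv g)) = (\<Sum>\<chi>\<in>Irr G. c \<chi> * \<chi> y)"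
        by (rule sum.cong[OF refl]) (simp only: invariant)
      then show "N * f (g \<otimes> y \<otimes> inv g) - (\<Sum>\<chi>\<in>Irr G. c \<chi> * \<chi> (g \<otimes> y \<otimes> inv g))
         = N * f y - (\<Sum>\<chi>\<in>Irr G. c \<chi> * \<chi> y)"
        using class_funD[OF f gy] by simp
    qed
    fix \<psi> assume \<psi>: "\<psi> \<in> Irr G"
    have "(\<Sum>g\<in>carrier G. D g * \<psi> (inv g))
        = (\<Sum>g\<in>carrier G. N * (f g * \<psi> (inv g)) - (\<Sum>\<chi>\<in>Irr G. c \<chi> * (\<chi> g * \<psi> (inv g))))"
      unfolding D_def by (intro sum.cong refl) (simp add: left_diff_distrib sum_distrib_right mult.assoc)
    also have "\<dots> = N * c \<psi> - (\<Sum>g\<in>carrier G. \<Sum>\<chi>\<in>Irr G. c \<chi> * (\<chi> g * \<psi> (inv g)))"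
    proof -
      have "c \<psi> = (\<Sum>g\<in>carrier G. f g * \<psi> (inv g))" by (simp only: c_def)
      then show ?thesis by (simp only: sum_subtractf sum_distrib_left[symmetric])
    qed
    also have "(\<Sum>g\<in>carrier G. \<Sum>\<chi>\<in>Irr G. c \<chi> * (\<chi> g * \<psi> (inv g)))
        = (\<Sum>\<chi>\<in>Irr G. c \<chi> * (\<Sum>g\<in>carrier G. \<chi> g * \<psi> (inv g)))"
      by (subst sum.swap) (simp add: sum_distrib_left)
    also have "\<dots> = (\<Sum>\<chi>\<in>Irr G. if \<chi> = \<psi> then c \<psi> * N else 0)"
      using \<psi> by (intro sum.cong refl) (auto simp: Irr_orthogonal N_def)
    also have "\<dots> = c \<psi> * N" using \<psi> finite_Irr by simp
    finally show "(\<Sum>g\<in>carrier G. D g * \<psi> (inv g)) = 0" by simp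
  qed
  then show ?thesis unfolding D_def c_def N_def by simp
qed

text \<open>
  The right-hand side, as a function of \<open>x\<close>, is \<open>\<bar>G\<bar>\<close> times the average of the indicator function
  of \<open>y\<close> over conjugation; expand this class function into characters.
\<close>
lemma Irr_column_orthogonal:
  assumes x: "x \<in> carrier G" and y: "y \<in> carrier G"
  shows "(\<Sum>\<chi>\<in>Irr G. \<chi> x * \<chi> (inv y)) = of_nat (card {t \<in> carrier G. t \<otimes> x \<otimes> inv t = y})"
proof -
  define f where "f = (\<lambda>x. \<Sum>t\<in>carrier G. if t \<otimes> x \<otimes> inv t = y then 1 else 0 :: complex)"
  have fx: "f x = of_nat (card {t \<in> carrier G. t \<otimes> x \<otimes> inv t = y})"
    unfolding f_def by (simp add: sum.If_cases Int_def conj_commute)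
  have "class_fun f"
    unfolding class_fun_def
  proof (intro ballI)
    fix g u assume gu: "g \<in> carrier G" "u \<in> carrier G"
    have "f u = (\<Sum>t\<in>carrier G. if (t \<otimes> g) \<otimes> u \<otimes> inv (t \<otimes> g) = y then 1 else 0)"
      unfolding f_def by (rule sum_right[OF gu(1), symmetric])
    also have "\<dots> = f (g \<otimes> u \<otimes> inv g)"
      unfolding f_def using gu by (intro sum.cong refl) (simp add: m_assoc inv_mult_group)
    finally show "f (g \<otimes> u \<otimes> inv g) = f u" by simp
  qed
  from class_fun_expansion[OF this x]
  have "of_nat cardG * f x = (\<Sum>\<chi>\<in>Irr G. (\<Sum>g\<in>carrier G. f g * \<chi> (inv g)) * \<chi> x)" .
  also have "\<dots> = (\<Sum>\<chi>\<in>Irr G. of_nat cardG * (\<chi> x * \<chi> (inv y)))"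
  proof (rule sum.cong[OF refl])
    fix \<chi> assume "\<chi> \<in> Irr G"
    then have cl: "class_fun \<chi>" using Irr_char_like unfolding char_like_def by blast
    have "(\<Sum>g\<in>carrier G. f g * \<chi> (inv g))
        = (\<Sum>g\<in>carrier G. \<Sum>t\<in>carrier G. if t \<otimes> g \<otimes> inv t = y then \<chi> (inv g) else 0)"
      unfolding f_def sum_distrib_right by (intro sum.cong refl) auto
    also have "\<dots> = (\<Sum>t\<in>carrier G. \<Sum>g\<in>carrier G. if t \<otimes> g \<otimes> inv t = y then \<chi> (inv g) else 0)" by (rule sum.swap)
    also have "\<dots> = (\<Sum>t\<in>carrier G. \<chi> (inv y))"
    proof (rule sum.cong[OF refl])
      fix t assume t: "t \<in> carrier G"
      have "(\<Sum>g\<in>carrier G. if t \<otimes> g \<otimes> inv t = y then \<chi> (inv g) else 0)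
          = (\<Sum>g\<in>carrier G. if t \<otimes> g \<otimes> inv t = y then \<chi> (inv (t \<otimes> g \<otimes> inv t)) else 0)"
      proof (rule sum.cong[OF refl])
        fix g assume "g \<in> carrier G"
        from class_fun_conj_inv[OF cl t this]
        show "(if t \<otimes> g \<otimes> inv t = y then \<chi> (inv g) else 0) = (if t \<otimes> g \<otimes> inv t = y then \<chi> (inv (t \<otimes> g \<otimes> inv t)) else 0)"
          by (simp only:)
      qed
      also have "\<dots> = (\<Sum>g\<in>carrier G. if g = y then \<chi> (inv g) else 0)"
        by (rule sum_conj[OF t, of "\<lambda>g. if g = y then \<chi> (inv g) else 0"])
      also have "\<dots> = \<chi> (inv y)" using y by simp
      finally show "(\<Sum>g\<in>carrier G. if t \<otimes> g \<otimes> inv t = y then \<chi> (inv g) else 0) = \<chi> (inv y)" .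
    qed
    also have "\<dots> = of_nat cardG * \<chi> (inv y)" by simp
    finally show "(\<Sum>g\<in>carrier G. f g * \<chi> (inv g)) * \<chi> x = of_nat cardG * (\<chi> x * \<chi> (inv y))" by simp
  qed
  finally show ?thesis using cardG_pos unfolding fx sum_distrib_left[symmetric] by simp
qed

end


section \<open>Units in orders generated by a real cyclotomic integer\<close>

text \<open>
  The interval from \<open>- R\<close> to \<open>R\<close> is cut into \<open>m\<close> boxes of length \<open>2 R / m\<close>; the right end
  point makes one more box, whence the assumption \<open>m + 1 < card A\<close>.
\<close>
lemma pigeonhole_close_values:
  fixes v :: "'i \<Rightarrow> real"
  assumes A: "finite A" and bound: "\<And>f. f \<in> A \<Longrightarrow> \<bar>v f\<bar> \<le> R" and R: "R > 0"
    and m: "m + 1 < card A" "m > 0"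
  obtains f g where "f \<in> A" "g \<in> A" "f \<noteq> g" "\<bar>v f - v g\<bar> \<le> 2 * R / real m"
proof -
  define \<delta> where "\<delta> = 2 * R / real m"
  have \<delta>: "\<delta> > 0" unfolding \<delta>_def using R m by simp
  define box where "box = (\<lambda>f. nat \<lfloor>(v f + R) / \<delta>\<rfloor>)"
  have "box ` A \<subseteq> {..m}"
  proof safe
    fix f assume f: "f \<in> A"
    have "(v f + R) / \<delta> \<le> 2 * R / \<delta>" using bound[OF f] \<delta> by (intro divide_right_mono) auto
    also have "\<dots> = real m" unfolding \<delta>_def using R m by simp
    finally show "box f \<le> m" unfolding box_def by linarith
  qed
  then have "card (box ` A) \<le> m + 1" using card_mono[of "{..m}" "box ` A"] by simp
  then have "\<not> inj_on box A" using m card_image[of box A] by linarith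
  then obtain f g where fg: "f \<in> A" "g \<in> A" "f \<noteq> g" "box f = box g" unfolding inj_on_def by blast
  have "0 \<le> (v f + R) / \<delta>" "0 \<le> (v g + R) / \<delta>" using bound[OF fg(1)] bound[OF fg(2)] \<delta> by auto
  then have "\<lfloor>(v f + R) / \<delta>\<rfloor> = \<lfloor>(v g + R) / \<delta>\<rfloor>" using fg(4) unfolding box_def by (simp add: nat_eq_iff)
  then have "\<bar>(v f + R) / \<delta> - (v g + R) / \<delta>\<bar> < 1" by linarith
  also have "(v f + R) / \<delta> - (v g + R) / \<delta> = (v f - v g) / \<delta>" by (simp add: diff_divide_distrib[symmetric])
  finally have "\<bar>v f - v g\<bar> < \<delta>" using \<delta> by (simp add: abs_divide)
  then show ?thesis using that fg unfolding \<delta>_def by (meson less_imp_le)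
qed

context root_of_unity
begin

lemma Gal_image_reindex:
  assumes s: "\<sigma> \<in> carrier Gal" and D: "D \<subseteq> L" "\<sigma> ` D = D"
  shows "bij_betw \<sigma> D D"
  using assms by (auto simp: bij_betw_def inj_on_def Gal_inj subset_iff)

text \<open>
  Being Galois stable, \<open>D\<close> is permuted by every automorphism, so the product is fixed.
\<close>
lemma conjugate_product_int:
  assumes D: "finite D" "D \<subseteq> int_adjoin \<zeta>" and stable: "\<And>\<sigma>. \<sigma> \<in> carrier Gal \<Longrightarrow> \<sigma> ` D = D"
  shows "(\<Prod>x\<in>D. ipoly q x) \<in> \<int>"
proof (rule Gal_fixed_integer)
  show "(\<Prod>x\<in>D. ipoly q x) \<in> int_adjoin \<zeta>" using D(2) by (intro int_adjoin_prod int_adjoin_ipoly) auto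
  fix \<sigma> assume s: "\<sigma> \<in> carrier Gal"
  have DL: "D \<subseteq> L" using D(2) int_adjoin_sub_cyclotomic by blast
  have qL: "ipoly q x \<in> L" if "x \<in> D" for x using D(2) that by (intro int_adjoin_sub_cyclotomic int_adjoin_ipoly) auto
  have "\<sigma> (\<Prod>x\<in>D. ipoly q x) = (\<Prod>x\<in>D. \<sigma> (ipoly q x))"
    by (rule Gal_prod[OF s]) (rule qL)
  also have "\<dots> = (\<Prod>x\<in>D. ipoly q (\<sigma> x))"
    by (intro prod.cong refl Gal_ipoly[OF s]) (use DL in auto)
  also have "\<dots> = (\<Prod>x\<in>D. ipoly q x)"
    by (rule prod.reindex_bij_betw[OF Gal_image_reindex[OF s DL stable[OF s]]])
  finally show "\<sigma> (\<Prod>x\<in>D. ipoly q x) = (\<Prod>x\<in>D. ipoly q x)" .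
qed

text \<open>
  A root of \<open>q\<close> in \<open>D\<close> would make all its conjugates roots, more than the degree permits.
\<close>
lemma ipoly_nonzero_on_orbit:
  assumes D: "finite D" "D \<subseteq> int_adjoin \<zeta>"
    and trans: "\<And>x y. x \<in> D \<Longrightarrow> y \<in> D \<Longrightarrow> \<exists>\<sigma>\<in>carrier Gal. \<sigma> x = y"
    and q: "q \<noteq> 0" "degree q < card D" and x: "x \<in> D"
  shows "ipoly q x \<noteq> 0"
proof
  assume 0: "ipoly q x = 0"
  have xL: "x \<in> L" using D(2) x int_adjoin_sub_cyclotomic by blast
  have "ipoly q y = 0" if y: "y \<in> D" for y
  proof -
    obtain \<sigma> where s: "\<sigma> \<in> carrier Gal" "\<sigma> x = y" using trans[OF x y] by blast
    have "ipoly q y = \<sigma> (ipoly q x)" using Gal_ipoly[OF s(1) xL, of q] s(2) by simp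
    then show ?thesis using 0 Gal_Rats[OF s(1), of 0] by simp
  qed
  then have "D \<subseteq> {y. ipoly q y = 0}" by blast
  moreover have nz: "map_poly of_int q \<noteq> (0 :: complex poly)" using q(1) by simp
  ultimately have "card D \<le> card {y. ipoly q y = 0}" using poly_roots_finite[OF nz] by (intro card_mono)
  also have "\<dots> \<le> degree (map_poly of_int q :: complex poly)" by (rule poly_roots_degree[OF nz])
  also have "\<dots> = degree q" by simp
  finally show False using q(2) by simp
qed

text \<open>
  Dirichlet's box argument. Among the \<open>S\<^sup>d\<close> polynomials of degree below \<open>d = card D\<close> with
  coefficients in \<open>{0, \<dots>, S - 1}\<close>, two have values at \<open>\<theta>\<close> that differ by \<open>O(S / S\<^sup>d)\<close>. Their
  difference \<open>p\<close> has values \<open>O(S)\<close> at the other \<open>d - 1\<close> points of \<open>D\<close>, so the product of all values is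
  bounded independently of \<open>S\<close>, while \<open>p(\<theta>)\<close> tends to \<open>0\<close>, as \<open>d \<ge> 2\<close>.
\<close>
lemma small_value_bounded_norm:
  assumes D: "finite D" "D \<subseteq> int_adjoin \<zeta>" "\<And>x. x \<in> D \<Longrightarrow> Im x = 0" "card D \<ge> 2"
    and \<theta>: "\<theta> \<in> D"
  shows "\<exists>C. C > 0 \<and> (\<forall>S\<ge>2. \<exists>p. p \<noteq> 0 \<and> degree p < card D \<and>
            norm (ipoly p \<theta>) \<le> C / real S \<and> norm (\<Prod>x\<in>D. ipoly p x) \<le> C)"
proof -
  let ?d = "card D"
  \<comment> \<open>\<open>K S\<close> bounds all values on \<open>D\<close> of polynomials with coefficients below \<open>S\<close>.\<close>
  define K where "K = 1 + (\<Sum>x\<in>D. \<Sum>j<?d. norm x ^ j)"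
  have K: "K \<ge> 1" unfolding K_def by (simp add: sum_nonneg)
  have Kx: "(\<Sum>j<?d. norm x ^ j) \<le> K" if "x \<in> D" for x
  proof -
    have "(\<Sum>j<?d. norm x ^ j) \<le> (\<Sum>x\<in>D. \<Sum>j<?d. norm x ^ j)"
      by (rule member_le_sum[OF that _ D(1)]) (simp add: sum_nonneg)
    then show ?thesis unfolding K_def by simp
  qed
  \<comment> \<open>Bounds of the value at \<open>\<theta>\<close>, \<open>8 K S / S\<^sup>d\<close>, and of the other \<open>d - 1\<close> values, \<open>4 K S\<close>, are
    multiplied; the powers of \<open>S\<close> cancel.\<close>
  define C where "C = 8 * K * (4 * K) ^ (?d - 1)"
  have "C > 0" unfolding C_def using K by simp
  have "\<exists>p. p \<noteq> 0 \<and> degree p < ?d \<and> norm (ipoly p \<theta>) \<le> C / real S \<and> norm (\<Prod>x\<in>D. ipoly p x) \<le> C"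
    if S: "S \<ge> 2" for S
  proof -
    define A where "A = Pi\<^sub>E {..<?d} (\<lambda>_. {0..<int S})"
    define q where "q = (\<lambda>f. \<Sum>j<?d. monom (f j) j :: int poly)"
    have A: "finite A" "card A = S ^ ?d" unfolding A_def by (auto simp: card_PiE intro!: finite_PiE)
    have qc: "coeff (q f) j = (if j < ?d then f j else 0)" for f j
      unfolding q_def coeff_sum by simp
    have deg: "degree (q f - q g) < ?d" for f g
    proof -
      have "degree (q f - q g) \<le> ?d - 1" 
      proof (rule degree_le, intro allI impI)
        fix i assume "?d - 1 < i"
        then have "\<not> i < ?d" by linarith
        then show "coeff (q f - q g) i = 0" by (simp add: qc)
      qed
      then show ?thesis using D(4) by linarith
    qed
    have val: "norm (ipoly (q f) x) \<le> K * S" if f: "f \<in> A" and x: "x \<in> D" for f x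
    proof -
      have "ipoly (q f) x = (\<Sum>j<?d. of_int (f j) * x ^ j)"
        unfolding q_def by (simp add: of_int_poly_hom.hom_sum poly_sum map_poly_monom poly_monom)
      also have "norm \<dots> \<le> (\<Sum>j<?d. norm (of_int (f j) * x ^ j))" by (rule norm_sum)
      also have "\<dots> \<le> (\<Sum>j<?d. real S * norm x ^ j)"
      proof (rule sum_mono)
        fix j assume "j \<in> {..<?d}"
        then have "f j \<in> {0..<int S}" using f unfolding A_def by blast
        then have "\<bar>real_of_int (f j)\<bar> \<le> real S" by auto
        then show "norm (of_int (f j) * x ^ j) \<le> real S * norm x ^ j"
          unfolding norm_mult norm_power norm_of_int by (intro mult_right_mono) auto
      qed
      also have "\<dots> = (\<Sum>j<?d. norm x ^ j) * S" by (simp add: sum_distrib_left mult.commute)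
      also have "\<dots> \<le> K * S" using Kx[OF x] by (intro mult_right_mono) auto
      finally show ?thesis .
    qed
    have S4: "S ^ ?d \<ge> 4"
    proof -
      have "(4::nat) = 2 ^ 2" by simp
      also have "\<dots> \<le> S ^ 2" using S by (intro power_mono) auto
      also have "\<dots> \<le> S ^ ?d" using S D(4) by (intro power_increasing) auto
      finally show ?thesis .
    qed
    \<comment> \<open>The number of boxes must stay below \<open>S\<^sup>d - 1\<close> but be of the same order of magnitude.\<close>
    define m where "m = S ^ ?d div 2"
    have m: "m + 1 < card A" "m > 0" "real m \<ge> real S ^ ?d / 4"
    proof -
      have half: "2 * m + S ^ ?d mod 2 = S ^ ?d" "S ^ ?d mod 2 < 2" unfolding m_def by simp_all
      show "m + 1 < card A" "m > 0" unfolding A(2) using S4 half by linarith+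
      have "4 * m \<ge> S ^ ?d" using S4 half by linarith
      then have "real (4 * m) \<ge> real (S ^ ?d)" by (simp only: of_nat_le_iff)
      then show "real m \<ge> real S ^ ?d / 4" by simp
    qed
    have bound: "\<bar>Re (ipoly (q f) \<theta>)\<bar> \<le> K * S" if "f \<in> A" for f
      using val[OF that \<theta>] abs_Re_le_cmod order_trans by blast
    have KS: "K * S > 0" using K S by simp
    obtain f g where fg: "f \<in> A" "g \<in> A" "f \<noteq> g"
        "\<bar>Re (ipoly (q f) \<theta>) - Re (ipoly (q g) \<theta>)\<bar> \<le> 2 * (K * S) / real m"
      using pigeonhole_close_values[of A "\<lambda>f. Re (ipoly (q f) \<theta>)", OF A(1) bound KS m(1,2)] by blast
    define p where "p = q f - q g"
    have "p \<noteq> 0"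
    proof
      assume "p = 0"
      then have "coeff (q f) j = coeff (q g) j" for j unfolding p_def by simp
      then have "f j = g j" if "j < ?d" for j using that by (metis qc)
      then have "f = g" using fg(1,2) unfolding A_def by (intro PiE_ext) auto
      then show False using fg(3) by simp
    qed
    have px: "norm (ipoly p x) \<le> 4 * K * S" if "x \<in> D" for x
    proof -
      have "norm (ipoly p x) \<le> norm (ipoly (q f) x) + norm (ipoly (q g) x)"
        unfolding p_def ipoly_diff by (rule norm_triangle_ineq4)
      then have "norm (ipoly p x) \<le> 4 * (K * S)"
        using val[OF fg(1) that] val[OF fg(2) that] KS by linarith
      then show ?thesis by simp
    qed
    have ipoly_real: "Im (ipoly r \<theta>) = 0" for r
    proof -
      have "\<theta> \<in> \<real>" using D(3)[OF \<theta>] by (simp add: complex_is_Real_iff)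
      then have "ipoly r \<theta> \<in> \<real>" unfolding ipoly_altdef by (intro sum_in_Reals Reals_mult Reals_power) auto
      then show ?thesis by (simp add: complex_is_Real_iff)
    qed
    have p\<theta>: "norm (ipoly p \<theta>) \<le> 8 * K * S / real S ^ ?d"
    proof -
      have "norm (ipoly p \<theta>) = \<bar>Re (ipoly p \<theta>)\<bar>" using ipoly_real[of p] by (simp add: cmod_eq_Re)
      also have "\<dots> \<le> 2 * (K * S) / real m" using fg(4) unfolding p_def ipoly_diff by simp
      also have "\<dots> \<le> 2 * (K * S) / (real S ^ ?d / 4)"
        using m KS S by (intro divide_left_mono) auto
      also have "\<dots> = 8 * K * S / real S ^ ?d" by simp
      finally show ?thesis .
    qed
    have Sd: "real S ^ ?d = real S * real S ^ (?d - 1)" using D(4) by (metis Suc_diff_1 less_le_trans pos2 power_Suc)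
    have "norm (\<Prod>x\<in>D. ipoly p x) = norm (ipoly p \<theta>) * (\<Prod>x\<in>D - {\<theta>}. norm (ipoly p x))"
      unfolding prod_norm norm_mult[symmetric] using prod.remove[OF D(1) \<theta>] by metis
    also have "\<dots> \<le> (8 * K * S / real S ^ ?d) * (\<Prod>x\<in>D - {\<theta>}. 4 * K * S)"
      using px p\<theta> K S by (intro mult_mono prod_mono prod_nonneg) auto
    also have "(\<Prod>x\<in>D - {\<theta>}. 4 * K * real S) = (4 * K * S) ^ (?d - 1)" using \<theta> D(1) by simp
    also have "(8 * K * S / real S ^ ?d) * (4 * K * S) ^ (?d - 1) = C"
      unfolding C_def Sd power_mult_distrib using S by simp
    finally have norm: "norm (\<Prod>x\<in>D. ipoly p x) \<le> C" .
    have "8 * K * S / real S ^ ?d \<le> 8 * K * S / real S ^ 2"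
      using K S D(4) by (intro divide_left_mono power_increasing) auto
    also have "\<dots> = 8 * K / S" using S by (simp add: power2_eq_square)
    also have "\<dots> \<le> C / S"
    proof -
      have "1 \<le> (4 * K) ^ (?d - 1)" using K by (intro one_le_power) auto
      then have "8 * K * 1 \<le> C" unfolding C_def using K by (intro mult_left_mono) auto
      then show ?thesis by (intro divide_right_mono) auto
    qed
    finally have "norm (ipoly p \<theta>) \<le> C / S" using p\<theta> by linarith
    then show ?thesis using \<open>p \<noteq> 0\<close> norm deg[of f g] unfolding p_def by blast
  qed
  then show ?thesis using \<open>C > 0\<close> by blast
qed

text \<open>
  Among infinitely many polynomials \<open>p\<^sub>S\<close> of bounded norm, with values at \<open>\<theta>\<close> tending to \<open>0\<close>, two have
  the same norm \<open>\<mu>\<close> and congruent coefficients modulo \<open>Q = M B!\<close>, where \<open>B\<close> bounds the norms. As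
  \<open>\<mu>\<close> divides \<open>B!\<close>, and \<open>p\<^sub>1(x)\<close> divides its norm \<open>\<mu>\<close>, the difference \<open>p\<^sub>2(x) - p\<^sub>1(x)\<close> is divisible by
  \<open>M p\<^sub>1(x)\<close> and likewise by \<open>M p\<^sub>2(x)\<close>. So the quotient \<open>u = p\<^sub>2(x) / p\<^sub>1(x)\<close> is a unit congruent to
  \<open>1\<close> modulo \<open>M\<close>, and it is less than \<open>1\<close> in absolute value at \<open>\<theta>\<close> if \<open>p\<^sub>2\<close> comes late enough. The
  unit and its inverse are given in the form \<open>1 + M w(x)\<close> as functions on the orbit \<open>D\<close>, so that the
  Galois group acts through the argument.
\<close>
theorem real_orbit_unit:
  assumes D: "finite D" "D \<subseteq> int_adjoin \<zeta>" "\<And>x. x \<in> D \<Longrightarrow> Im x = 0" "card D \<ge> 2"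
    and stable: "\<And>\<sigma>. \<sigma> \<in> carrier Gal \<Longrightarrow> \<sigma> ` D = D"
    and trans: "\<And>x y. x \<in> D \<Longrightarrow> y \<in> D \<Longrightarrow> \<exists>\<sigma>\<in>carrier Gal. \<sigma> x = y"
    and \<theta>: "\<theta> \<in> D" and M: "(M::int) > 0"
  shows "\<exists>w w'. (\<forall>x\<in>D. w x \<in> int_adjoin \<zeta> \<and> w' x \<in> int_adjoin \<zeta>) \<and>
    (\<forall>\<sigma>\<in>carrier Gal. \<forall>x\<in>D. \<sigma> (w x) = w (\<sigma> x) \<and> \<sigma> (w' x) = w' (\<sigma> x)) \<and>
    (\<forall>x\<in>D. (1 + of_int M * w x) * (1 + of_int M * w' x) = 1) \<and>
    norm (1 + of_int M * w \<theta>) < 1"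
proof -
  let ?d = "card D"
  have DL: "D \<subseteq> L" using D(2) int_adjoin_sub_cyclotomic by blast
  obtain C where C: "C > 0" "\<And>S. S \<ge> 2 \<Longrightarrow> \<exists>p. p \<noteq> 0 \<and> degree p < ?d \<and>
            norm (ipoly p \<theta>) \<le> C / real S \<and> norm (\<Prod>x\<in>D. ipoly p x) \<le> C"
    using small_value_bounded_norm[OF D \<theta>] by blast
  then obtain p where p: "\<And>S. S \<ge> 2 \<Longrightarrow> p S \<noteq> 0" "\<And>S. S \<ge> 2 \<Longrightarrow> degree (p S) < ?d"
    "\<And>S. S \<ge> 2 \<Longrightarrow> norm (ipoly (p S) \<theta>) \<le> C / real S" "\<And>S. S \<ge> 2 \<Longrightarrow> norm (\<Prod>x\<in>D. ipoly (p S) x) \<le> C"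
    by metis
  have "\<exists>\<nu>. (\<Prod>x\<in>D. ipoly (p S) x) = of_int \<nu>" for S
    using conjugate_product_int[OF D(1,2) stable, of "p S"] by (auto elim: Ints_cases)
  then obtain \<nu> where \<nu>: "\<And>S. (\<Prod>x\<in>D. ipoly (p S) x) = of_int (\<nu> S)" by metis
  define B where "B = nat \<lfloor>C\<rfloor>"
  have \<nu>B: "\<bar>\<nu> S\<bar> \<le> int B" if "S \<ge> 2" for S
  proof -
    have "real_of_int \<bar>\<nu> S\<bar> \<le> C" using p(4)[OF that] unfolding \<nu> by simp
    then show ?thesis unfolding B_def by linarith
  qed
  have nz: "ipoly (p S) x \<noteq> 0" if "S \<ge> 2" "x \<in> D" for S x
    using ipoly_nonzero_on_orbit[OF D(1,2) trans p(1)[OF that(1)] p(2)[OF that(1)] that(2)] .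
  have \<nu>0: "\<nu> S \<noteq> 0" if "S \<ge> 2" for S
  proof
    assume "\<nu> S = 0"
    then have "(\<Prod>x\<in>D. ipoly (p S) x) = 0" unfolding \<nu> by simp
    then show False using nz[OF that] D(1) by simp
  qed
  define Q where "Q = M * fact B"
  have Q: "Q > 0" unfolding Q_def using M by simp
  \<comment> \<open>The norm of \<open>p\<^sub>S\<close> and its coefficients modulo \<open>Q\<close>: finitely many possibilities.\<close>
  define key where "key = (\<lambda>S. (\<nu> S, \<lambda>j\<in>{..<?d}. coeff (p S) j mod Q))"
  have "key ` {2..} \<subseteq> {- int B..int B} \<times> Pi\<^sub>E {..<?d} (\<lambda>_. {0..<Q})"
  proof (rule image_subsetI)
    fix S :: nat assume "S \<in> {2..}"
    then have S: "2 \<le> S" by simp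
    have "\<nu> S \<in> {- int B..int B}" using \<nu>B[OF S] by auto
    moreover have "(\<lambda>j\<in>{..<?d}. coeff (p S) j mod Q) \<in> Pi\<^sub>E {..<?d} (\<lambda>_. {0..<Q})"
      using Q by (auto simp: PiE_iff)
    ultimately show "key S \<in> {- int B..int B} \<times> Pi\<^sub>E {..<?d} (\<lambda>_. {0..<Q})"
      unfolding key_def by blast
  qed
  then have "finite (key ` {2..})"
    by (rule finite_subset) (intro finite_cartesian_product finite_PiE, auto)
  moreover have "infinite {2::nat..}" by (rule infinite_Ici)
  ultimately obtain S1 where S1: "S1 \<in> {2..}" "infinite {S \<in> {2..}. key S = key S1}"
    using pigeonhole_infinite by blast
  have pos: "norm (ipoly (p S1) \<theta>) > 0" using nz \<theta> S1 by simp
  obtain S2 where S2: "S2 \<ge> 2" "key S2 = key S1" "real S2 > C / norm (ipoly (p S1) \<theta>)"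
  proof -
    obtain k :: nat where k: "real k > C / norm (ipoly (p S1) \<theta>)" using reals_Archimedean2 by blast
    have "\<exists>S > k. S \<in> {S \<in> {2..}. key S = key S1}" using S1(2) unfolding infinite_nat_iff_unbounded by blast
    then show ?thesis using that k by force
  qed
  have S1': "S1 \<ge> 2" using S1 by simp
  define p1 p2 where "p1 = p S1" and "p2 = p S2"
  define \<mu> where "\<mu> = \<nu> S1"
  have \<mu>2: "\<nu> S2 = \<mu>" using S2(2) unfolding key_def \<mu>_def by simp
  have prod1: "(\<Prod>x\<in>D. ipoly p1 x) = of_int \<mu>" and prod2: "(\<Prod>x\<in>D. ipoly p2 x) = of_int \<mu>"
    unfolding p1_def p2_def using \<nu> \<mu>2 \<mu>_def by simp_all
  have small: "norm (ipoly p2 \<theta>) < norm (ipoly p1 \<theta>)"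
  proof -
    have "norm (ipoly p2 \<theta>) \<le> C / real S2" unfolding p2_def by (rule p(3)[OF S2(1)])
    also have "\<dots> < norm (ipoly p1 \<theta>)" using S2 pos unfolding p1_def by (simp add: field_simps)
    finally show ?thesis .
  qed
  have nz1: "ipoly p1 x \<noteq> 0" and nz2: "ipoly p2 x \<noteq> 0" if "x \<in> D" for x
    unfolding p1_def p2_def using nz S1' S2 that by auto
  have "[:Q:] dvd p2 - p1"
    unfolding const_poly_dvd_iff
  proof
    fix j
    show "Q dvd coeff (p2 - p1) j"
    proof (cases "j < ?d")
      case True
      have "coeff p2 j mod Q = coeff p1 j mod Q"
      proof -
        have "(\<lambda>j\<in>{..<?d}. coeff (p S2) j mod Q) = (\<lambda>j\<in>{..<?d}. coeff (p S1) j mod Q)"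
          using S2(2) unfolding key_def by simp
        from fun_cong[OF this, of j] show ?thesis using True unfolding p1_def p2_def by simp
      qed
      then show ?thesis by (simp add: mod_eq_dvd_iff)
    next
      case False
      then have "coeff p2 j = 0" "coeff p1 j = 0"
        unfolding p1_def p2_def using p(2)[OF S1'] p(2)[OF S2(1)] by (auto intro!: coeff_eq_0)
      then show ?thesis by simp
    qed
  qed
  then obtain r where "p2 - p1 = [:Q:] * r" by (auto elim: dvdE)
  then have r: "ipoly p2 x - ipoly p1 x = of_int Q * ipoly r x" for x
    unfolding ipoly_diff[symmetric] by (simp only: ipoly_mult ipoly_const)
  have "\<mu> dvd fact B"
  proof -
    have "nat \<bar>\<mu>\<bar> dvd fact B"
      using \<nu>0[OF S1'] \<nu>B[OF S1'] unfolding \<mu>_def by (intro dvd_fact) auto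
    then have "int (nat \<bar>\<mu>\<bar>) dvd int (fact B)" by (simp only: int_dvd_int_iff)
    then show ?thesis by simp
  qed
  then obtain c where c: "fact B = \<mu> * c" by (auto elim: dvdE)
  have \<mu>0: "\<mu> \<noteq> 0" unfolding \<mu>_def by (rule \<nu>0[OF S1'])
  \<comment> \<open>The cofactor of \<open>q(x)\<close> in the norm of \<open>q\<close>; it lies in \<open>\<int>[\<zeta>]\<close>, so \<open>q(x)\<close> divides its norm there.\<close>
  define cof where "cof = (\<lambda>q x. \<Prod>y\<in>D - {x}. ipoly q y)"
  define w where "w = (\<lambda>x. of_int c * (ipoly r x * cof p1 x))"
  define w' where "w' = (\<lambda>x. of_int c * (ipoly (- r) x * cof p2 x))"
  have cof: "ipoly q x * cof q x = (\<Prod>y\<in>D. ipoly q y)" if "x \<in> D" for q x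
    unfolding cof_def using prod.remove[OF D(1) that] by metis
  have cof_int: "cof q x \<in> int_adjoin \<zeta>" for q x
    unfolding cof_def using D(2) by (intro int_adjoin_prod int_adjoin_ipoly) auto
  have cof_Gal: "\<sigma> (cof q x) = cof q (\<sigma> x)" if s: "\<sigma> \<in> carrier Gal" and x: "x \<in> D" for \<sigma> q x
  proof -
    have qL: "ipoly q y \<in> L" if "y \<in> D - {x}" for y
      using D(2) that by (intro int_adjoin_sub_cyclotomic int_adjoin_ipoly) auto
    have bij: "bij_betw \<sigma> (D - {x}) (D - {\<sigma> x})"
      using Gal_image_reindex[OF s DL stable[OF s]] x stable[OF s] by (intro bij_betw_DiffI) auto
    have "\<sigma> (cof q x) = (\<Prod>y\<in>D - {x}. \<sigma> (ipoly q y))"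
      unfolding cof_def by (rule Gal_prod[OF s]) (rule qL)
    also have "\<dots> = (\<Prod>y\<in>D - {x}. ipoly q (\<sigma> y))"
      by (intro prod.cong refl Gal_ipoly[OF s]) (use DL in auto)
    also have "\<dots> = cof q (\<sigma> x)" unfolding cof_def by (rule prod.reindex_bij_betw[OF bij])
    finally show ?thesis .
  qed
  have w1: "1 + of_int M * w x = ipoly p2 x / ipoly p1 x" if "x \<in> D" for x
  proof -
    have "ipoly p1 x * (of_int M * w x) = of_int M * of_int c * ipoly r x * (ipoly p1 x * cof p1 x)"
      unfolding w_def by (simp add: mult_ac)
    also have "\<dots> = of_int (M * (\<mu> * c)) * ipoly r x" unfolding cof[OF that] prod1 by (simp add: mult_ac)
    also have "M * (\<mu> * c) = Q" unfolding Q_def c by simp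
    also have "of_int Q * ipoly r x = ipoly p2 x - ipoly p1 x" by (rule r[symmetric])
    finally show ?thesis using nz1[OF that] by (simp add: field_simps)
  qed
  have w2: "1 + of_int M * w' x = ipoly p1 x / ipoly p2 x" if "x \<in> D" for x
  proof -
    have "ipoly (- r) x = - ipoly r x" by (simp add: of_int_poly_hom.hom_uminus)
    then have "ipoly p2 x * (of_int M * w' x) = - (of_int M * of_int c * ipoly r x * (ipoly p2 x * cof p2 x))"
      unfolding w'_def by (simp add: mult_ac)
    also have "\<dots> = - (of_int (M * (\<mu> * c)) * ipoly r x)" unfolding cof[OF that] prod2 by (simp add: mult_ac)
    also have "M * (\<mu> * c) = Q" unfolding Q_def c by simp
    also have "of_int Q * ipoly r x = ipoly p2 x - ipoly p1 x" by (rule r[symmetric])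
    finally show ?thesis using nz2[OF that] by (simp add: field_simps)
  qed
  have Gal_w: "\<sigma> (of_int c * (ipoly s x * cof q x)) = of_int c * (ipoly s (\<sigma> x) * cof q (\<sigma> x))"
    if s: "\<sigma> \<in> carrier Gal" and x: "x \<in> D" for \<sigma> s q x
  proof -
    have xL: "x \<in> L" using x DL by blast
    have "of_int c \<in> L" by (intro Rats_sub_cyclotomic) simp
    moreover have "ipoly s x \<in> L" using x D(2) by (intro int_adjoin_sub_cyclotomic int_adjoin_ipoly) auto
    moreover have "cof q x \<in> L" by (rule int_adjoin_sub_cyclotomic[OF cof_int])
    ultimately show ?thesis
      using Gal_ipoly[OF s xL, of _] cof_Gal[OF s x] by (simp add: Gal_times[OF s] L_mult Gal_Rats[OF s])
  qed
  show ?thesis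
  proof (rule exI[of _ w], rule exI[of _ w'], intro conjI ballI)
    fix x assume x: "x \<in> D"
    have xi: "x \<in> int_adjoin \<zeta>" using x D(2) by blast
    show "w x \<in> int_adjoin \<zeta>" "w' x \<in> int_adjoin \<zeta>"
      unfolding w_def w'_def by (intro int_adjoin_mult int_adjoin_of_int int_adjoin_ipoly cof_int xi)+
    show "(1 + of_int M * w x) * (1 + of_int M * w' x) = 1"
      unfolding w1[OF x] w2[OF x] using nz1[OF x] nz2[OF x] by simp
  next
    fix \<sigma> x assume s: "\<sigma> \<in> carrier Gal" and x: "x \<in> D"
    show "\<sigma> (w x) = w (\<sigma> x)" unfolding w_def by (rule Gal_w[OF s x])
    show "\<sigma> (w' x) = w' (\<sigma> x)" unfolding w'_def by (rule Gal_w[OF s x])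
  next
    show "norm (1 + of_int M * w \<theta>) < 1"
      unfolding w1[OF \<theta>] norm_divide using small nz1[OF \<theta>] by simp
  qed
qed

end


section \<open>The Galois action on irreducible characters\<close>

locale cyclotomic_group = fin_group G + root_of_unity n \<zeta>
  for G :: "('a, 'b) monoid_scheme" (structure) and n \<zeta> +
  assumes exponent: "\<And>g. g \<in> carrier G \<Longrightarrow> g [^] n = \<one>"
begin

lemma Irr_root_sums:
  assumes "\<chi> \<in> Irr G" "g \<in> carrier G"
  shows "\<exists>(d::nat) a. \<forall>k::nat. \<chi> (g [^] k) = (\<Sum>i<d. \<zeta> ^ (a i * k))"
proof -
  from Irr_eigenvalues[OF assms exponent[OF assms(2)]]
  obtain d :: nat and e :: "nat \<Rightarrow> complex"
    where e: "\<forall>i<d. e i ^ n = 1" "\<forall>k::nat. \<chi> (g [^] k) = (\<Sum>i<d. e i ^ k)"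
    by (elim exE conjE)
  have "\<exists>a. e i = \<zeta> ^ a" if i: "i < d" for i
  proof -
    have "e i ^ n = 1" using e(1) i by blast
    then show ?thesis by (rule roots_of_unity_powers) blast
  qed
  then have "\<forall>i. \<exists>a. i < d \<longrightarrow> e i = \<zeta> ^ a" by blast
  then obtain a where a: "\<forall>i. i < d \<longrightarrow> e i = \<zeta> ^ a i" by (rule choice[THEN exE])
  have eq: "\<forall>k::nat. \<chi> (g [^] k) = (\<Sum>i<d. \<zeta> ^ (a i * k))"
  proof
    fix k :: nat
    have "\<chi> (g [^] k) = (\<Sum>i<d. e i ^ k)" using e(2) by (rule spec)
    also have "\<dots> = (\<Sum>i<d. \<zeta> ^ (a i * k))"
      by (intro sum.cong refl) (simp add: a power_mult)
    finally show "\<chi> (g [^] k) = (\<Sum>i<d. \<zeta> ^ (a i * k))" .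
  qed
  show ?thesis by (rule exI[of _ d], rule exI[of _ a], rule eq)
qed

lemma Irr_int_adjoin: "\<chi> \<in> Irr G \<Longrightarrow> g \<in> carrier G \<Longrightarrow> \<chi> g \<in> int_adjoin \<zeta>"
proof -
  assume \<chi>: "\<chi> \<in> Irr G" and g: "g \<in> carrier G"
  from Irr_root_sums[OF \<chi> g] obtain d :: nat and a :: "nat \<Rightarrow> nat"
    where "\<forall>k::nat. \<chi> (g [^] k) = (\<Sum>i<d. \<zeta> ^ (a i * k))" by (elim exE)
  from spec[OF this, of 1] have "\<chi> g = (\<Sum>i<d. \<zeta> ^ a i)" using g by simp
  then show ?thesis by (simp only:) (intro int_adjoin_sum int_adjoin_power int_adjoin_self)
qed

lemma Irr_L: "\<chi> \<in> Irr G \<Longrightarrow> g \<in> carrier G \<Longrightarrow> \<chi> g \<in> L"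
  by (intro int_adjoin_sub_cyclotomic Irr_int_adjoin)

text \<open>
  The value of a character is a sum of powers of \<open>\<zeta>\<close>, the eigenvalues of the representing matrix,
  and passing to \<open>g\<^sup>m\<close> raises each eigenvalue to the \<open>m\<close>-th power, as \<open>\<sigma>\<close> does.
\<close>
lemma Gal_Irr_value:
  assumes "\<chi> \<in> Irr G" "g \<in> carrier G" and s: "\<sigma> \<in> carrier Gal" "\<sigma> \<zeta> = \<zeta> ^ m"
  shows "\<sigma> (\<chi> g) = \<chi> (g [^] m)"
proof -
  from Irr_root_sums[OF assms(1,2)] obtain d :: nat and a :: "nat \<Rightarrow> nat"
    where e: "\<forall>k::nat. \<chi> (g [^] k) = (\<Sum>i<d. \<zeta> ^ (a i * k))" by (elim exE)
  from spec[OF e, of 1] have "\<chi> g = (\<Sum>i<d. \<zeta> ^ a i)" using assms(2) by simp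
  then have "\<sigma> (\<chi> g) = (\<Sum>i<d. \<sigma> (\<zeta> ^ a i))" by (simp add: Gal_sum[OF s(1)] L_power zeta_in_L)
  also have "\<dots> = (\<Sum>i<d. \<zeta> ^ (a i * m))"
    by (simp add: Gal_power[OF s(1)] zeta_in_L s(2) power_mult[symmetric] mult.commute)
  also have "\<dots> = \<chi> (g [^] m)" by (rule spec[OF e, symmetric])
  finally show ?thesis .
qed

text \<open>
  The left action on characters; the right action of the theorem is by the inverse automorphism.
\<close>
definition gal_char :: "(complex \<Rightarrow> complex) \<Rightarrow> ('a \<Rightarrow> complex) \<Rightarrow> ('a \<Rightarrow> complex)" where
  "gal_char \<sigma> \<chi> = (\<lambda>g\<in>carrier G. \<sigma> (\<chi> g))"

lemma gal_char_apply [simp]: "g \<in> carrier G \<Longrightarrow> gal_char \<sigma> \<chi> g = \<sigma> (\<chi> g)"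
  by (simp add: gal_char_def)

lemma Gal_of_nat: "\<sigma> \<in> carrier Gal \<Longrightarrow> \<sigma> (of_nat k) = of_nat k"
  by (intro Gal_Rats) auto

text \<open>
  The properties in \<open>char_like\<close> are equations with rational coefficients between the values.
\<close>
lemma gal_char_Irr:
  assumes s: "\<sigma> \<in> carrier Gal" and \<chi>: "\<chi> \<in> Irr G"
  shows "gal_char \<sigma> \<chi> \<in> Irr G"
proof (rule char_like_Irr)
  have cl: "class_fun \<chi>" "char_equation \<chi>" "(\<Sum>g\<in>carrier G. \<chi> g * \<chi> (inv g)) = of_nat cardG"
    using Irr_char_like[OF \<chi>] unfolding char_like_def by auto
  obtain d :: nat where d: "d > 0" "\<chi> \<one> = of_nat d" using Irr_degree[OF \<chi>] by blast
  note v = Irr_L[OF \<chi>]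
  have "class_fun (gal_char \<sigma> \<chi>)" using cl(1) unfolding class_fun_def by simp
  moreover have "gal_char \<sigma> \<chi> \<one> = of_nat d" using d by (simp add: Gal_of_nat[OF s])
  moreover have "char_equation (gal_char \<sigma> \<chi>)"
    unfolding char_equation_def
  proof (intro ballI)
    fix a b assume ab: "a \<in> carrier G" "b \<in> carrier G"
    have N: "of_nat cardG \<in> L" by (intro Rats_sub_cyclotomic) simp
    have "gal_char \<sigma> \<chi> \<one> * (\<Sum>t\<in>carrier G. gal_char \<sigma> \<chi> (a \<otimes> t \<otimes> b \<otimes> inv t))
        = \<sigma> (\<chi> \<one> * (\<Sum>t\<in>carrier G. \<chi> (a \<otimes> t \<otimes> b \<otimes> inv t)))"
      using ab v by (simp add: Gal_times[OF s] Gal_sum[OF s] L_sum)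
    also have "\<dots> = \<sigma> (of_nat cardG * \<chi> a * \<chi> b)" using cl(2) ab unfolding char_equation_def by simp
    also have "\<dots> = of_nat cardG * gal_char \<sigma> \<chi> a * gal_char \<sigma> \<chi> b"
      using ab v N by (simp add: Gal_times[OF s] L_mult Gal_of_nat[OF s])
    finally show "gal_char \<sigma> \<chi> \<one> * (\<Sum>t\<in>carrier G. gal_char \<sigma> \<chi> (a \<otimes> t \<otimes> b \<otimes> inv t))
        = of_nat cardG * gal_char \<sigma> \<chi> a * gal_char \<sigma> \<chi> b" .
  qed
  moreover have "(\<Sum>g\<in>carrier G. gal_char \<sigma> \<chi> g * gal_char \<sigma> \<chi> (inv g)) = of_nat cardG"
  proof -
    have "(\<Sum>g\<in>carrier G. gal_char \<sigma> \<chi> g * gal_char \<sigma> \<chi> (inv g)) = \<sigma> (\<Sum>g\<in>carrier G. \<chi> g * \<chi> (inv g))"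
      using v by (simp add: Gal_sum[OF s] Gal_times[OF s] L_mult)
    then show ?thesis unfolding cl(3) by (simp add: Gal_of_nat[OF s])
  qed
  ultimately show "char_like (gal_char \<sigma> \<chi>)" unfolding char_like_def using d(1) by blast
qed (simp add: gal_char_def)

lemma gal_char_mult:
  assumes "\<sigma> \<in> carrier Gal" "\<tau> \<in> carrier Gal" "\<chi> \<in> Irr G"
  shows "gal_char (\<sigma> \<otimes>\<^bsub>Gal\<^esub> \<tau>) \<chi> = gal_char \<sigma> (gal_char \<tau> \<chi>)"
  unfolding gal_char_def using assms by (auto simp: Gal_mult Irr_L restrict_def)

lemma gal_char_one: "\<chi> \<in> Irr G \<Longrightarrow> gal_char \<one>\<^bsub>Gal\<^esub> \<chi> = \<chi>"
  by (rule extensionalityI[OF _ Irr_extensional]) (auto simp: gal_char_def Gal_one Irr_L)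

lemma gal_char_bij: "\<sigma> \<in> carrier Gal \<Longrightarrow> bij_betw (gal_char \<sigma>) (Irr G) (Irr G)"
proof -
  assume s: "\<sigma> \<in> carrier Gal"
  interpret Ga: group Gal by (rule Gal_group)
  have i: "inv\<^bsub>Gal\<^esub> \<sigma> \<in> carrier Gal" using s by simp
  show ?thesis
    by (rule bij_betw_byWitness[where f' = "gal_char (inv\<^bsub>Gal\<^esub> \<sigma>)"])
       (use s i gal_char_Irr in \<open>auto simp: gal_char_mult[symmetric] gal_char_one\<close>)
qed

section \<open>Central units built from characters\<close>

text \<open>
  The coefficients of the central element \<open>\<Sum> U(\<psi>) e\<^sub>\<psi>\<close> of the complex group algebra, where
  \<open>e\<^sub>\<psi>\<close> are the primitive central idempotents: it acts on the representation with character \<open>\<psi>\<close> by the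
  scalar \<open>U(\<psi>)\<close>.
\<close>
definition central_elem :: "(('a \<Rightarrow> complex) \<Rightarrow> complex) \<Rightarrow> 'a \<Rightarrow> complex" where
  "central_elem U g = (\<Sum>\<psi>\<in>Irr G. \<psi> \<one> * \<psi> (inv g) * U \<psi>) / of_nat cardG"

lemma central_elem_class_fun: "class_fun (central_elem U)"
  unfolding class_fun_def
proof (intro ballI)
  fix g x assume gx: "g \<in> carrier G" "x \<in> carrier G"
  have "\<psi> (inv (g \<otimes> x \<otimes> inv g)) = \<psi> (inv x)" if "\<psi> \<in> Irr G" for \<psi>
    using Irr_char_like[OF that] class_fun_conj_inv[OF _ gx] unfolding char_like_def by blast
  then show "central_elem U (g \<otimes> x \<otimes> inv g) = central_elem U x"
    unfolding central_elem_def by (intro arg_cong2[where f = "(/)"] sum.cong refl) simp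
qed

text \<open>
  Multiplication in the centre is componentwise: \<open>e\<^sub>\<psi> e\<^sub>\<phi>\<close> is \<open>e\<^sub>\<psi>\<close> or \<open>0\<close>.
\<close>
lemma central_elem_convolution:
  assumes x: "x \<in> carrier G"
  shows "(\<Sum>y\<in>carrier G. central_elem U y * central_elem V (inv y \<otimes> x)) = central_elem (\<lambda>\<psi>. U \<psi> * V \<psi>) x"
proof -
  define N where "N = (of_nat cardG :: complex)"
  have N: "N \<noteq> 0" unfolding N_def using cardG_pos by simp
  have inner: "\<phi> \<one> * (\<Sum>y\<in>carrier G. \<phi> (inv x \<otimes> y) * \<psi> (inv y)) = (if \<phi> = \<psi> then N * \<psi> (inv x) else 0)"
    if "\<phi> \<in> Irr G" "\<psi> \<in> Irr G" for \<phi> \<psi>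
    using char_convolution[of \<phi> \<psi> "inv x"] Irr_char_like[OF that(1)] Irr_char_like[OF that(2)] x
      Irr_orthogonal[OF that] unfolding char_like_def N_def by auto
  have "(\<Sum>y\<in>carrier G. central_elem U y * central_elem V (inv y \<otimes> x))
      = (\<Sum>y\<in>carrier G. (\<Sum>\<psi>\<in>Irr G. \<Sum>\<phi>\<in>Irr G. \<psi> \<one> * U \<psi> * V \<phi> * (\<phi> \<one> * (\<phi> (inv x \<otimes> y) * \<psi> (inv y)))) / (N * N))"
  proof (rule sum.cong[OF refl])
    fix y assume y: "y \<in> carrier G"
    have "inv (inv y \<otimes> x) = inv x \<otimes> y" using x y by (simp add: inv_mult_group)
    then have "central_elem U y * central_elem V (inv y \<otimes> x)
      = (\<Sum>\<psi>\<in>Irr G. \<Sum>\<phi>\<in>Irr G. (\<psi> \<one> * \<psi> (inv y) * U \<psi>) * (\<phi> \<one> * \<phi> (inv x \<otimes> y) * V \<phi>)) / (N * N)"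
      unfolding central_elem_def N_def by (simp only: times_divide_times_eq sum_product)
    also have "(\<Sum>\<psi>\<in>Irr G. \<Sum>\<phi>\<in>Irr G. (\<psi> \<one> * \<psi> (inv y) * U \<psi>) * (\<phi> \<one> * \<phi> (inv x \<otimes> y) * V \<phi>))
      = (\<Sum>\<psi>\<in>Irr G. \<Sum>\<phi>\<in>Irr G. \<psi> \<one> * U \<psi> * V \<phi> * (\<phi> \<one> * (\<phi> (inv x \<otimes> y) * \<psi> (inv y))))"
      by (rule sum.cong[OF refl], rule sum.cong[OF refl]) (simp only: mult_ac)
    finally show "central_elem U y * central_elem V (inv y \<otimes> x)
      = (\<Sum>\<psi>\<in>Irr G. \<Sum>\<phi>\<in>Irr G. \<psi> \<one> * U \<psi> * V \<phi> * (\<phi> \<one> * (\<phi> (inv x \<otimes> y) * \<psi> (inv y)))) / (N * N)" .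
  qed
  also have "\<dots> = (\<Sum>y\<in>carrier G. \<Sum>\<psi>\<in>Irr G. \<Sum>\<phi>\<in>Irr G. \<psi> \<one> * U \<psi> * V \<phi> * (\<phi> \<one> * (\<phi> (inv x \<otimes> y) * \<psi> (inv y)))) / (N * N)"
    by (rule sum_divide_distrib[symmetric])
  also have "(\<Sum>y\<in>carrier G. \<Sum>\<psi>\<in>Irr G. \<Sum>\<phi>\<in>Irr G. \<psi> \<one> * U \<psi> * V \<phi> * (\<phi> \<one> * (\<phi> (inv x \<otimes> y) * \<psi> (inv y))))
      = (\<Sum>\<psi>\<in>Irr G. \<Sum>y\<in>carrier G. \<Sum>\<phi>\<in>Irr G. \<psi> \<one> * U \<psi> * V \<phi> * (\<phi> \<one> * (\<phi> (inv x \<otimes> y) * \<psi> (inv y))))"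
    by (rule sum.swap)
  also have "\<dots> = (\<Sum>\<psi>\<in>Irr G. \<Sum>\<phi>\<in>Irr G. \<Sum>y\<in>carrier G. \<psi> \<one> * U \<psi> * V \<phi> * (\<phi> \<one> * (\<phi> (inv x \<otimes> y) * \<psi> (inv y))))"
    by (rule sum.cong[OF refl], rule sum.swap)
  also have "\<dots> = (\<Sum>\<psi>\<in>Irr G. \<Sum>\<phi>\<in>Irr G. \<psi> \<one> * U \<psi> * V \<phi> * (\<phi> \<one> * (\<Sum>y\<in>carrier G. \<phi> (inv x \<otimes> y) * \<psi> (inv y))))"
    by (simp only: sum_distrib_left)
  also have "\<dots> = (\<Sum>\<psi>\<in>Irr G. \<Sum>\<phi>\<in>Irr G. if \<phi> = \<psi> then \<psi> \<one> * U \<psi> * V \<psi> * (N * \<psi> (inv x)) else 0)"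
    by (intro sum.cong refl) (simp add: inner)
  also have "\<dots> = N * (\<Sum>\<psi>\<in>Irr G. \<psi> \<one> * \<psi> (inv x) * (U \<psi> * V \<psi>))"
    using finite_Irr by (simp add: sum_distrib_left mult_ac)
  finally show ?thesis unfolding central_elem_def N_def[symmetric] using N by simp
qed

lemma central_elem_one:
  assumes g: "g \<in> carrier G"
  shows "central_elem (\<lambda>_. 1) g = (if g = \<one> then 1 else 0)"
proof -
  have "{t \<in> carrier G. t \<otimes> \<one> \<otimes> inv t = g} = (if g = \<one> then carrier G else {})" by auto
  then have "(\<Sum>\<psi>\<in>Irr G. \<psi> \<one> * \<psi> (inv g)) = (if g = \<one> then of_nat cardG else 0)"
    using Irr_column_orthogonal[OF one_closed g] by simp
  then show ?thesis unfolding central_elem_def using cardG_pos by simp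
qed

text \<open>
  The trace of the central element on the representation with character \<open>\<chi>\<close>.
\<close>
lemma central_elem_character:
  assumes \<chi>: "\<chi> \<in> Irr G"
  shows "(\<Sum>g\<in>carrier G. central_elem U g * \<chi> g) = \<chi> \<one> * U \<chi>"
proof -
  have "(\<Sum>g\<in>carrier G. central_elem U g * \<chi> g)
      = (\<Sum>g\<in>carrier G. \<Sum>\<psi>\<in>Irr G. \<psi> \<one> * U \<psi> * (\<chi> g * \<psi> (inv g))) / of_nat cardG"
    unfolding central_elem_def sum_divide_distrib sum_distrib_right
    by (intro sum.cong refl) (simp add: mult_ac)
  also have "(\<Sum>g\<in>carrier G. \<Sum>\<psi>\<in>Irr G. \<psi> \<one> * U \<psi> * (\<chi> g * \<psi> (inv g)))
      = (\<Sum>\<psi>\<in>Irr G. \<psi> \<one> * U \<psi> * (\<Sum>g\<in>carrier G. \<chi> g * \<psi> (inv g)))"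
    by (subst sum.swap) (simp add: sum_distrib_left)
  also have "\<dots> = (\<Sum>\<psi>\<in>Irr G. if \<psi> = \<chi> then \<chi> \<one> * U \<chi> * of_nat cardG else 0)"
    using \<chi> by (intro sum.cong refl) (auto simp: Irr_orthogonal)
  also have "\<dots> = \<chi> \<one> * U \<chi> * of_nat cardG" using \<chi> finite_Irr by simp
  finally show ?thesis using cardG_pos by simp
qed

text \<open>
  The factor \<open>\<bar>G\<bar>\<close> cancels the denominator in \<open>central_elem\<close>, so that the coefficients lie in
  \<open>\<int>[\<zeta>]\<close>; Galois equivariance of \<open>w\<close> makes them fixed, hence integers.
\<close>
lemma central_elem_integral:
  assumes w: "\<And>\<psi>. \<psi> \<in> Irr G \<Longrightarrow> w \<psi> \<in> int_adjoin \<zeta>"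
    and equiv: "\<And>\<sigma> \<psi>. \<sigma> \<in> carrier Gal \<Longrightarrow> \<psi> \<in> Irr G \<Longrightarrow> \<sigma> (w \<psi>) = w (gal_char \<sigma> \<psi>)"
    and g: "g \<in> carrier G"
  shows "central_elem (\<lambda>\<psi>. 1 + of_nat cardG * w \<psi>) g \<in> \<int>"
proof -
  let ?s = "\<Sum>\<psi>\<in>Irr G. \<psi> \<one> * \<psi> (inv g) * w \<psi>"
  have summand: "\<psi> \<one> * \<psi> (inv g) * w \<psi> \<in> int_adjoin \<zeta>" if "\<psi> \<in> Irr G" for \<psi>
    using Irr_int_adjoin[OF that one_closed] Irr_int_adjoin[OF that inv_closed[OF g]] w[OF that]
    by (intro int_adjoin_mult)
  have "?s \<in> \<int>"
  proof (rule Gal_fixed_integer)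
    show "?s \<in> int_adjoin \<zeta>" by (rule int_adjoin_sum) (rule summand)
    fix \<sigma> assume s: "\<sigma> \<in> carrier Gal"
    have "\<sigma> ?s = (\<Sum>\<psi>\<in>Irr G. \<sigma> (\<psi> \<one> * \<psi> (inv g) * w \<psi>))"
      by (rule Gal_sum[OF s]) (rule int_adjoin_sub_cyclotomic[OF summand])
    also have "\<dots> = (\<Sum>\<psi>\<in>Irr G. (\<lambda>\<psi>. \<psi> \<one> * \<psi> (inv g) * w \<psi>) (gal_char \<sigma> \<psi>))"
    proof (rule sum.cong[OF refl])
      fix \<psi> assume p: "\<psi> \<in> Irr G"
      have "\<psi> \<one> \<in> L" "\<psi> (inv g) \<in> L" "w \<psi> \<in> L"
        using Irr_L[OF p] g int_adjoin_sub_cyclotomic[OF w[OF p]] by auto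
      then show "\<sigma> (\<psi> \<one> * \<psi> (inv g) * w \<psi>) = (\<lambda>\<psi>. \<psi> \<one> * \<psi> (inv g) * w \<psi>) (gal_char \<sigma> \<psi>)"
        using g equiv[OF s p] by (simp add: Gal_times[OF s] L_mult)
    qed
    also have "\<dots> = ?s" by (rule sum.reindex_bij_betw[OF gal_char_bij[OF s]])
    finally show "\<sigma> ?s = ?s" .
  qed
  moreover have "central_elem (\<lambda>\<psi>. 1 + of_nat cardG * w \<psi>) g = central_elem (\<lambda>_. 1) g + ?s"
    unfolding central_elem_def using cardG_pos
    by (simp add: distrib_left sum.distrib add_divide_distrib sum_distrib_left[symmetric] mult.left_commute)
  ultimately show ?thesis using central_elem_one[OF g] by simp
qed

text \<open>
  Convolution with a class function commutes with everything.
\<close>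
lemma central_int_unit:
  assumes \<alpha>: "\<alpha> \<in> extensional (carrier G)" "\<beta> \<in> extensional (carrier G)"
    and cl: "class_fun (\<lambda>g. of_int (\<alpha> g))"
    and conv: "\<And>x. x \<in> carrier G \<Longrightarrow> (\<Sum>y\<in>carrier G. \<alpha> y * \<beta> (inv y \<otimes> x)) = (if x = \<one> then 1 else 0)"
      "\<And>x. x \<in> carrier G \<Longrightarrow> (\<Sum>y\<in>carrier G. \<beta> y * \<alpha> (inv y \<otimes> x)) = (if x = \<one> then 1 else 0)"
  shows "\<alpha> \<in> center (units_of (int_group_ring G))"
proof -
  let ?R = "int_group_ring G"
  have mult: "monoid.mult ?R f h = (\<lambda>x\<in>carrier G. \<Sum>y\<in>carrier G. f y * h (inv y \<otimes> x))" for f h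
    unfolding int_group_ring_def by simp
  have one: "one ?R = (\<lambda>x\<in>carrier G. if x = \<one> then 1 else 0)"
    unfolding int_group_ring_def by simp
  have car: "carrier ?R = extensional (carrier G)" unfolding int_group_ring_def by simp
  have shift: "\<alpha> (a \<otimes> b) = \<alpha> (b \<otimes> a)" if "a \<in> carrier G" "b \<in> carrier G" for a b
    using class_fun_shift[OF cl that] by simp
  have "\<alpha> \<in> Units ?R"
    unfolding Units_def
  proof (intro CollectI conjI bexI[of _ \<beta>])
    show "\<alpha> \<in> carrier ?R" "\<beta> \<in> carrier ?R" using \<alpha> car by auto
    show "\<beta> \<otimes>\<^bsub>?R\<^esub> \<alpha> = \<one>\<^bsub>?R\<^esub>" "\<alpha> \<otimes>\<^bsub>?R\<^esub> \<beta> = \<one>\<^bsub>?R\<^esub>"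
      unfolding mult one by (intro restrict_ext conv; assumption)+
  qed
  moreover have "\<alpha> \<otimes>\<^bsub>?R\<^esub> f = f \<otimes>\<^bsub>?R\<^esub> \<alpha>" for f
    unfolding mult
  proof (intro restrict_ext)
    fix x assume x: "x \<in> carrier G"
    have bij: "bij_betw (\<lambda>y. x \<otimes> inv y) (carrier G) (carrier G)"
      using bij_betw_trans[OF bij_inv bij_left[OF x]] by (simp add: comp_def)
    have "(\<Sum>y\<in>carrier G. \<alpha> y * f (inv y \<otimes> x)) = (\<Sum>y\<in>carrier G. \<alpha> (x \<otimes> inv y) * f (inv (x \<otimes> inv y) \<otimes> x))"
      by (rule sum.reindex_bij_betw[OF bij, symmetric])
    also have "\<dots> = (\<Sum>y\<in>carrier G. f y * \<alpha> (inv y \<otimes> x))"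
    proof (rule sum.cong[OF refl])
      fix y assume y: "y \<in> carrier G"
      have "inv (x \<otimes> inv y) \<otimes> x = y" using x y by (simp add: inv_mult_group m_assoc)
      then show "\<alpha> (x \<otimes> inv y) * f (inv (x \<otimes> inv y) \<otimes> x) = f y * \<alpha> (inv y \<otimes> x)"
        using x y shift[of x "inv y"] by simp
    qed
    finally show "(\<Sum>y\<in>carrier G. \<alpha> y * f (inv y \<otimes> x)) = (\<Sum>y\<in>carrier G. f y * \<alpha> (inv y \<otimes> x))" .
  qed
  ultimately show ?thesis unfolding center_def units_of_def by simp
qed

lemma int_group_ring_uminus:
  assumes f: "f \<in> extensional (carrier G)"
  shows "\<ominus>\<^bsub>int_group_ring G\<^esub> f = (\<lambda>x\<in>carrier G. - f x)"
proof -
  let ?R = "int_group_ring G"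
  have "(THE y. y \<in> carrier ?R \<and> f \<oplus>\<^bsub>?R\<^esub> y = \<zero>\<^bsub>?R\<^esub> \<and> y \<oplus>\<^bsub>?R\<^esub> f = \<zero>\<^bsub>?R\<^esub>) = (\<lambda>x\<in>carrier G. - f x)"
  proof (rule the_equality)
    show "(\<lambda>x\<in>carrier G. - f x) \<in> carrier ?R \<and> f \<oplus>\<^bsub>?R\<^esub> (\<lambda>x\<in>carrier G. - f x) = \<zero>\<^bsub>?R\<^esub> \<and>
        (\<lambda>x\<in>carrier G. - f x) \<oplus>\<^bsub>?R\<^esub> f = \<zero>\<^bsub>?R\<^esub>"
      unfolding int_group_ring_def by (auto intro!: restrict_ext)
    fix y assume y: "y \<in> carrier ?R \<and> f \<oplus>\<^bsub>?R\<^esub> y = \<zero>\<^bsub>?R\<^esub> \<and> y \<oplus>\<^bsub>?R\<^esub> f = \<zero>\<^bsub>?R\<^esub>"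
    then have ye: "y \<in> extensional (carrier G)" and
      sum: "(\<lambda>x\<in>carrier G. f x + y x) = (\<lambda>x\<in>carrier G. 0)" unfolding int_group_ring_def by auto
    show "y = (\<lambda>x\<in>carrier G. - f x)"
    proof (rule extensionalityI[OF ye restrict_extensional])
      fix x assume "x \<in> carrier G"
      then show "y x = (\<lambda>x\<in>carrier G. - f x) x" using fun_cong[OF sum, of x] by simp
    qed
  qed
  then show ?thesis unfolding a_inv_def m_inv_def by simp
qed

text \<open>
  If the real number \<open>\<theta> = \<chi>(c) + \<chi>(c\<^sup>-\<^sup>1)\<close> is moved, \<open>real_orbit_unit\<close> applies to its orbit \<open>D\<close>, with
  the order of \<open>G\<close> as the modulus. Put the conjugates of the unit on the Galois orbit \<open>O'\<close> of \<open>\<chi>\<close> and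
  \<open>1\<close> on all other characters. The resulting element \<open>\<alpha> w\<close> is a central unit of the integral group
  ring with inverse \<open>\<alpha> w'\<close>, and it acts on the representation of \<open>\<chi>\<close> by a scalar of absolute value
  less than \<open>1\<close>. But by the cut property it is plus or minus a central group element, whose scalar has
  absolute value \<open>1\<close>.
\<close>
theorem cut_group_real_part_fixed:
  assumes cut: "cut_group G" and \<chi>: "\<chi> \<in> Irr G" and c: "c \<in> carrier G" and \<sigma>: "\<sigma> \<in> carrier Gal"
  shows "\<sigma> (\<chi> c + \<chi> (inv c)) = \<chi> c + \<chi> (inv c)"
proof (rule ccontr)
  assume moved: "\<sigma> (\<chi> c + \<chi> (inv c)) \<noteq> \<chi> c + \<chi> (inv c)"
  interpret Ga: group Gal by (rule Gal_group)
  define \<theta> where "\<theta> = (\<lambda>\<psi>. \<psi> c + \<psi> (inv c) :: complex)"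
  have \<theta>_int: "\<theta> \<psi> \<in> int_adjoin \<zeta>" if "\<psi> \<in> Irr G" for \<psi>
    unfolding \<theta>_def using c that by (intro int_adjoin_add Irr_int_adjoin) auto
  have \<theta>_L: "\<theta> \<psi> \<in> L" if "\<psi> \<in> Irr G" for \<psi> by (rule int_adjoin_sub_cyclotomic[OF \<theta>_int[OF that]])
  have \<theta>_Gal: "\<tau> (\<theta> \<psi>) = \<theta> (gal_char \<tau> \<psi>)" if "\<tau> \<in> carrier Gal" "\<psi> \<in> Irr G" for \<tau> \<psi>
    unfolding \<theta>_def using c that by (simp add: Gal_add Irr_L)
  have \<theta>_real: "Im (\<theta> \<psi>) = 0" if "\<psi> \<in> Irr G" for \<psi>
    unfolding \<theta>_def using Irr_cnj[OF that c] by simp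
  define O' where "O' = (\<lambda>\<tau>. gal_char \<tau> \<chi>) ` carrier Gal"
  define D where "D = \<theta> ` O'"
  have O'_Irr: "\<psi> \<in> Irr G" if "\<psi> \<in> O'" for \<psi> using that gal_char_Irr \<chi> unfolding O'_def by auto
  have O'_stable: "gal_char \<tau> \<psi> \<in> O' \<longleftrightarrow> \<psi> \<in> O'" if t: "\<tau> \<in> carrier Gal" and p: "\<psi> \<in> Irr G" for \<tau> \<psi>
  proof
    assume "\<psi> \<in> O'"
    then obtain \<upsilon> where "\<upsilon> \<in> carrier Gal" "\<psi> = gal_char \<upsilon> \<chi>" unfolding O'_def by blast
    then show "gal_char \<tau> \<psi> \<in> O'" unfolding O'_def using t \<chi> by (auto simp: gal_char_mult[symmetric])
  next
    assume "gal_char \<tau> \<psi> \<in> O'"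
    then obtain \<upsilon> where u: "\<upsilon> \<in> carrier Gal" "gal_char \<tau> \<psi> = gal_char \<upsilon> \<chi>" unfolding O'_def by blast
    have "\<psi> = gal_char (inv\<^bsub>Gal\<^esub> \<tau> \<otimes>\<^bsub>Gal\<^esub> \<tau>) \<psi>" using t p by (simp add: gal_char_one)
    also have "\<dots> = gal_char (inv\<^bsub>Gal\<^esub> \<tau>) (gal_char \<upsilon> \<chi>)" using t p u(2) by (subst gal_char_mult) auto
    also have "\<dots> = gal_char (inv\<^bsub>Gal\<^esub> \<tau> \<otimes>\<^bsub>Gal\<^esub> \<upsilon>) \<chi>" using t u(1) \<chi> by (subst gal_char_mult) auto
    finally show "\<psi> \<in> O'" unfolding O'_def using t u(1) by blast
  qed
  have \<chi>O: "\<chi> \<in> O'" unfolding O'_def using gal_char_one[OF \<chi>] Ga.one_closed by force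
  have D: "finite D" "D \<subseteq> int_adjoin \<zeta>" "\<And>x. x \<in> D \<Longrightarrow> Im x = 0"
    unfolding D_def using finite_Gal \<theta>_int \<theta>_real O'_Irr by (auto simp: O'_def)
  have "card D \<ge> 2"
  proof -
    have "\<theta> (gal_char \<sigma> \<chi>) \<noteq> \<theta> \<chi>" using moved \<theta>_Gal[OF \<sigma> \<chi>] unfolding \<theta>_def by simp
    moreover have "{\<theta> (gal_char \<sigma> \<chi>), \<theta> \<chi>} \<subseteq> D" unfolding D_def using \<chi>O O'_stable[OF \<sigma> \<chi>] by auto
    ultimately show ?thesis using card_mono[OF D(1), of "{\<theta> (gal_char \<sigma> \<chi>), \<theta> \<chi>}"] by simp
  qed
  moreover have stable: "\<tau> ` D = D" if t: "\<tau> \<in> carrier Gal" for \<tau>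
  proof (rule card_subset_eq[OF D(1)])
    show "\<tau> ` D \<subseteq> D"
    proof safe
      fix x assume "x \<in> D"
      then obtain \<psi> where "\<psi> \<in> O'" "x = \<theta> \<psi>" unfolding D_def by blast
      then show "\<tau> x \<in> D" unfolding D_def using \<theta>_Gal[OF t O'_Irr] O'_stable[OF t O'_Irr] by auto
    qed
    have "inj_on \<tau> D" using D(2) int_adjoin_sub_cyclotomic by (intro inj_onI) (auto simp: Gal_inj[OF t] subset_iff)
    then show "card (\<tau> ` D) = card D" by (rule card_image)
  qed
  moreover have trans: "\<exists>\<tau>\<in>carrier Gal. \<tau> x = y" if "x \<in> D" "y \<in> D" for x y
  proof -
    have mem: "\<exists>s\<in>carrier Gal. x = s (\<theta> \<chi>)" if "x \<in> D" for x
      using that \<theta>_Gal[OF _ \<chi>] unfolding D_def O'_def by auto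
    obtain s where s: "s \<in> carrier Gal" and x: "x = s (\<theta> \<chi>)" using mem[OF \<open>x \<in> D\<close>] by (elim bexE)
    obtain t where t: "t \<in> carrier Gal" and y: "y = t (\<theta> \<chi>)" using mem[OF \<open>y \<in> D\<close>] by (elim bexE)
    have "(t \<otimes>\<^bsub>Gal\<^esub> inv\<^bsub>Gal\<^esub> s) x = y"
      unfolding x y using s t \<theta>_L[OF \<chi>] by (simp add: Gal_mult Gal_closed Gal_inv)
    moreover have "t \<otimes>\<^bsub>Gal\<^esub> inv\<^bsub>Gal\<^esub> s \<in> carrier Gal" using s t by simp
    ultimately show ?thesis by (rule bexI)
  qed
  moreover have "\<theta> \<chi> \<in> D" unfolding D_def using \<chi>O by blast
  moreover have "int cardG > 0" using cardG_pos by simp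
  ultimately have unit: "\<exists>w w'. (\<forall>x\<in>D. w x \<in> int_adjoin \<zeta> \<and> w' x \<in> int_adjoin \<zeta>) \<and>
    (\<forall>\<sigma>\<in>carrier Gal. \<forall>x\<in>D. \<sigma> (w x) = w (\<sigma> x) \<and> \<sigma> (w' x) = w' (\<sigma> x)) \<and>
    (\<forall>x\<in>D. (1 + of_int (int cardG) * w x) * (1 + of_int (int cardG) * w' x) = 1) \<and>
    norm (1 + of_int (int cardG) * w (\<theta> \<chi>)) < 1"
    by (intro real_orbit_unit D)
  then obtain w w' where
    w: "\<And>x. x \<in> D \<Longrightarrow> w x \<in> int_adjoin \<zeta>" "\<And>x. x \<in> D \<Longrightarrow> w' x \<in> int_adjoin \<zeta>"
    "\<And>\<sigma> x. \<sigma> \<in> carrier Gal \<Longrightarrow> x \<in> D \<Longrightarrow> \<sigma> (w x) = w (\<sigma> x)"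
    "\<And>\<sigma> x. \<sigma> \<in> carrier Gal \<Longrightarrow> x \<in> D \<Longrightarrow> \<sigma> (w' x) = w' (\<sigma> x)"
    "\<And>x. x \<in> D \<Longrightarrow> (1 + of_int (int cardG) * w x) * (1 + of_int (int cardG) * w' x) = 1"
    "norm (1 + of_int (int cardG) * w (\<theta> \<chi>)) < 1"
    by blast
  \<comment> \<open>Off the orbit \<open>w\<close> is continued by \<open>0\<close>, which gives the scalar \<open>U = 1\<close>.\<close>
  define ext where "ext = (\<lambda>v \<psi>. if \<psi> \<in> O' then v (\<theta> \<psi>) else (0::complex))"
  define U where "U = (\<lambda>v \<psi>. 1 + of_nat cardG * ext v \<psi>)"
  have zero_int: "0 \<in> int_adjoin \<zeta>" using int_adjoin_of_int[of 0 \<zeta>] by simp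
  have integral: "central_elem (U v) g \<in> \<int>"
    if v: "\<And>x. x \<in> D \<Longrightarrow> v x \<in> int_adjoin \<zeta>" "\<And>\<sigma> x. \<sigma> \<in> carrier Gal \<Longrightarrow> x \<in> D \<Longrightarrow> \<sigma> (v x) = v (\<sigma> x)"
      and g: "g \<in> carrier G" for v g
    unfolding U_def
  proof (rule central_elem_integral[OF _ _ g])
    show "ext v \<psi> \<in> int_adjoin \<zeta>" if "\<psi> \<in> Irr G" for \<psi>
      unfolding ext_def using v(1) zero_int by (auto simp: D_def)
    show "\<tau> (ext v \<psi>) = ext v (gal_char \<tau> \<psi>)" if t: "\<tau> \<in> carrier Gal" and p: "\<psi> \<in> Irr G" for \<tau> \<psi>
      unfolding ext_def using O'_stable[OF t p] v(2)[OF t, of "\<theta> \<psi>"] \<theta>_Gal[OF t p] Gal_Rats[OF t, of 0]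
      by (auto simp: D_def)
  qed
  \<comment> \<open>The coefficients are integers by \<open>integral\<close>; the floor of the real part only changes their type.\<close>
  define \<alpha> where "\<alpha> = (\<lambda>v. \<lambda>g\<in>carrier G. \<lfloor>Re (central_elem (U v) g)\<rfloor>)"
  have \<alpha>: "of_int (\<alpha> v g) = central_elem (U v) g"
    if "\<And>x. x \<in> D \<Longrightarrow> v x \<in> int_adjoin \<zeta>" "\<And>\<sigma> x. \<sigma> \<in> carrier Gal \<Longrightarrow> x \<in> D \<Longrightarrow> \<sigma> (v x) = v (\<sigma> x)"
      and g: "g \<in> carrier G" for v g
    using integral[OF that] g unfolding \<alpha>_def by (auto elim!: Ints_cases)
  note \<alpha>w = \<alpha>[OF w(1,3)] and \<alpha>w' = \<alpha>[OF w(2,4)]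
  have UU: "U w \<psi> * U w' \<psi> = 1" for \<psi>
    using w(5)[of "\<theta> \<psi>"] unfolding U_def ext_def D_def by auto
  have "\<alpha> w \<in> center (units_of (int_group_ring G))"
  proof (rule central_int_unit[where \<beta> = "\<alpha> w'"])
    show "\<alpha> w \<in> extensional (carrier G)" "\<alpha> w' \<in> extensional (carrier G)" unfolding \<alpha>_def by auto
    show "class_fun (\<lambda>g. of_int (\<alpha> w g))"
      using central_elem_class_fun[of "U w"] unfolding class_fun_def by (simp add: \<alpha>w)
    fix x assume x: "x \<in> carrier G"
    have "(of_int (\<Sum>y\<in>carrier G. \<alpha> w y * \<alpha> w' (inv y \<otimes> x)) :: complex) = of_int (if x = \<one> then 1 else 0)"
      using x by (simp add: \<alpha>w \<alpha>w' central_elem_convolution UU central_elem_one)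
    then show "(\<Sum>y\<in>carrier G. \<alpha> w y * \<alpha> w' (inv y \<otimes> x)) = (if x = \<one> then 1 else 0)"
      by (simp only: of_int_eq_iff)
    have "U w' \<psi> * U w \<psi> = 1" for \<psi> using UU[of \<psi>] by (simp add: mult.commute)
    then have "(of_int (\<Sum>y\<in>carrier G. \<alpha> w' y * \<alpha> w (inv y \<otimes> x)) :: complex) = of_int (if x = \<one> then 1 else 0)"
      using x by (simp add: \<alpha>w \<alpha>w' central_elem_convolution central_elem_one)
    then show "(\<Sum>y\<in>carrier G. \<alpha> w' y * \<alpha> w (inv y \<otimes> x)) = (if x = \<one> then 1 else 0)"
      by (simp only: of_int_eq_iff)
  qed
  then obtain z where z: "z \<in> center G"
    "\<alpha> w = group_ring_elem G z \<or> \<alpha> w = \<ominus>\<^bsub>int_group_ring G\<^esub> group_ring_elem G z"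
    using cut unfolding cut_group_def by auto
  have zG: "z \<in> carrier G" using z(1) unfolding center_def by blast
  have gre: "group_ring_elem G z \<in> extensional (carrier G)" unfolding group_ring_elem_def by simp
  have pm: "(\<forall>g\<in>carrier G. \<alpha> w g = (if g = z then 1 else 0)) \<or> (\<forall>g\<in>carrier G. \<alpha> w g = - (if g = z then 1 else 0))"
    using z(2) unfolding int_group_ring_uminus[OF gre] by (auto simp: group_ring_elem_def)
  have "\<chi> \<one> * U w \<chi> = (\<Sum>g\<in>carrier G. of_int (\<alpha> w g) * \<chi> g)"
    by (simp add: \<alpha>w central_elem_character[OF \<chi>])
  also have "\<dots> = \<chi> z \<or> \<dots> = - \<chi> z"
    using pm
  proof
    assume "\<forall>g\<in>carrier G. \<alpha> w g = (if g = z then 1 else 0)"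
    then have "(\<Sum>g\<in>carrier G. of_int (\<alpha> w g) * \<chi> g) = (\<Sum>g\<in>carrier G. if g = z then \<chi> g else 0)"
      by (intro sum.cong refl) auto
    then show ?thesis using zG by simp
  next
    assume "\<forall>g\<in>carrier G. \<alpha> w g = - (if g = z then 1 else 0)"
    then have "(\<Sum>g\<in>carrier G. of_int (\<alpha> w g) * \<chi> g) = (\<Sum>g\<in>carrier G. if g = z then - \<chi> g else 0)"
      by (intro sum.cong refl) auto
    then show ?thesis using zG by simp
  qed
  finally have norm_eq: "norm (\<chi> \<one>) * norm (U w \<chi>) = norm (\<chi> z)"
    by (metis norm_minus_cancel norm_mult)
  have "norm (\<chi> z) = norm (\<chi> \<one>)"
  proof -
    \<comment> \<open>The functional equation for \<open>z\<close> and \<open>z\<^sup>-\<^sup>1\<close>, with \<open>z\<close> central, says \<open>\<chi>(1)\<^sup>2 = \<chi>(z) \<chi>(z\<^sup>-\<^sup>1)\<close>.\<close>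
    have zc: "z \<otimes> t \<otimes> inv z \<otimes> inv t = \<one>" if t: "t \<in> carrier G" for t
    proof -
      have "z \<otimes> t = t \<otimes> z" using z(1) t unfolding center_def by blast
      then show ?thesis using zG t by (simp add: m_assoc)
    qed
    have "\<chi> \<one> * (\<Sum>t\<in>carrier G. \<chi> (z \<otimes> t \<otimes> inv z \<otimes> inv t)) = of_nat cardG * \<chi> z * \<chi> (inv z)"
      using Irr_char_like[OF \<chi>] zG unfolding char_like_def char_equation_def by blast
    then have "of_nat cardG * (\<chi> \<one> * \<chi> \<one>) = of_nat cardG * (\<chi> z * cnj (\<chi> z))"
      using Irr_cnj[OF \<chi> zG] by (simp add: zc mult_ac)
    then have "\<chi> \<one> * \<chi> \<one> = \<chi> z * cnj (\<chi> z)" using cardG_pos by simp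
    then have "norm (\<chi> \<one>) * norm (\<chi> \<one>) = norm (\<chi> z) * norm (\<chi> z)" by (metis norm_mult complex_mod_cnj)
    then show ?thesis by (metis abs_norm_cancel real_sqrt_abs2)
  qed
  moreover have "norm (\<chi> \<one>) > 0" using Irr_degree[OF \<chi>] by (metis norm_of_nat of_nat_0_less_iff)
  ultimately have "norm (U w \<chi>) = 1" using norm_eq by simp
  moreover have "norm (U w \<chi>) < 1" using w(6) \<chi>O unfolding U_def ext_def by simp
  ultimately show False by simp
qed

end


section \<open>Actions with orbits of length at most two\<close>

text \<open>
  Match one orbit \<open>{a, s a}\<close> with one orbit \<open>{b, t b}\<close> and continue with the rest.
\<close>
lemma involution_bijection:
  assumes "finite A" "finite B" "card A = card B"
    and s: "\<And>a. a \<in> A \<Longrightarrow> s a \<in> A \<and> s (s a) = a \<and> s a \<noteq> a"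
    and t: "\<And>b. b \<in> B \<Longrightarrow> t b \<in> B \<and> t (t b) = b \<and> t b \<noteq> b"
  shows "\<exists>f. bij_betw f A B \<and> (\<forall>a\<in>A. f (s a) = t (f a))"
  using assms
proof (induction "card A" arbitrary: A B rule: less_induct)
  case less
  show ?case
  proof (cases "A = {}")
    case True
    then have "B = {}" using less.prems by simp
    then show ?thesis using True by (simp add: bij_betw_def)
  next
    case False
    then obtain a where a: "a \<in> A" by blast
    have "card A \<noteq> 0" using False less.prems(1) by simp
    then have "card B \<noteq> 0" using less.prems(3) by simp
    then obtain b where b: "b \<in> B" by fastforce
    note sa = less.prems(4)[OF a] and tb = less.prems(5)[OF b]
    let ?A = "A - {a, s a}" and ?B = "B - {b, t b}"
    have cA: "card ?A = card A - 2" and cB: "card ?B = card B - 2"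
    proof -
      have "a \<noteq> s a" "b \<noteq> t b" using sa tb by metis+
      then have "card {a, s a} = 2" "card {b, t b} = 2" by simp_all
      then show "card ?A = card A - 2" "card ?B = card B - 2"
        using sa tb a b by (simp_all add: card_Diff_subset)
    qed
    have "card A > 0" using a less.prems(1) by (auto simp: card_gt_0_iff)
    then have small: "card ?A < card A" using cA by simp
    have sA: "s x \<in> ?A \<and> s (s x) = x \<and> s x \<noteq> x" if "x \<in> ?A" for x
      using less.prems(4)[of x] that sa by auto
    have tB: "t y \<in> ?B \<and> t (t y) = y \<and> t y \<noteq> y" if "y \<in> ?B" for y
      using less.prems(5)[of y] that tb by auto
    have "\<exists>f. bij_betw f ?A ?B \<and> (\<forall>x\<in>?A. f (s x) = t (f x))"
      by (rule less.hyps[OF small]) (use less.prems cA cB sA tB in auto)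
    then obtain f where f: "bij_betw f ?A ?B" "\<forall>x\<in>?A. f (s x) = t (f x)" by (elim exE conjE)
    define g where "g = (\<lambda>x. if x = a then b else if x = s a then t b else f x)"
    have "bij_betw g ?A ?B" using f(1) by (rule bij_betw_cong[THEN iffD1, rotated]) (auto simp: g_def)
    moreover have "bij_betw g {a, s a} {b, t b}" using sa tb by (auto simp: bij_betw_def g_def)
    moreover have "?A \<union> {a, s a} = A" "?B \<union> {b, t b} = B" using sa tb a b by auto
    ultimately have "bij_betw g A B" using bij_betw_combine[of g ?A ?B "{a, s a}" "{b, t b}"] by auto
    moreover have "g (s x) = t (g x)" if x: "x \<in> A" for x
    proof -
      consider "x = a" | "x = s a" | "x \<in> ?A" using x by blast
      then show ?thesis
      proof cases
        case 1 then show ?thesis using sa by (simp add: g_def)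
      next
        case 2 then show ?thesis using sa tb by (simp add: g_def)
      next
        case 3
        then have "s x \<noteq> a" "s x \<noteq> s a" "x \<noteq> a" "x \<noteq> s a" using sA[OF 3] by auto
        then show ?thesis using f(2) 3 by (simp add: g_def)
      qed
    qed
    ultimately show ?thesis by blast
  qed
qed

text \<open>
  \<open>H\<close> is the kernel of a sign character of \<open>\<Gamma>\<close> with value \<open>- 1\<close> at \<open>c\<close>.
\<close>
definition half_of :: "('g, 'b) monoid_scheme \<Rightarrow> 'g \<Rightarrow> 'g set \<Rightarrow> bool" where
  "half_of \<Gamma> c H \<longleftrightarrow> H \<subseteq> carrier \<Gamma> \<and> c \<notin> H \<and>
     (\<forall>g\<in>carrier \<Gamma>. \<forall>k\<in>carrier \<Gamma>. g \<otimes>\<^bsub>\<Gamma>\<^esub> k \<in> H \<longleftrightarrow> (g \<in> H \<longleftrightarrow> k \<in> H))"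

text \<open>
  Orthogonality of sign characters: unless \<open>K = H\<close>, there is an element of \<open>K\<close> outside \<open>H\<close>, and
  multiplication by it exchanges the parts of \<open>K\<close> inside and outside \<open>H\<close>. As both
  kernels avoid \<open>c\<close>, an element \<open>\<tau>\<close> of \<open>H\<close> outside \<open>K\<close> also yields one of \<open>K\<close> outside \<open>H\<close>,
  namely \<open>\<tau> c\<close>.
\<close>
lemma half_of_balance:
  fixes \<Gamma> (structure)
  assumes G: "group \<Gamma>" and fin: "finite (carrier \<Gamma>)" and c: "c \<in> carrier \<Gamma>"
    and H: "half_of \<Gamma> c H" and K: "K = carrier \<Gamma> \<or> half_of \<Gamma> c K"
  shows "(\<Sum>g\<in>K. if g \<in> H then 1 else - 1 :: int) = (if K = H then int (card H) else 0)"
proof -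
  interpret group \<Gamma> by (rule G)
  have Hs: "H \<subseteq> carrier \<Gamma>" "c \<notin> H" "\<And>g k. g \<in> carrier \<Gamma> \<Longrightarrow> k \<in> carrier \<Gamma> \<Longrightarrow> g \<otimes> k \<in> H \<longleftrightarrow> (g \<in> H \<longleftrightarrow> k \<in> H)"
    using H unfolding half_of_def by auto
  have Ks: "K \<subseteq> carrier \<Gamma>" using K unfolding half_of_def by auto
  have finK: "finite K" by (rule finite_subset[OF Ks fin])
  have sum: "(\<Sum>g\<in>K. if g \<in> H then 1 else - 1 :: int) = int (card (K \<inter> H)) - int (card (K - H))"
    using finK by (simp add: sum.If_cases Diff_eq)
  show ?thesis
  proof (cases "K = H")
    case True then show ?thesis by simp
  next
    case False
    have "\<exists>\<tau>\<in>K. \<tau> \<notin> H \<and> (\<forall>k\<in>K. k \<otimes> \<tau> \<in> K)"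
    proof (cases "K = carrier \<Gamma>")
      case True then show ?thesis using c Hs(2) by blast
    next
      case nc: False
      then have Kc: "c \<notin> K" "\<And>g k. g \<in> carrier \<Gamma> \<Longrightarrow> k \<in> carrier \<Gamma> \<Longrightarrow> g \<otimes> k \<in> K \<longleftrightarrow> (g \<in> K \<longleftrightarrow> k \<in> K)"
        using K unfolding half_of_def by auto
      have "\<exists>\<tau>\<in>K. \<tau> \<notin> H"
      proof (cases "\<exists>\<tau>\<in>K. \<tau> \<notin> H")
        case no: False
        then obtain \<tau> where \<tau>: "\<tau> \<in> H" "\<tau> \<notin> K" using \<open>K \<noteq> H\<close> by blast
        have "\<tau> \<otimes> c \<in> K" using Kc \<tau> Hs(1) c by blast
        moreover have "\<tau> \<otimes> c \<notin> H" using \<tau> Hs c by blast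
        ultimately show ?thesis by blast
      qed
      then show ?thesis using Kc(2) Ks by blast
    qed
    then obtain \<tau> where \<tau>: "\<tau> \<in> K" "\<tau> \<notin> H" "\<And>k. k \<in> K \<Longrightarrow> k \<otimes> \<tau> \<in> K" by blast
    have inj: "inj_on (\<lambda>k. k \<otimes> \<tau>) Z" if "Z \<subseteq> K" for Z
      using that Ks \<tau>(1) by (intro inj_onI) (meson r_cancel subsetD)
    have "(\<lambda>k. k \<otimes> \<tau>) ` (K \<inter> H) \<subseteq> K - H" "(\<lambda>k. k \<otimes> \<tau>) ` (K - H) \<subseteq> K \<inter> H"
      using \<tau> Hs(3) Ks by auto
    then have "card (K \<inter> H) \<le> card (K - H)" "card (K - H) \<le> card (K \<inter> H)"
      using card_inj_on_le[OF inj] finK by (meson Diff_subset Int_lower1 finite_Diff finite_Int)+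
    then show ?thesis unfolding sum using False by simp
  qed
qed

text \<open>
  An action whose orbits are all of the form \<open>{x, x\<^sup>c}\<close> for one fixed group element \<open>c\<close>.
\<close>
locale small_orbit_action =
  fixes \<Gamma> :: "('g, 'b) monoid_scheme" (structure) and S :: "'x set" and act :: "'x \<Rightarrow> 'g \<Rightarrow> 'x" and c :: 'g
  assumes action: "right_action \<Gamma> S act" and finite_S: "finite S"
    and finite_group: "finite (carrier \<Gamma>)" and c: "c \<in> carrier \<Gamma>"
    and small: "\<And>x g. x \<in> S \<Longrightarrow> g \<in> carrier \<Gamma> \<Longrightarrow> act x g = x \<or> act x g = act x c"
begin

sublocale group \<Gamma> using action unfolding right_action_def by blast

lemma act_closed: "x \<in> S \<Longrightarrow> g \<in> carrier \<Gamma> \<Longrightarrow> act x g \<in> S"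
  using action unfolding right_action_def by blast

lemma act_one: "x \<in> S \<Longrightarrow> act x \<one> = x"
  using action unfolding right_action_def by blast

lemma act_mult: "x \<in> S \<Longrightarrow> g \<in> carrier \<Gamma> \<Longrightarrow> h \<in> carrier \<Gamma> \<Longrightarrow> act x (g \<otimes> h) = act (act x g) h"
  using action unfolding right_action_def by blast

lemma act_cancel:
  assumes "x \<in> S" "y \<in> S" "g \<in> carrier \<Gamma>" "act x g = act y g" shows "x = y"
proof -
  have "act x (g \<otimes> inv g) = act y (g \<otimes> inv g)" using assms by (simp only: act_mult inv_closed)
  then show ?thesis using assms by (simp add: act_one)
qed

definition stab :: "'x \<Rightarrow> 'g set" where "stab x = {g \<in> carrier \<Gamma>. act x g = x}"

text \<open>
  Whether \<open>g\<close> moves \<open>x\<close> is a sign character, because an orbit has at most two points.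
\<close>
lemma stab_cases:
  assumes x: "x \<in> S"
  shows "stab x = carrier \<Gamma> \<or> half_of \<Gamma> c (stab x)"
proof (cases "act x c = x")
  case True
  then have "stab x = carrier \<Gamma>" unfolding stab_def using small[OF x] by auto
  then show ?thesis ..
next
  case False
  have "half_of \<Gamma> c (stab x)"
    unfolding half_of_def
  proof (intro conjI ballI)
    show "stab x \<subseteq> carrier \<Gamma>" "c \<notin> stab x" unfolding stab_def using False by auto
    fix g k assume g: "g \<in> carrier \<Gamma>" and k: "k \<in> carrier \<Gamma>"
    note gk = act_mult[OF x g k]
    have iff: "h \<in> stab x \<longleftrightarrow> act x h = x" if "h \<in> carrier \<Gamma>" for h unfolding stab_def using that by simp
    have "act x (g \<otimes> k) = x \<longleftrightarrow> (act x g = x \<longleftrightarrow> act x k = x)"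
    proof (cases "act x g = x")
      case True then show ?thesis unfolding gk by simp
    next
      case ng: False
      show ?thesis
      proof (cases "act x k = x")
        case True
        then show ?thesis unfolding gk using ng act_cancel[OF act_closed[OF x g] x k] by metis
      next
        case nk: False
        have "act x g = act x c" "act x k = act x c" using small[OF x] g k ng nk by auto
        moreover have "act x (g \<otimes> k) = x"
        proof (rule ccontr)
          assume "act x (g \<otimes> k) \<noteq> x"
          then have "act x (g \<otimes> k) = act x c" using small[OF x, of "g \<otimes> k"] g k by auto
          then have "act (act x g) k = act x k" using gk \<open>act x k = act x c\<close> by simp
          then have "act x g = x" by (rule act_cancel[OF act_closed[OF x g] x k])
          then show False using ng by simp
        qed
        ultimately show ?thesis using ng nk by simp
      qed
    qed
    then show "g \<otimes> k \<in> stab x \<longleftrightarrow> (g \<in> stab x \<longleftrightarrow> k \<in> stab x)" using g k by (simp add: iff)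
  qed
  then show ?thesis ..
qed

lemma c_moves: "x \<in> S \<Longrightarrow> half_of \<Gamma> c (stab x) \<Longrightarrow> act x c \<noteq> x"
  using c unfolding half_of_def stab_def by auto

lemma stab_c:
  assumes x: "x \<in> S" shows "stab (act x c) = stab x" and "act (act x c) c = x"
proof -
  have "stab (act x c) = stab x \<and> act (act x c) c = x"
  proof (cases "half_of \<Gamma> c (stab x)")
    case True
    then have h: "c \<notin> stab x" "\<And>g k. g \<in> carrier \<Gamma> \<Longrightarrow> k \<in> carrier \<Gamma> \<Longrightarrow> g \<otimes> k \<in> stab x \<longleftrightarrow> (g \<in> stab x \<longleftrightarrow> k \<in> stab x)"
      unfolding half_of_def by auto
    have iff: "g \<in> stab x \<longleftrightarrow> act x g = x" if "g \<in> carrier \<Gamma>" for g unfolding stab_def using that by simp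
    have "act (act x c) g = act x c \<longleftrightarrow> act x g = x" if g: "g \<in> carrier \<Gamma>" for g
    proof (cases "g \<in> stab x")
      case True
      then have "c \<otimes> g \<notin> stab x" using h c g by blast
      then have "act x (c \<otimes> g) = act x c" using small[OF x, of "c \<otimes> g"] c g iff by auto
      then show ?thesis using True act_mult[OF x c g] iff[OF g] by simp
    next
      case False
      then have "c \<otimes> g \<in> stab x" using h c g by blast
      then have "act (act x c) g = x" using act_mult[OF x c g] iff c g by simp
      then show ?thesis using False iff[OF g] iff[OF c] h(1) by metis
    qed
    then have "stab (act x c) = stab x" unfolding stab_def by auto
    moreover have "c \<otimes> c \<in> stab x" using h c by blast
    then have "act (act x c) c = x" using act_mult[OF x c c] iff c by simp
    ultimately show ?thesis ..
  next
    case False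
    then have "stab x = carrier \<Gamma>" using stab_cases[OF x] by blast
    then have "act x c = x" unfolding stab_def using c by blast
    then show ?thesis by simp
  qed
  then show "stab (act x c) = stab x" "act (act x c) c = x" by auto
qed

text \<open>
  Fourier inversion: weigh the fixed points of \<open>g\<close> by the sign character with kernel \<open>H\<close> and sum over
  \<open>g\<close>. A point contributes the sum of the signs over its stabilizer, which vanishes unless the
  stabilizer is \<open>H\<close>.
\<close>
lemma count_stab_half:
  assumes H: "half_of \<Gamma> c H"
  shows "int (card H) * int (card {x \<in> S. stab x = H})
     = (\<Sum>g\<in>carrier \<Gamma>. (if g \<in> H then 1 else - 1) * int (card {x \<in> S. act x g = x}))"
proof -
  have "(\<Sum>g\<in>carrier \<Gamma>. (if g \<in> H then 1 else - 1) * int (card {x \<in> S. act x g = x}))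
      = (\<Sum>g\<in>carrier \<Gamma>. \<Sum>x\<in>S. if act x g = x then (if g \<in> H then 1 else - 1) else 0)"
  proof (rule sum.cong[OF refl])
    fix g
    have "(\<Sum>x\<in>S. if act x g = x then (if g \<in> H then 1 else - 1 :: int) else 0) = (\<Sum>x\<in>{x \<in> S. act x g = x}. if g \<in> H then 1 else - 1)"
      by (rule sum.inter_filter[OF finite_S, symmetric])
    then show "(if g \<in> H then 1 else - 1) * int (card {x \<in> S. act x g = x})
      = (\<Sum>x\<in>S. if act x g = x then (if g \<in> H then 1 else - 1) else 0)" by simp
  qed
  also have "\<dots> = (\<Sum>x\<in>S. \<Sum>g\<in>carrier \<Gamma>. if act x g = x then (if g \<in> H then 1 else - 1) else 0)"
    by (rule sum.swap)
  also have "\<dots> = (\<Sum>x\<in>S. if stab x = H then int (card H) else 0)"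
  proof (rule sum.cong[OF refl])
    fix x assume x: "x \<in> S"
    have "(\<Sum>g\<in>carrier \<Gamma>. if act x g = x then (if g \<in> H then 1 else - 1 :: int) else 0) = (\<Sum>g\<in>stab x. if g \<in> H then 1 else - 1)"
      unfolding stab_def by (rule sum.inter_filter[OF finite_group, symmetric])
    also have "\<dots> = (if stab x = H then int (card H) else 0)"
      by (rule half_of_balance[OF is_group finite_group c H stab_cases[OF x]])
    finally show "(\<Sum>g\<in>carrier \<Gamma>. if act x g = x then (if g \<in> H then 1 else - 1 :: int) else 0)
       = (if stab x = H then int (card H) else 0)" .
  qed
  also have "\<dots> = (\<Sum>x\<in>{x \<in> S. stab x = H}. int (card H))"
    by (rule sum.inter_filter[OF finite_S, symmetric])
  also have "\<dots> = int (card H) * int (card {x \<in> S. stab x = H})" by simp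
  finally show ?thesis by simp
qed

end

text \<open>
  Equal numbers of fixed points give equal numbers of points with each stabilizer: for the full group
  these are the points fixed by \<open>c\<close>, for the other stabilizers see \<open>count_stab_half\<close>. For each
  stabilizer \<open>H\<close> there is a bijection \<open>F H\<close> that commutes with \<open>c\<close>, and gluing them gives the
  isomorphism, because every group element acts on a point trivially or as \<open>c\<close>, and the stabilizer
  tells which.
\<close>
theorem small_orbit_actions_isomorphic:
  assumes S: "small_orbit_action \<Gamma> S actS c" and T: "small_orbit_action \<Gamma> T actT c"
    and fixed: "\<And>g. g \<in> carrier \<Gamma> \<Longrightarrow> card {x \<in> S. actS x g = x} = card {y \<in> T. actT y g = y}"
  shows "\<exists>\<alpha>. bij_betw \<alpha> S T \<and> (\<forall>x\<in>S. \<forall>g\<in>carrier \<Gamma>. \<alpha> (actS x g) = actT (\<alpha> x) g)"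
proof -
  interpret S: small_orbit_action \<Gamma> S actS c by (rule S)
  interpret T: small_orbit_action \<Gamma> T actT c by (rule T)
  define SH where "SH = (\<lambda>H. {x \<in> S. S.stab x = H})"
  define TH where "TH = (\<lambda>H. {y \<in> T. T.stab y = H})"
  have full: "x \<in> SH (carrier \<Gamma>) \<longleftrightarrow> x \<in> S \<and> actS x c = x" for x
    unfolding SH_def using S.stab_cases[of x] S.c S.c_moves[of x] unfolding S.stab_def by auto
  have full': "y \<in> TH (carrier \<Gamma>) \<longleftrightarrow> y \<in> T \<and> actT y c = y" for y
    unfolding TH_def using T.stab_cases[of y] T.c T.c_moves[of y] unfolding T.stab_def by auto
  have eq_card: "card (SH H) = card (TH H)" if H: "H = carrier \<Gamma> \<or> half_of \<Gamma> c H" for H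
  proof (cases "H = carrier \<Gamma>")
    case True
    have "SH H = {x \<in> S. actS x c = x}" "TH H = {y \<in> T. actT y c = y}" using full full' True by auto
    then show ?thesis using fixed[OF S.c] by simp
  next
    case False
    then have h: "half_of \<Gamma> c H" using H by blast
    have "int (card H) * int (card (SH H)) = int (card H) * int (card (TH H))"
      unfolding SH_def TH_def S.count_stab_half[OF h] T.count_stab_half[OF h]
      by (intro sum.cong refl) (simp add: fixed)
    moreover have "card H \<noteq> 0"
    proof -
      have "\<one>\<^bsub>\<Gamma>\<^esub> \<in> H" using h S.one_closed unfolding half_of_def by (metis S.l_one)
      moreover have "finite H" using h S.finite_group finite_subset unfolding half_of_def by blast
      ultimately show ?thesis by auto
    qed
    ultimately show ?thesis by simp
  qed
  have local_iso: "\<exists>f. bij_betw f (SH H) (TH H) \<and> (\<forall>x\<in>SH H. f (actS x c) = actT (f x) c)"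
    if H: "H = carrier \<Gamma> \<or> half_of \<Gamma> c H" for H
  proof (cases "H = carrier \<Gamma>")
    case True
    have "finite (SH H)" "finite (TH H)" unfolding SH_def TH_def using S.finite_S T.finite_S by auto
    then obtain f where f: "bij_betw f (SH H) (TH H)" using eq_card[OF H] by (metis finite_same_card_bij)
    then have "f x \<in> TH H" if "x \<in> SH H" for x using that by (auto simp: bij_betw_def)
    then have "\<forall>x\<in>SH H. f (actS x c) = actT (f x) c" using full full' True by simp
    then show ?thesis using f by blast
  next
    case False
    then have h: "half_of \<Gamma> c H" using H by blast
    show ?thesis
    proof (rule involution_bijection)
      show "finite (SH H)" "finite (TH H)" unfolding SH_def TH_def using S.finite_S T.finite_S by auto
      show "card (SH H) = card (TH H)" by (rule eq_card[OF H])
      show "actS x c \<in> SH H \<and> actS (actS x c) c = x \<and> actS x c \<noteq> x" if "x \<in> SH H" for x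
        using that h S.stab_c[of x] S.c_moves[of x] S.act_closed[of x c] S.c unfolding SH_def by auto
      show "actT x c \<in> TH H \<and> actT (actT x c) c = x \<and> actT x c \<noteq> x" if "x \<in> TH H" for x
        using that h T.stab_c[of x] T.c_moves[of x] T.act_closed[of x c] T.c unfolding TH_def by auto
    qed
  qed
  have "\<exists>f. (H = carrier \<Gamma> \<or> half_of \<Gamma> c H) \<longrightarrow> bij_betw f (SH H) (TH H) \<and> (\<forall>x\<in>SH H. f (actS x c) = actT (f x) c)" for H
    using local_iso[of H] by (cases "H = carrier \<Gamma> \<or> half_of \<Gamma> c H") simp_all
  then have "\<forall>H. \<exists>f. (H = carrier \<Gamma> \<or> half_of \<Gamma> c H) \<longrightarrow> bij_betw f (SH H) (TH H) \<and> (\<forall>x\<in>SH H. f (actS x c) = actT (f x) c)"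
    by (rule allI)
  then obtain F where "\<forall>H. (H = carrier \<Gamma> \<or> half_of \<Gamma> c H) \<longrightarrow> bij_betw (F H) (SH H) (TH H) \<and> (\<forall>x\<in>SH H. F H (actS x c) = actT (F H x) c)"
    by (rule choice[THEN exE])
  then have F: "bij_betw (F H) (SH H) (TH H)" "\<And>x. x \<in> SH H \<Longrightarrow> F H (actS x c) = actT (F H x) c"
    if "H = carrier \<Gamma> \<or> half_of \<Gamma> c H" for H using that by auto
  define \<alpha> where "\<alpha> = (\<lambda>x. F (S.stab x) x)"
  have \<alpha>T: "\<alpha> x \<in> T" "T.stab (\<alpha> x) = S.stab x" if x: "x \<in> S" for x
  proof -
    have "x \<in> SH (S.stab x)" unfolding SH_def using x by simp
    then have "\<alpha> x \<in> TH (S.stab x)" unfolding \<alpha>_def using F(1)[OF S.stab_cases[OF x]] by (auto simp: bij_betw_def)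
    then show "\<alpha> x \<in> T" "T.stab (\<alpha> x) = S.stab x" unfolding TH_def by auto
  qed
  have "bij_betw \<alpha> S T"
    unfolding bij_betw_def
  proof (intro conjI inj_onI equalityI subsetI)
    fix x x' assume x: "x \<in> S" "x' \<in> S" "\<alpha> x = \<alpha> x'"
    then have st: "S.stab x = S.stab x'" using \<alpha>T by metis
    then have "x \<in> SH (S.stab x)" "x' \<in> SH (S.stab x)" using x unfolding SH_def by auto
    moreover have "F (S.stab x) x = F (S.stab x) x'" using x(3) st unfolding \<alpha>_def by simp
    ultimately show "x = x'" using F(1)[OF S.stab_cases[OF x(1)]] by (meson bij_betw_def inj_onD)
  next
    fix y assume "y \<in> \<alpha> ` S" then show "y \<in> T" using \<alpha>T by blast
  next
    fix y assume y: "y \<in> T"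
    have "y \<in> TH (T.stab y)" unfolding TH_def using y by simp
    then have "y \<in> F (T.stab y) ` SH (T.stab y)" using F(1)[OF T.stab_cases[OF y]] by (simp add: bij_betw_def)
    then obtain x where "x \<in> SH (T.stab y)" "y = F (T.stab y) x" by blast
    then have "x \<in> S" "y = \<alpha> x" unfolding SH_def \<alpha>_def by auto
    then show "y \<in> \<alpha> ` S" by blast
  qed
  moreover have "\<alpha> (actS x g) = actT (\<alpha> x) g" if x: "x \<in> S" and g: "g \<in> carrier \<Gamma>" for x g
  proof (cases "g \<in> S.stab x")
    case True
    then have "g \<in> T.stab (\<alpha> x)" using \<alpha>T(2)[OF x] by simp
    then show ?thesis using True unfolding S.stab_def T.stab_def by simp
  next
    case False
    then have ng: "actS x g \<noteq> x" "g \<notin> T.stab (\<alpha> x)" using \<alpha>T(2)[OF x] g unfolding S.stab_def by auto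
    then have "actS x g = actS x c" using S.small[OF x g] by simp
    then have "\<alpha> (actS x g) = F (S.stab x) (actS x c)" unfolding \<alpha>_def using S.stab_c(1)[OF x] by simp
    also have "\<dots> = actT (\<alpha> x) c"
      unfolding \<alpha>_def by (rule F(2)[OF S.stab_cases[OF x]]) (simp add: SH_def x)
    also have "\<dots> = actT (\<alpha> x) g"
      using ng(2) T.small[OF \<alpha>T(1)[OF x] g] g unfolding T.stab_def by auto
    finally show ?thesis .
  qed
  ultimately show ?thesis by blast
qed


section \<open>The two Galois actions\<close>

context fin_group
begin

lemma conj_class_eq: "x \<in> carrier G \<Longrightarrow> conj_class G x = (\<lambda>t. t \<otimes> x \<otimes> inv t) ` carrier G"
  unfolding conj_class_def orbit_def by auto

lemma conj_classes_eq: "conj_classes G = conj_class G ` carrier G"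
  unfolding conj_classes_def orbits_def conj_class_def by auto

lemma conj_class_self: "x \<in> carrier G \<Longrightarrow> x \<in> conj_class G x"
  unfolding conj_class_eq by (rule image_eqI[of _ _ \<one>]) auto

lemma conj_class_closed: "x \<in> carrier G \<Longrightarrow> y \<in> conj_class G x \<Longrightarrow> y \<in> carrier G"
  unfolding conj_class_eq by auto

lemma conj_class_conj:
  assumes x: "x \<in> carrier G" and s: "s \<in> carrier G"
  shows "conj_class G (s \<otimes> x \<otimes> inv s) = conj_class G x"
proof -
  have sx: "s \<otimes> x \<otimes> inv s \<in> carrier G" using x s by simp
  have "(\<lambda>t. t \<otimes> x \<otimes> inv t) ` carrier G = (\<lambda>t. t \<otimes> x \<otimes> inv t) ` (\<lambda>t. t \<otimes> s) ` carrier G"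
    using bij_betw_imp_surj_on[OF bij_right[OF s]] by simp
  also have "\<dots> = (\<lambda>t. (t \<otimes> s) \<otimes> x \<otimes> inv (t \<otimes> s)) ` carrier G" by (simp only: image_image)
  also have "\<dots> = (\<lambda>t. t \<otimes> (s \<otimes> x \<otimes> inv s) \<otimes> inv t) ` carrier G"
    using x s by (intro image_cong refl) (simp add: m_assoc inv_mult_group)
  finally show ?thesis unfolding conj_class_eq[OF sx] conj_class_eq[OF x] by simp
qed

lemma conj_class_eqI:
  assumes x: "x \<in> carrier G" and y: "y \<in> conj_class G x"
  shows "conj_class G y = conj_class G x"
proof -
  obtain s where "s \<in> carrier G" "y = s \<otimes> x \<otimes> inv s" using y unfolding conj_class_eq[OF x] by blast
  then show ?thesis using conj_class_conj[OF x] by simp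
qed

lemma conj_class_eq_iff:
  assumes "x \<in> carrier G" "y \<in> carrier G"
  shows "conj_class G x = conj_class G y \<longleftrightarrow> (\<exists>t\<in>carrier G. t \<otimes> x \<otimes> inv t = y)"
proof
  assume "conj_class G x = conj_class G y"
  then have "y \<in> conj_class G x" using conj_class_self[OF assms(2)] by simp
  then show "\<exists>t\<in>carrier G. t \<otimes> x \<otimes> inv t = y" unfolding conj_class_eq[OF assms(1)] by blast
next
  assume "\<exists>t\<in>carrier G. t \<otimes> x \<otimes> inv t = y"
  then have "y \<in> conj_class G x" unfolding conj_class_eq[OF assms(1)] by blast
  from conj_class_eqI[OF assms(1) this] show "conj_class G x = conj_class G y" by simp
qed

lemma conj_pow:
  assumes "t \<in> carrier G" "x \<in> carrier G"
  shows "(t \<otimes> x \<otimes> inv t) [^] (k::nat) = t \<otimes> x [^] k \<otimes> inv t"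
proof (induction k)
  case 0 then show ?case using assms by simp
next
  case (Suc k)
  have cancel: "inv t \<otimes> (t \<otimes> (x \<otimes> inv t)) = x \<otimes> inv t" using assms by (simp add: m_assoc[symmetric])
  have "(t \<otimes> x \<otimes> inv t) [^] Suc k = (t \<otimes> x [^] k \<otimes> inv t) \<otimes> (t \<otimes> x \<otimes> inv t)" using Suc by simp
  also have "\<dots> = t \<otimes> (x [^] k \<otimes> x) \<otimes> inv t" using assms by (simp add: m_assoc cancel)
  finally show ?case by simp
qed

text \<open>
  The sets of conjugators partition \<open>G\<close> if \<open>y\<close> lies in the class \<open>C\<close>, and are empty otherwise.
\<close>
lemma sum_conjugators:
  assumes C: "C \<in> conj_classes G" and y: "y \<in> carrier G"
  shows "(\<Sum>g\<in>C. card {t \<in> carrier G. t \<otimes> y \<otimes> inv t = g}) = (if y \<in> C then cardG else 0)"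
proof -
  obtain x where x: "x \<in> carrier G" "C = conj_class G x" using C unfolding conj_classes_eq by blast
  have CG: "C \<subseteq> carrier G" using conj_class_closed[OF x(1)] x(2) by blast
  have fin: "finite C" using CG finite_carrier by (rule finite_subset)
  have disj: "(\<Sum>g\<in>C. card {t \<in> carrier G. t \<otimes> y \<otimes> inv t = g}) = card (\<Union>g\<in>C. {t \<in> carrier G. t \<otimes> y \<otimes> inv t = g})"
    using fin by (intro card_UN_disjoint[symmetric]) auto
  have "(\<Union>g\<in>C. {t \<in> carrier G. t \<otimes> y \<otimes> inv t = g}) = {t \<in> carrier G. t \<otimes> y \<otimes> inv t \<in> C}" by blast
  moreover have "t \<otimes> y \<otimes> inv t \<in> C \<longleftrightarrow> y \<in> C" if t: "t \<in> carrier G" for t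
  proof -
    have mem: "z \<in> C \<longleftrightarrow> conj_class G z = C" if "z \<in> carrier G" for z
      using conj_class_eqI[OF x(1)] conj_class_self[OF that] x(2) by auto
    show ?thesis using mem[of y] mem[of "t \<otimes> y \<otimes> inv t"] conj_class_conj[OF y t] y t by simp
  qed
  ultimately have "(\<Union>g\<in>C. {t \<in> carrier G. t \<otimes> y \<otimes> inv t = g}) = (if y \<in> C then carrier G else {})" by auto
  then show ?thesis unfolding disj by simp
qed

lemma Irr_inner_real_parts:
  assumes "x \<in> carrier G" "y \<in> carrier G"
  shows "(\<Sum>\<chi>\<in>Irr G. (\<chi> x + \<chi> (inv x)) * \<chi> (inv y))
    = of_nat (card {t \<in> carrier G. t \<otimes> x \<otimes> inv t = y} + card {t \<in> carrier G. t \<otimes> inv x \<otimes> inv t = y})"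
  using Irr_column_orthogonal[OF assms] Irr_column_orthogonal[OF inv_closed[OF assms(1)] assms(2)]
  by (simp add: distrib_right sum.distrib)

text \<open>
  By column orthogonality, pairing the hypothesis with the column of \<open>y\<close> counts conjugators from \<open>y\<close>
  and \<open>y\<^sup>-\<^sup>1\<close> to \<open>y\<close> on one side, which is positive, and from \<open>x\<close> and \<open>x\<^sup>-\<^sup>1\<close> to \<open>y\<close> on the other.
\<close>
lemma real_parts_separate_classes:
  assumes x: "x \<in> carrier G" and y: "y \<in> carrier G"
    and eq: "\<And>\<chi>. \<chi> \<in> Irr G \<Longrightarrow> \<chi> y + \<chi> (inv y) = \<chi> x + \<chi> (inv x)"
  shows "conj_class G y = conj_class G x \<or> conj_class G y = conj_class G (inv x)"
proof -
  have "(\<Sum>\<chi>\<in>Irr G. (\<chi> y + \<chi> (inv y)) * \<chi> (inv y)) = (\<Sum>\<chi>\<in>Irr G. (\<chi> x + \<chi> (inv x)) * \<chi> (inv y))"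
    by (intro sum.cong refl) (simp add: eq)
  then have "card {t \<in> carrier G. t \<otimes> y \<otimes> inv t = y} + card {t \<in> carrier G. t \<otimes> inv y \<otimes> inv t = y}
     = card {t \<in> carrier G. t \<otimes> x \<otimes> inv t = y} + card {t \<in> carrier G. t \<otimes> inv x \<otimes> inv t = y}"
    unfolding Irr_inner_real_parts[OF y y] Irr_inner_real_parts[OF x y] by (simp only: of_nat_eq_iff)
  moreover have "card {t \<in> carrier G. t \<otimes> y \<otimes> inv t = y} > 0"
  proof -
    have "\<one> \<in> {t \<in> carrier G. t \<otimes> y \<otimes> inv t = y}" using y by simp
    moreover have "finite {t \<in> carrier G. t \<otimes> y \<otimes> inv t = y}" by simp
    ultimately show ?thesis by (metis card_gt_0_iff empty_iff)
  qed
  ultimately have "card {t \<in> carrier G. t \<otimes> x \<otimes> inv t = y} \<noteq> 0 \<or> card {t \<in> carrier G. t \<otimes> inv x \<otimes> inv t = y} \<noteq> 0"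
    by linarith
  then have "{t \<in> carrier G. t \<otimes> x \<otimes> inv t = y} \<noteq> {} \<or> {t \<in> carrier G. t \<otimes> inv x \<otimes> inv t = y} \<noteq> {}"
    by (metis card.empty)
  then have "conj_class G x = conj_class G y \<or> conj_class G (inv x) = conj_class G y"
    using conj_class_eq_iff[OF x y] conj_class_eq_iff[OF inv_closed[OF x] y] by blast
  then show ?thesis by auto
qed

end

context cyclotomic_group
begin

lemma ord_dvd_n: "x \<in> carrier G \<Longrightarrow> ord x dvd n"
  using exponent pow_eq_id by blast

lemma pow_cong: "x \<in> carrier G \<Longrightarrow> [m = int k] (mod int (ord x)) \<Longrightarrow> x [^] m = x [^] k"
  by (metis cong_iff_dvd_diff cong_sym int_pow_eq int_pow_int)

lemma galois_exp_pow:
  assumes "\<sigma> \<in> carrier Gal" "\<sigma> \<zeta> = \<zeta> ^ k" "x \<in> carrier G"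
  shows "x [^] galois_exp n \<zeta> \<sigma> = x [^] k"
proof (rule pow_cong[OF assms(3)])
  show "[galois_exp n \<zeta> \<sigma> = int k] (mod int (ord x))"
    by (rule cong_dvd_modulus[OF galois_exp_cong[OF assms(1,2)]]) (simp add: ord_dvd_n[OF assms(3)])
qed

lemma class_action_eq:
  assumes s: "\<sigma> \<in> carrier Gal" "\<sigma> \<zeta> = \<zeta> ^ k" and x: "x \<in> carrier G"
  shows "class_action G n \<zeta> (conj_class G x) \<sigma> = conj_class G (x [^] k)"
proof -
  have "conj_class G (y [^] galois_exp n \<zeta> \<sigma>) = conj_class G (x [^] k)" if y: "y \<in> conj_class G x" for y
  proof -
    obtain t where t: "t \<in> carrier G" "y = t \<otimes> x \<otimes> inv t" using y unfolding conj_class_eq[OF x] by blast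
    then have "y [^] galois_exp n \<zeta> \<sigma> = t \<otimes> x [^] k \<otimes> inv t"
      using galois_exp_pow[OF s, of y] x conj_pow[OF t(1) x] by simp
    then show ?thesis using conj_class_conj[of "x [^] k" t] x t by simp
  qed
  then show ?thesis unfolding class_action_def using conj_class_self[OF x] by auto
qed

lemma Gal_mult_zeta:
  assumes "\<sigma> \<in> carrier Gal" "\<sigma> \<zeta> = \<zeta> ^ k" "\<tau> \<in> carrier Gal" "\<tau> \<zeta> = \<zeta> ^ l"
  shows "(\<sigma> \<otimes>\<^bsub>Gal\<^esub> \<tau>) \<zeta> = \<zeta> ^ (k * l)"
  using assms by (simp add: Gal_mult zeta_in_L Gal_power power_mult)

lemma class_right_action: "right_action Gal (conj_classes G) (class_action G n \<zeta>)"
  unfolding right_action_def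
proof (intro conjI ballI)
  interpret Ga: group Gal by (rule Gal_group)
  show "group Gal" by (rule Gal_group)
  fix C assume "C \<in> conj_classes G"
  then obtain x where x: "x \<in> carrier G" "C = conj_class G x" unfolding conj_classes_eq by blast
  have "\<one>\<^bsub>Gal\<^esub> \<zeta> = \<zeta> ^ 1" by (simp add: Gal_one zeta_in_L)
  from class_action_eq[OF Ga.one_closed this x(1)]
  show "class_action G n \<zeta> C \<one>\<^bsub>Gal\<^esub> = C" using x by simp
  fix \<sigma> assume s: "\<sigma> \<in> carrier Gal"
  obtain k where k: "\<sigma> \<zeta> = \<zeta> ^ k" using Gal_zeta[OF s] by blast
  show "class_action G n \<zeta> C \<sigma> \<in> conj_classes G"
    unfolding x(2) class_action_eq[OF s k x(1)] conj_classes_eq using x(1) by simp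
  fix \<tau> assume t: "\<tau> \<in> carrier Gal"
  obtain l where l: "\<tau> \<zeta> = \<zeta> ^ l" using Gal_zeta[OF t] by blast
  have "class_action G n \<zeta> C (\<sigma> \<otimes>\<^bsub>Gal\<^esub> \<tau>) = conj_class G (x [^] (k * l))"
    unfolding x(2) by (rule class_action_eq[OF Ga.m_closed[OF s t] Gal_mult_zeta[OF s k t l] x(1)])
  also have "\<dots> = class_action G n \<zeta> (class_action G n \<zeta> C \<sigma>) \<tau>"
    unfolding x(2) class_action_eq[OF s k x(1)]
    using class_action_eq[OF t l, of "x [^] k"] x(1) by (simp add: nat_pow_pow)
  finally show "class_action G n \<zeta> C (\<sigma> \<otimes>\<^bsub>Gal\<^esub> \<tau>) = class_action G n \<zeta> (class_action G n \<zeta> C \<sigma>) \<tau>" .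
qed

lemma character_action_eq: "character_action G \<zeta> \<chi> \<sigma> = gal_char (inv\<^bsub>Gal\<^esub> \<sigma>) \<chi>"
  unfolding character_action_def gal_char_def ..

text \<open>
  The group of automorphisms acts on values from the left; inverting makes this a right action.
\<close>
lemma character_right_action: "right_action Gal (Irr G) (character_action G \<zeta>)"
  unfolding right_action_def character_action_eq
proof (intro conjI ballI)
  interpret Ga: group Gal by (rule Gal_group)
  show "group Gal" by (rule Gal_group)
  fix \<chi> assume \<chi>: "\<chi> \<in> Irr G"
  show "gal_char (inv\<^bsub>Gal\<^esub> \<one>\<^bsub>Gal\<^esub>) \<chi> = \<chi>" using gal_char_one[OF \<chi>] by simp
  fix \<sigma> assume s: "\<sigma> \<in> carrier Gal"
  show "gal_char (inv\<^bsub>Gal\<^esub> \<sigma>) \<chi> \<in> Irr G" using s \<chi> by (intro gal_char_Irr) auto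
  fix \<tau> assume t: "\<tau> \<in> carrier Gal"
  show "gal_char (inv\<^bsub>Gal\<^esub> (\<sigma> \<otimes>\<^bsub>Gal\<^esub> \<tau>)) \<chi> = gal_char (inv\<^bsub>Gal\<^esub> \<tau>) (gal_char (inv\<^bsub>Gal\<^esub> \<sigma>) \<chi>)"
    using s t \<chi> by (simp add: Ga.inv_mult_group gal_char_mult)
qed

lemma gal_char_fixed_inv_iff:
  assumes "\<sigma> \<in> carrier Gal" "\<chi> \<in> Irr G"
  shows "gal_char (inv\<^bsub>Gal\<^esub> \<sigma>) \<chi> = \<chi> \<longleftrightarrow> gal_char \<sigma> \<chi> = \<chi>"
proof -
  interpret Ga: group Gal by (rule Gal_group)
  have "gal_char \<sigma> (gal_char (inv\<^bsub>Gal\<^esub> \<sigma>) \<chi>) = \<chi>" "gal_char (inv\<^bsub>Gal\<^esub> \<sigma>) (gal_char \<sigma> \<chi>) = \<chi>"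
    using assms by (simp_all add: gal_char_mult[symmetric] gal_char_one)
  then show ?thesis by metis
qed

text \<open>
  Brauer's permutation lemma. Row orthogonality of \<open>\<chi>\<^sup>\<sigma>\<close> and \<open>\<chi>\<close>, summed over \<open>\<chi>\<close>, counts the fixed
  characters. Exchanging the sums and using \<open>\<sigma>(\<chi>(g)) = \<chi>(g\<^sup>k)\<close>, column orthogonality gives for each
  \<open>g\<close> the number \<open>h(g)\<close> of conjugators from \<open>g\<^sup>k\<close> to \<open>g\<close>, and on each class these add up to the order
  of \<open>G\<close> or to \<open>0\<close>, according to whether the class is fixed.
\<close>
theorem fixed_points_equal:
  assumes s: "\<sigma> \<in> carrier Gal"
  shows "card {C \<in> conj_classes G. class_action G n \<zeta> C \<sigma> = C} = card {\<chi> \<in> Irr G. character_action G \<zeta> \<chi> \<sigma> = \<chi>}"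
proof -
  obtain k where k: "\<sigma> \<zeta> = \<zeta> ^ k" using Gal_zeta[OF s] by blast
  define h where "h = (\<lambda>g. card {t \<in> carrier G. t \<otimes> g [^] k \<otimes> inv t = g})"
  have finC: "finite (conj_classes G)" unfolding conj_classes_eq by simp
  have "(\<Sum>\<chi>\<in>Irr G. \<Sum>g\<in>carrier G. gal_char \<sigma> \<chi> g * \<chi> (inv g))
      = (\<Sum>\<chi>\<in>Irr G. if gal_char \<sigma> \<chi> = \<chi> then of_nat cardG else 0)"
    by (intro sum.cong refl Irr_orthogonal gal_char_Irr[OF s])
  also have "\<dots> = of_nat (cardG * card {\<chi> \<in> Irr G. gal_char \<sigma> \<chi> = \<chi>})"
    using finite_Irr by (simp add: sum.If_cases Int_def)
  finally have irr: "of_nat (cardG * card {\<chi> \<in> Irr G. gal_char \<sigma> \<chi> = \<chi>})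
      = (\<Sum>\<chi>\<in>Irr G. \<Sum>g\<in>carrier G. gal_char \<sigma> \<chi> g * \<chi> (inv g))" by simp
  also have "\<dots> = (\<Sum>g\<in>carrier G. \<Sum>\<chi>\<in>Irr G. gal_char \<sigma> \<chi> g * \<chi> (inv g))" by (rule sum.swap)
  also have "\<dots> = (\<Sum>g\<in>carrier G. of_nat (h g))"
  proof (rule sum.cong[OF refl])
    fix g assume g: "g \<in> carrier G"
    have "(\<Sum>\<chi>\<in>Irr G. gal_char \<sigma> \<chi> g * \<chi> (inv g)) = (\<Sum>\<chi>\<in>Irr G. \<chi> (g [^] k) * \<chi> (inv g))"
      using g by (intro sum.cong refl) (simp add: Gal_Irr_value[OF _ _ s k])
    also have "\<dots> = of_nat (h g)" unfolding h_def using g by (intro Irr_column_orthogonal) auto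
    finally show "(\<Sum>\<chi>\<in>Irr G. gal_char \<sigma> \<chi> g * \<chi> (inv g)) = of_nat (h g)" .
  qed
  also have "\<dots> = of_nat (\<Sum>g\<in>carrier G. h g)" by simp
  finally have irr_count: "cardG * card {\<chi> \<in> Irr G. gal_char \<sigma> \<chi> = \<chi>} = (\<Sum>g\<in>carrier G. h g)"
    by (simp only: of_nat_eq_iff)
  have "carrier G = \<Union> (conj_classes G)"
    unfolding conj_classes_eq using conj_class_self conj_class_closed by blast
  then have "(\<Sum>g\<in>carrier G. h g) = (\<Sum>g\<in>\<Union> (conj_classes G). h g)" by simp
  also have "\<dots> = (\<Sum>C\<in>conj_classes G. \<Sum>g\<in>C. h g)"
  proof (rule sum.Union_disjoint[unfolded comp_def])
    show "\<forall>C\<in>conj_classes G. finite C"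
      unfolding conj_classes_eq by (auto simp: conj_class_eq)
    show "\<forall>C\<in>conj_classes G. \<forall>C'\<in>conj_classes G. C \<noteq> C' \<longrightarrow> C \<inter> C' = {}"
    proof (intro ballI impI)
      fix C C' assume C: "C \<in> conj_classes G" "C' \<in> conj_classes G" "C \<noteq> C'"
      then obtain x y where xy: "x \<in> carrier G" "C = conj_class G x" "y \<in> carrier G" "C' = conj_class G y"
        unfolding conj_classes_eq by blast
      show "C \<inter> C' = {}"
        using conj_class_eqI[OF xy(1)] conj_class_eqI[OF xy(3)] xy C(3) by blast
    qed
  qed
  also have "\<dots> = (\<Sum>C\<in>conj_classes G. if class_action G n \<zeta> C \<sigma> = C then cardG else 0)"
  proof (rule sum.cong[OF refl])
    fix C assume C: "C \<in> conj_classes G"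
    then obtain x where x: "x \<in> carrier G" "C = conj_class G x" unfolding conj_classes_eq by blast
    have "h g = card {t \<in> carrier G. t \<otimes> x [^] k \<otimes> inv t = g}" if g: "g \<in> C" for g
    proof -
      obtain u where u: "u \<in> carrier G" "g = u \<otimes> x \<otimes> inv u" using g unfolding x(2) conj_class_eq[OF x(1)] by blast
      have gk: "g [^] k = u \<otimes> x [^] k \<otimes> inv u" unfolding u(2) by (rule conj_pow[OF u(1) x(1)])
      have eq: "t \<otimes> g [^] k \<otimes> inv t = (t \<otimes> u) \<otimes> x [^] k \<otimes> inv (t \<otimes> u)" if "t \<in> carrier G" for t
        unfolding gk using that u(1) x(1) by (simp add: m_assoc inv_mult_group)
      have "bij_betw (\<lambda>t. t \<otimes> u) {t \<in> carrier G. t \<otimes> g [^] k \<otimes> inv t = g} {t \<in> carrier G. t \<otimes> x [^] k \<otimes> inv t = g}"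
      proof (rule bij_betw_byWitness[where f' = "\<lambda>t. t \<otimes> inv u"])
        show "(\<lambda>t. t \<otimes> inv u) ` {t \<in> carrier G. t \<otimes> x [^] k \<otimes> inv t = g} \<subseteq> {t \<in> carrier G. t \<otimes> g [^] k \<otimes> inv t = g}"
        proof (rule image_subsetI)
          fix t assume t: "t \<in> {t \<in> carrier G. t \<otimes> x [^] k \<otimes> inv t = g}"
          then have "t \<otimes> inv u \<otimes> u = t" using u(1) by (simp add: m_assoc)
          then show "t \<otimes> inv u \<in> {t \<in> carrier G. t \<otimes> g [^] k \<otimes> inv t = g}"
            using t u(1) eq[of "t \<otimes> inv u"] by simp
        qed
      qed (use u(1) eq in \<open>auto simp: m_assoc\<close>)
      then show ?thesis unfolding h_def by (rule bij_betw_same_card)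
    qed
    then have "(\<Sum>g\<in>C. h g) = (\<Sum>g\<in>C. card {t \<in> carrier G. t \<otimes> x [^] k \<otimes> inv t = g})" by (rule sum.cong[OF refl])
    also have "\<dots> = (if x [^] k \<in> C then cardG else 0)" by (rule sum_conjugators[OF C]) (use x in simp)
    also have "x [^] k \<in> C \<longleftrightarrow> class_action G n \<zeta> C \<sigma> = C"
      unfolding x(2) class_action_eq[OF s k x(1)]
      using conj_class_self[of "x [^] k"] conj_class_eqI[OF x(1), of "x [^] k"] x(1) by auto
    finally show "(\<Sum>g\<in>C. h g) = (if class_action G n \<zeta> C \<sigma> = C then cardG else 0)" by simp
  qed
  also have "\<dots> = cardG * card {C \<in> conj_classes G. class_action G n \<zeta> C \<sigma> = C}"
    using finC by (simp add: sum.If_cases Int_def)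
  finally have "cardG * card {\<chi> \<in> Irr G. gal_char \<sigma> \<chi> = \<chi>} = cardG * card {C \<in> conj_classes G. class_action G n \<zeta> C \<sigma> = C}"
    using irr_count by simp
  then have "card {\<chi> \<in> Irr G. gal_char \<sigma> \<chi> = \<chi>} = card {C \<in> conj_classes G. class_action G n \<zeta> C \<sigma> = C}"
    using cardG_pos by simp
  moreover have "{\<chi> \<in> Irr G. character_action G \<zeta> \<chi> \<sigma> = \<chi>} = {\<chi> \<in> Irr G. gal_char \<sigma> \<chi> = \<chi>}"
    unfolding character_action_eq using gal_char_fixed_inv_iff[OF s] by blast
  ultimately show ?thesis by simp
qed

text \<open>
  The conjugate \<open>\<phi> = \<chi>\<^sup>\<sigma>\<close> satisfies \<open>\<phi> + \<phi>\<^sup>c = \<chi> + \<chi>\<^sup>c\<close>. Pairing with \<open>\<phi>\<close> gives something positive on the left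
  and zero on the right unless \<open>\<phi>\<close> is \<open>\<chi>\<close> or \<open>\<chi>\<^sup>c\<close>.
\<close>
lemma cut_group_conjugate_cases:
  assumes cut: "cut_group G" and \<chi>: "\<chi> \<in> Irr G" and s: "\<sigma> \<in> carrier Gal"
    and c: "c \<in> carrier Gal" "\<And>x. x \<in> L \<Longrightarrow> c x = cnj x"
  shows "gal_char \<sigma> \<chi> = \<chi> \<or> gal_char \<sigma> \<chi> = gal_char c \<chi>"
proof (rule ccontr)
  assume "\<not> ?thesis"
  then have ne: "\<chi> \<noteq> gal_char \<sigma> \<chi>" "gal_char c \<chi> \<noteq> gal_char \<sigma> \<chi>" by auto
  define \<phi> where "\<phi> = gal_char \<sigma> \<chi>"
  have \<phi>: "\<phi> \<in> Irr G" unfolding \<phi>_def by (rule gal_char_Irr[OF s \<chi>])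
  have conj_val: "gal_char c \<psi> g = \<psi> (inv g)" if "\<psi> \<in> Irr G" "g \<in> carrier G" for \<psi> g
    using that c(2)[OF Irr_L[OF that]] Irr_cnj[OF that] by simp
  have real: "\<phi> g + gal_char c \<phi> g = \<chi> g + gal_char c \<chi> g" if g: "g \<in> carrier G" for g
  proof -
    have "\<phi> g + \<phi> (inv g) = \<sigma> (\<chi> g + \<chi> (inv g))"
      unfolding \<phi>_def using g by (simp add: Gal_add[OF s] Irr_L[OF \<chi>])
    also have "\<dots> = \<chi> g + \<chi> (inv g)" by (rule cut_group_real_part_fixed[OF cut \<chi> g s])
    finally show ?thesis using conj_val[OF \<phi> g] conj_val[OF \<chi> g] by simp
  qed
  have "(\<Sum>g\<in>carrier G. (\<phi> g + gal_char c \<phi> g) * \<phi> (inv g)) = (\<Sum>g\<in>carrier G. (\<chi> g + gal_char c \<chi> g) * \<phi> (inv g))"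
    by (intro sum.cong refl) (simp only: real)
  then have "(\<Sum>g\<in>carrier G. \<phi> g * \<phi> (inv g)) + (\<Sum>g\<in>carrier G. gal_char c \<phi> g * \<phi> (inv g))
     = (\<Sum>g\<in>carrier G. \<chi> g * \<phi> (inv g)) + (\<Sum>g\<in>carrier G. gal_char c \<chi> g * \<phi> (inv g))"
    by (simp only: distrib_right sum.distrib)
  then have "of_nat cardG + (if gal_char c \<phi> = \<phi> then of_nat cardG else 0) = (0 :: complex)"
    unfolding Irr_orthogonal[OF \<phi> \<phi>] Irr_orthogonal[OF gal_char_Irr[OF c(1) \<phi>] \<phi>]
      Irr_orthogonal[OF \<chi> \<phi>] Irr_orthogonal[OF gal_char_Irr[OF c(1) \<chi>] \<phi>]
    using ne unfolding \<phi>_def by simp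
  then have "of_nat (cardG + (if gal_char c \<phi> = \<phi> then cardG else 0)) = (of_nat 0 :: complex)"
    by (simp split: if_splits)
  then have "cardG + (if gal_char c \<phi> = \<phi> then cardG else 0) = 0" by (simp only: of_nat_eq_iff)
  then show False using cardG_pos by simp
qed

text \<open>
  Both actions have orbits of the form \<open>{x, x\<^sup>c}\<close> with \<open>c\<close> complex conjugation. On classes \<open>c\<close> is
  inversion, because a character takes conjugate values at inverse elements.
\<close>
theorem cut_group_actions_isomorphic:
  assumes cut: "cut_group G"
  shows "permutation_isomorphic Gal (conj_classes G) (class_action G n \<zeta>) (Irr G) (character_action G \<zeta>)"
proof -
  interpret Ga: group Gal by (rule Gal_group)
  obtain c where c: "c \<in> carrier Gal" "\<And>x. x \<in> L \<Longrightarrow> c x = cnj x" using cnj_Gal by blast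
  have c_inv: "(inv\<^bsub>Gal\<^esub> c) x = cnj x" if "x \<in> L" for x
  proof -
    have "cnj ((inv\<^bsub>Gal\<^esub> c) x) = c ((inv\<^bsub>Gal\<^esub> c) x)" using c that by (simp add: Gal_closed)
    also have "\<dots> = x" by (rule Gal_inv[OF c(1) that])
    finally show ?thesis by (metis complex_cnj_cnj)
  qed
  have characters: "small_orbit_action Gal (Irr G) (character_action G \<zeta>) c"
  proof (unfold_locales)
    show "right_action Gal (Irr G) (character_action G \<zeta>)" by (rule character_right_action)
    show "finite (Irr G)" by (rule finite_Irr)
    show "finite (carrier Gal)" by (rule finite_Gal)
    show "c \<in> carrier Gal" by (rule c)
    fix \<chi> \<sigma> assume "\<chi> \<in> Irr G" "\<sigma> \<in> carrier Gal"
    then show "character_action G \<zeta> \<chi> \<sigma> = \<chi> \<or> character_action G \<zeta> \<chi> \<sigma> = character_action G \<zeta> \<chi> c"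
      unfolding character_action_eq using cut_group_conjugate_cases[OF cut _ _ _ c_inv] c(1) by simp
  qed
  have classes: "small_orbit_action Gal (conj_classes G) (class_action G n \<zeta>) c"
  proof (unfold_locales)
    show "right_action Gal (conj_classes G) (class_action G n \<zeta>)" by (rule class_right_action)
    show "finite (conj_classes G)" unfolding conj_classes_eq by simp
    show "finite (carrier Gal)" by (rule finite_Gal)
    show "c \<in> carrier Gal" by (rule c)
    fix C \<sigma> assume "C \<in> conj_classes G" and s: "\<sigma> \<in> carrier Gal"
    then obtain x where x: "x \<in> carrier G" "C = conj_class G x" unfolding conj_classes_eq by blast
    have cases: "conj_class G (x [^] k) = conj_class G x \<or> conj_class G (x [^] k) = conj_class G (inv x)"
      if t: "\<tau> \<in> carrier Gal" "\<tau> \<zeta> = \<zeta> ^ k" for \<tau> k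
    proof (rule real_parts_separate_classes)
      fix \<chi> assume \<chi>: "\<chi> \<in> Irr G"
      have "\<chi> (x [^] k) + \<chi> (inv (x [^] k)) = \<chi> (x [^] k) + \<chi> (inv x [^] k)"
        using x(1) by (simp add: nat_pow_inv)
      also have "\<dots> = \<tau> (\<chi> x + \<chi> (inv x))"
        using x(1) Gal_Irr_value[OF \<chi> _ t] by (simp add: Gal_add[OF t(1)] Irr_L[OF \<chi>])
      also have "\<dots> = \<chi> x + \<chi> (inv x)" by (rule cut_group_real_part_fixed[OF cut \<chi> x(1) t(1)])
      finally show "\<chi> (x [^] k) + \<chi> (inv (x [^] k)) = \<chi> x + \<chi> (inv x)" .
    qed (use x in auto)
    obtain k where k: "\<sigma> \<zeta> = \<zeta> ^ k" using Gal_zeta[OF s] by blast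
    obtain j where j: "c \<zeta> = \<zeta> ^ j" using Gal_zeta[OF c(1)] by blast
    have "conj_class G (x [^] j) = conj_class G (inv x)"
    proof -
      have "(\<Sum>\<chi>\<in>Irr G. \<chi> (x [^] j) * \<chi> (inv (inv x))) = (\<Sum>\<chi>\<in>Irr G. \<chi> (inv x) * \<chi> (inv (inv x)))"
        using x(1) by (intro sum.cong refl)
          (simp add: Gal_Irr_value[OF _ _ c(1) j, symmetric] c(2)[OF Irr_L] Irr_cnj)
      then have "card {t \<in> carrier G. t \<otimes> x [^] j \<otimes> inv t = inv x} = card {t \<in> carrier G. t \<otimes> inv x \<otimes> inv t = inv x}"
        using x(1) Irr_column_orthogonal[of "x [^] j" "inv x"] Irr_column_orthogonal[of "inv x" "inv x"] by simp
      moreover have "\<one> \<in> {t \<in> carrier G. t \<otimes> inv x \<otimes> inv t = inv x}" using x(1) by simp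
      then have "card {t \<in> carrier G. t \<otimes> inv x \<otimes> inv t = inv x} \<noteq> 0" by (auto simp: card_eq_0_iff)
      ultimately have "{t \<in> carrier G. t \<otimes> x [^] j \<otimes> inv t = inv x} \<noteq> {}" by (metis card.empty)
      then show ?thesis using conj_class_eq_iff[of "x [^] j" "inv x"] x(1) by blast
    qed
    then show "class_action G n \<zeta> C \<sigma> = C \<or> class_action G n \<zeta> C \<sigma> = class_action G n \<zeta> C c"
      unfolding x(2) class_action_eq[OF s k x(1)] class_action_eq[OF c(1) j x(1)] using cases[OF s k] by simp
  qed
  show ?thesis
    unfolding permutation_isomorphic_def
    using class_right_action character_right_action
      small_orbit_actions_isomorphic[OF classes characters fixed_points_equal] by blast
qed

text \<open>
  The exponents prime to the order of an element lift to exponents prime to \<open>n\<close>, which are the ones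
  realized by the Galois group.
\<close>
lemma rational_class_iff:
  assumes C: "C \<in> conj_classes G"
  shows "rational_class G C \<longleftrightarrow> (\<forall>\<sigma>\<in>carrier Gal. class_action G n \<zeta> C \<sigma> = C)"
proof
  obtain x where x: "x \<in> carrier G" "C = conj_class G x" using C unfolding conj_classes_eq by blast
  assume r: "rational_class G C"
  show "\<forall>\<sigma>\<in>carrier Gal. class_action G n \<zeta> C \<sigma> = C"
  proof
    fix \<sigma> assume s: "\<sigma> \<in> carrier Gal"
    obtain k where k: "coprime k n" "\<sigma> \<zeta> = \<zeta> ^ k" using Gal_zeta[OF s] by blast
    have "coprime (int k) (int (ord x))"
      using k(1) ord_dvd_n[OF x(1)] by (simp add: coprime_divisors[of k k "ord x" n])
    then have "x [^] int k \<in> conj_class G x"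
      using r conj_class_self[OF x(1)] unfolding rational_class_def rational_elem_def x(2) by blast
    then show "class_action G n \<zeta> C \<sigma> = C"
      unfolding x(2) class_action_eq[OF s k(2) x(1)] using conj_class_eqI[OF x(1)] by (simp add: int_pow_int)
  qed
next
  assume f: "\<forall>\<sigma>\<in>carrier Gal. class_action G n \<zeta> C \<sigma> = C"
  show "rational_class G C"
    unfolding rational_class_def rational_elem_def
  proof (intro ballI allI impI)
    fix y and j :: int assume y: "y \<in> C" and j: "coprime j (int (ord y))"
    obtain x where x: "x \<in> carrier G" "C = conj_class G x" using C unfolding conj_classes_eq by blast
    have yG: "y \<in> carrier G" using conj_class_closed[OF x(1)] y x(2) by blast
    have Cy: "C = conj_class G y" using conj_class_eqI[OF x(1)] y x(2) by simp
    have ordpos: "ord y > 0" using ord_dvd_n[OF yG] n_pos by (meson dvd_pos_nat)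
    define i where "i = nat (j mod int (ord y))"
    have i: "int i = j mod int (ord y)" unfolding i_def using ordpos by simp
    have "coprime (int i) (int (ord y))" unfolding i using j by (metis coprime_mod_left_iff ordpos of_nat_0_less_iff less_irrefl)
    then have "coprime i (ord y)" by simp
    then obtain m where m: "[m = i] (mod ord y)" "coprime m n" using coprime_lift_modulus[OF _ n_pos] by metis
    obtain \<sigma> where s: "\<sigma> \<in> carrier Gal" "\<sigma> \<zeta> = \<zeta> ^ m" using Gal_exists[OF m(2)] by blast
    have "[j = int m] (mod int (ord y))"
    proof -
      have "[int m = int i] (mod int (ord y))" using m(1) by (simp add: cong_int_iff)
      then show ?thesis unfolding i by (simp add: cong_def)
    qed
    then have "y [^] j = y [^] m" by (rule pow_cong[OF yG])
    also have "y [^] m \<in> conj_class G (y [^] m)" using yG by (intro conj_class_self) simp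
    also have "conj_class G (y [^] m) = conj_class G y"
      using f s(1) class_action_eq[OF s yG] unfolding Cy by simp
    finally show "y [^] j \<in> conj_class G y" .
  qed
qed

lemma rational_character_iff:
  assumes \<chi>: "\<chi> \<in> Irr G"
  shows "rational_character G \<chi> \<longleftrightarrow> (\<forall>\<sigma>\<in>carrier Gal. character_action G \<zeta> \<chi> \<sigma> = \<chi>)"
proof
  assume r: "rational_character G \<chi>"
  show "\<forall>\<sigma>\<in>carrier Gal. character_action G \<zeta> \<chi> \<sigma> = \<chi>"
  proof
    fix \<sigma> assume s: "\<sigma> \<in> carrier Gal"
    have "gal_char \<sigma> \<chi> = \<chi>"
      using r by (intro Irr_eqI[OF gal_char_Irr[OF s \<chi>] \<chi>]) (simp add: rational_character_def Gal_Rats[OF s])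
    then show "character_action G \<zeta> \<chi> \<sigma> = \<chi>"
      unfolding character_action_eq using gal_char_fixed_inv_iff[OF s \<chi>] by simp
  qed
next
  assume f: "\<forall>\<sigma>\<in>carrier Gal. character_action G \<zeta> \<chi> \<sigma> = \<chi>"
  show "rational_character G \<chi>"
    unfolding rational_character_def
  proof
    fix g assume g: "g \<in> carrier G"
    show "\<chi> g \<in> \<rat>"
    proof (rule Gal_fixed_rational[OF Irr_L[OF \<chi> g]])
      fix \<sigma> assume s: "\<sigma> \<in> carrier Gal"
      have "gal_char \<sigma> \<chi> = \<chi>" using f s gal_char_fixed_inv_iff[OF s \<chi>] unfolding character_action_eq by blast
      then show "\<sigma> (\<chi> g) = \<chi> g" using gal_char_apply[OF g, of \<sigma> \<chi>] by simp
    qed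
  qed
qed

end

lemma permutation_isomorphic_card_fixed:
  assumes "permutation_isomorphic \<Gamma> S actS T actT"
  shows "card {x \<in> S. \<forall>g\<in>carrier \<Gamma>. actS x g = x} = card {y \<in> T. \<forall>g\<in>carrier \<Gamma>. actT y g = y}"
proof -
  obtain \<alpha> where \<alpha>: "bij_betw \<alpha> S T" "\<And>x g. x \<in> S \<Longrightarrow> g \<in> carrier \<Gamma> \<Longrightarrow> \<alpha> (actS x g) = actT (\<alpha> x) g"
    and closed: "\<And>x g. x \<in> S \<Longrightarrow> g \<in> carrier \<Gamma> \<Longrightarrow> actS x g \<in> S"
    using assms unfolding permutation_isomorphic_def right_action_def by (elim exE conjE) simp
  have fix_iff: "actS x g = x \<longleftrightarrow> actT (\<alpha> x) g = \<alpha> x" if "x \<in> S" "g \<in> carrier \<Gamma>" for x g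
    using inj_on_eq_iff[OF bij_betw_imp_inj_on[OF \<alpha>(1)] closed[OF that] that(1)] \<alpha>(2)[OF that] by simp
  have "bij_betw \<alpha> {x \<in> S. \<forall>g\<in>carrier \<Gamma>. actS x g = x} {y \<in> T. \<forall>g\<in>carrier \<Gamma>. actT y g = y}"
    unfolding bij_betw_def
  proof
    show "inj_on \<alpha> {x \<in> S. \<forall>g\<in>carrier \<Gamma>. actS x g = x}"
      using \<alpha>(1) by (auto simp: bij_betw_def intro: inj_on_subset)
    show "\<alpha> ` {x \<in> S. \<forall>g\<in>carrier \<Gamma>. actS x g = x} = {y \<in> T. \<forall>g\<in>carrier \<Gamma>. actT y g = y}"
      using fix_iff unfolding bij_betw_imp_surj_on[OF \<alpha>(1), symmetric] by auto
  qed
  then show ?thesis by (rule bij_betw_same_card)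
qed

theorem theorem1:
  fixes G :: "('a, 'b) monoid_scheme" and n :: nat and \<zeta> :: complex
  assumes "cut_group G"
    and "n > 0"
    and "group_exponent G dvd n"
    and "primitive_root_of_unity n \<zeta>"
  shows "permutation_isomorphic (cyclotomic_galois \<zeta>)
           (conj_classes G) (class_action G n \<zeta>)
           (Irr G) (character_action G \<zeta>)
         \<and> card {\<chi> \<in> Irr G. rational_character G \<chi>} = card {C \<in> conj_classes G. rational_class G C}"
proof -
  interpret group G using assms(1) unfolding cut_group_def by blast
  have "cyclotomic_group G n \<zeta>"
  proof unfold_locales
    show "finite (carrier G)" using assms(1) unfolding cut_group_def by blast
    show "0 < n" "primitive_root_of_unity n \<zeta>" by fact+
    fix g assume g: "g \<in> carrier G"
    then have "ord g dvd group_exponent G" unfolding group_exponent_def by (intro dvd_Lcm) auto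
    then have "ord g dvd n" using assms(3) by (rule dvd_trans)
    then show "g [^]\<^bsub>G\<^esub> n = \<one>\<^bsub>G\<^esub>" using pow_eq_id[OF g] by blast
  qed
  then interpret cyclotomic_group G n \<zeta> .
  have iso: "permutation_isomorphic (cyclotomic_galois \<zeta>)
           (conj_classes G) (class_action G n \<zeta>) (Irr G) (character_action G \<zeta>)"
    by (rule cut_group_actions_isomorphic[OF assms(1)])
  have "{\<chi> \<in> Irr G. rational_character G \<chi>} = {\<chi> \<in> Irr G. \<forall>\<sigma>\<in>carrier (cyclotomic_galois \<zeta>). character_action G \<zeta> \<chi> \<sigma> = \<chi>}"
    using rational_character_iff by blast
  moreover have "{C \<in> conj_classes G. rational_class G C}
      = {C \<in> conj_classes G. \<forall>\<sigma>\<in>carrier (cyclotomic_galois \<zeta>). class_action G n \<zeta> C \<sigma> = C}"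
    using rational_class_iff by blast
  ultimately show ?thesis using iso permutation_isomorphic_card_fixed[OF iso] by simp
qed

end
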